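(* Let $n\ge 2$, let $i$ be an integer with $0<i<n$, and let $f\in L^1(S^{n-1})$. Then $$Mf=R_i^*\,R_{n-i,\perp}f .$$
   Context: $S^{n-1}$ is the unit sphere in $\mathbb{R}^n$ with the rotation-invariant measure $d\theta$ normalized to total mass $1$. For an integer $1\le k\le n-1$, $G_{n,k}$ is the Grassmann manifold of $k$-dimensional linear subspaces of $\mathbb{R}^n$ with the normalized $SO(n)$-invariant measure. For continuous $f$ on $S^{n-1}$ and $\varphi$ on $G_{n,k}$ set $$(R_kf)(\xi)=\int_{S^{n-1}\cap\xi}f(\theta)\,d_\xi\theta,\ \ \xi\in G_{n,k},\qquad (R_k^*\varphi)(\theta)=\int_{\xi\ni\theta}\varphi(\xi)\,d_\theta\xi,\ \ \theta\in S^{n-1},$$ where $d_\xi\theta$ is the rotation-invariant probability measure on $S^{n-1}\cap\xi$ and $d_\theta\xi$ is the invariant probability measure on $\{\xi\in G_{n,k}:\xi\ni\theta\}$. Precisely, $(R_k^*\varphi)(\theta)=\int_{SO(n-1)}\varphi(r_\theta\gamma p_0)\,d\gamma$, where $p_0=\mathbb{R}e_{n-k+1}+\dots+\mathbb{R}e_n$, $r_\theta\in SO(n)$ satisfies $r_\theta e_n=\theta$, $SO(n-1)$ is the subgroup of $SO(n)$ fixing $e_n$, and $d\gamma$ is the normalized Haar measure. $R_k$ and $R_k^*$ extend to bounded operators $L^1(S^{n-1})\to L^1(G_{n,k})$ and $L^1(G_{n,k})\to L^1(S^{n-1})$. For $\xi\in G_{n,i}$, $(R_{n-i,\perp}f)(\xi)=(R_{n-i}f)(\xi^\perp)$,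 where $\xi^\perp$ is the orthogonal complement of $\xi$. The Minkowski-Funk transform is $(Mf)(u)=(R_{n-1}f)(u^\perp)=\int_{\{\theta\in S^{n-1}:\theta\cdot u=0\}}f(\theta)\,d_u\theta$, $u\in S^{n-1}$, with $d_u\theta$ the normalized invariant measure. For $L^1$ functions the identity is an identity of elements of $L^1(S^{n-1})$. *)

theory Defs
  imports "HOL-Analysis.Analysis"
begin

text \<open>
  The space \<open>\<real>\<^sup>n\<close> is \<^typ>\<open>real ^ 'n\<close> with \<open>n = CARD('n)\<close>. A linear order on the
  index type \<open>'n\<close> numbers the standard basis as \<open>e\<^sub>1, \<dots>, e\<^sub>n\<close>. Functions are scalar valued in
  \<open>'c\<close>, a complete real normed field, that is \<open>\<real>\<close> or \<open>\<complex>\<close>.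
\<close>

subsection \<open>Invariant probability measures\<close>

text \<open>
  \<open>N\<close> only supplies the underlying measurable space.
\<close>

definition invariant_prob :: "'a measure \<Rightarrow> ('a \<Rightarrow> 'a) set \<Rightarrow> 'a measure" where
  "invariant_prob N \<T> =
     (THE \<mu>. sets \<mu> = sets N \<and> emeasure \<mu> (space \<mu>) = 1 \<and> (\<forall>T\<in>\<T>. distr \<mu> N T = \<mu>))"

text \<open>
  Haar measure of a compact matrix group \<open>H\<close>; left invariance suffices to characterise it.
\<close>

definition haar_prob :: "(real ^ 'n ^ 'n) set \<Rightarrow> (real ^ 'n ^ 'n) measure" where
  "haar_prob H = invariant_prob (restrict_space borel H) {(\<lambda>h. g ** h) |g. g \<in> H}"

text \<open>
  On the unit sphere of a subspace \<open>\<xi>\<close>, the acting group consists of all rotations of the ambient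
  space that preserve \<open>\<xi>\<close>. If \<open>\<xi>\<close> is a proper subspace these induce every orthogonal map of \<open>\<xi>\<close>;
  in particular, the measure on the two unit vectors of a line gives each of them mass \<open>1/2\<close>.
\<close>

definition section_measure :: "(real ^ 'n) set \<Rightarrow> (real ^ 'n) measure" where
  "section_measure \<xi> = invariant_prob (restrict_space borel (sphere 0 1 \<inter> \<xi>))
     {(\<lambda>x. g *v x) |g. rotation_matrix g \<and> (\<lambda>x. g *v x) ` \<xi> = \<xi>}"

definition sphere_measure :: "(real ^ 'n) measure" where
  "sphere_measure = section_measure UNIV"

subsection \<open>The Grassmann manifold\<close>

definition grassmannian :: "nat \<Rightarrow> (real ^ 'n) set set" where
  "grassmannian k = {\<xi>. subspace \<xi> \<and> dim \<xi> = k}"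

text \<open>
  A subspace is identified with the matrix of its orthogonal projection (nearest point map); this
  embedding into the space of matrices induces the topology.
\<close>

definition grassmann_topology :: "nat \<Rightarrow> (real ^ 'n) set topology" where
  "grassmann_topology k =
     pullback_topology (grassmannian k) (\<lambda>\<xi>. matrix (closest_point \<xi>)) euclidean"

definition grassmann_measure :: "nat \<Rightarrow> (real ^ 'n) set measure" where
  "grassmann_measure k = invariant_prob
     (sigma (grassmannian k) {U. openin (grassmann_topology k) U})
     {(\<lambda>\<xi>. (\<lambda>x. g *v x) ` \<xi>) |g. rotation_matrix g}"

subsection \<open>The transforms of continuous functions\<close>

text \<open>The formula for \<open>R\<^sub>k f\<close> is the same for all \<open>k\<close>; the index only selects its domain.\<close>

definition radon ::
  "(real ^ 'n \<Rightarrow> 'c) \<Rightarrow> (real ^ 'n) set \<Rightarrow> 'c::{real_normed_field, banach, second_countable_topology}"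
  where
  "radon f \<xi> = (\<integral>\<theta>. f \<theta> \<partial>section_measure \<xi>)"

definition last_axis :: "real ^ 'n::{finite, linorder}" where
  "last_axis = axis (Max UNIV) 1"

text \<open>The span of the last \<open>k\<close> basis vectors: those indices with fewer than \<open>k\<close> indices above.\<close>

definition last_plane :: "nat \<Rightarrow> (real ^ 'n::{finite, linorder}) set" where
  "last_plane k = span {axis j 1 |j. card {j<..} < k}"

definition axis_stabilizer :: "(real ^ 'n::{finite, linorder} ^ 'n::{finite, linorder}) set" where
  "axis_stabilizer = {g. rotation_matrix g \<and> g *v last_axis = last_axis}"

definition rotation_to :: "real ^ 'n::{finite, linorder} \<Rightarrow> real ^ 'n::{finite, linorder} ^ 'n::{finite, linorder}" where
  "rotation_to \<theta> = (SOME r. rotation_matrix r \<and> r *v last_axis = \<theta>)"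

definition radon_dual ::
  "nat \<Rightarrow> ((real ^ 'n::{finite, linorder}) set \<Rightarrow> 'c) \<Rightarrow> real ^ 'n::{finite, linorder} \<Rightarrow>
   'c::{real_normed_field, banach, second_countable_topology}"
  where
  "radon_dual k \<phi> \<theta> =
     (\<integral>\<gamma>. \<phi> ((\<lambda>x. (rotation_to \<theta> ** \<gamma>) *v x) ` last_plane k) \<partial>haar_prob axis_stabilizer)"

subsection \<open>Extension to integrable functions\<close>

text \<open>
  Elements of \<open>L\<^sup>1\<close> are represented by integrable functions, so linearity is required up to null
  sets. Together with the bound it forces \<open>T f = T g\<close> almost everywhere if \<open>f = g\<close> almost everywhere.
\<close>

definition L1_bounded_operator ::
  "'a measure \<Rightarrow> 'b measure \<Rightarrow>
   (('a \<Rightarrow> 'c) \<Rightarrow> 'b \<Rightarrow> 'c::{real_normed_field, banach, second_countable_topology}) \<Rightarrow> bool"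
  where
  "L1_bounded_operator \<mu> \<nu> T \<longleftrightarrow>
     (\<forall>f. integrable \<mu> f \<longrightarrow> integrable \<nu> (T f)) \<and>
     (\<forall>f g a b. integrable \<mu> f \<longrightarrow> integrable \<mu> g \<longrightarrow>
        (AE y in \<nu>. T (\<lambda>x. a * f x + b * g x) y = a * T f y + b * T g y)) \<and>
     (\<exists>C. \<forall>f. integrable \<mu> f \<longrightarrow> (\<integral>y. norm (T f y) \<partial>\<nu>) \<le> C * (\<integral>x. norm (f x) \<partial>\<mu>))"

text \<open>
  The bounded extension to \<open>L\<^sup>1\<close> of an operator \<open>T\<close> given on the functions that are continuous in
  the topology \<open>X\<close>; it is determined up to null sets when these are dense.
\<close>

definition L1_extension ::
  "'a topology \<Rightarrow> 'a measure \<Rightarrow> 'b measure \<Rightarrow> (('a \<Rightarrow> 'c) \<Rightarrow> 'b \<Rightarrow> 'c) \<Rightarrow>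
   (('a \<Rightarrow> 'c) \<Rightarrow> 'b \<Rightarrow> 'c::{real_normed_field, banach, second_countable_topology})"
  where
  "L1_extension X \<mu> \<nu> T = (SOME T'. L1_bounded_operator \<mu> \<nu> T' \<and>
     (\<forall>f. continuous_map X euclidean f \<longrightarrow> (AE y in \<nu>. T' f y = T f y)))"

definition radon_L1 ::
  "nat \<Rightarrow> (real ^ 'n \<Rightarrow> 'c) \<Rightarrow> (real ^ 'n) set \<Rightarrow> 'c::{real_normed_field, banach, second_countable_topology}"
  where
  "radon_L1 k =
     L1_extension (top_of_set (sphere 0 1)) sphere_measure (grassmann_measure k) radon"

definition radon_dual_L1 ::
  "nat \<Rightarrow> ((real ^ 'n::{finite, linorder}) set \<Rightarrow> 'c) \<Rightarrow> real ^ 'n::{finite, linorder} \<Rightarrow>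
   'c::{real_normed_field, banach, second_countable_topology}"
  where
  "radon_dual_L1 k =
     L1_extension (grassmann_topology k) (grassmann_measure k) sphere_measure (radon_dual k)"

definition radon_perp_L1 ::
  "nat \<Rightarrow> (real ^ 'n \<Rightarrow> 'c) \<Rightarrow> (real ^ 'n) set \<Rightarrow> 'c::{real_normed_field, banach, second_countable_topology}"
  where
  "radon_perp_L1 k f \<xi> = radon_L1 k f (\<xi>\<^sup>\<bottom>)"

definition minkowski_funk_L1 ::
  "(real ^ 'n \<Rightarrow> 'c) \<Rightarrow> real ^ 'n \<Rightarrow> 'c::{real_normed_field, banach, second_countable_topology}"
  where
  "minkowski_funk_L1 f u = radon_L1 (CARD('n) - 1) f ({u}\<^sup>\<bottom>)"

end

theory Submission
  imports Defs "HOL-Probability.Probability"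
begin

text \<open>
  Why the identity holds. Fix a unit vector \<open>\<theta>\<close> and a rotation \<open>r\<close> taking the last axis to
  \<open>\<theta>\<close>. For random \<open>\<gamma>\<close> in the stabiliser of the last axis, \<open>r \<gamma> p\<^sub>0\<close> is a random plane through
  \<open>\<theta>\<close>, so its orthogonal complement is a random subspace of the hyperplane \<open>\<theta>\<^sup>\<bottom>\<close>. A random unit
  vector of this random subspace has a distribution on the unit sphere of \<open>\<theta>\<^sup>\<bottom>\<close> that is invariant
  under all rotations fixing \<open>\<theta>\<close>, since such a rotation only translates \<open>\<gamma>\<close>. If \<open>n \<ge> 3\<close> these
  rotations act transitively on that sphere, hence the distribution is the invariant one, and
  integrating \<open>f\<close> in two stages gives \<open>R\<^sub>i\<^sup>* R\<^bsub>n-i,\<perp>\<^esub> f (\<theta>) = M f (\<theta>)\<close>. If \<open>n = 2\<close> the random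
  subspace is \<open>\<theta>\<^sup>\<bottom>\<close> itself. This is \<open>radon_dual_radon_orthogonal_comp\<close>; it applies to every \<open>\<theta>\<close>
  for which \<open>f\<close> is integrable on the sphere of \<open>\<theta>\<^sup>\<bottom>\<close>, that is to almost every \<open>\<theta>\<close>.

  Uniqueness of invariant measures has one source: two probability measures for which the mass of
  a ball depends on its radius only coincide (\<open>uniformly_distributed_unique\<close>), and a measure
  invariant under a transitive group of isometries has this property. Here sets of subspaces are
  metrised through their orthogonal projections and groups of matrices through the Euclidean norm.

  Existence is explicit. The invariant measure on the sphere of a subspace \<open>\<xi>\<close> is the law of the
  normalised projection to \<open>\<xi>\<close> of a uniform point of the unit ball. This description is jointly
  measurable in \<open>\<xi>\<close> and in the point, so that Fubini's theorem handles random subspaces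
  (\<open>mixture_fubini\<close>). Haar measure on the stabiliser of a set of axes is built one axis at a time
  from the sphere and the next smaller stabiliser (\<open>haar_step\<close>), and the measure on the
  Grassmannian is an image of Haar measure.

  The same two-stage integration shows that the integral formulas for \<open>R\<^sub>k\<close> and \<open>R\<^sub>k\<^sup>*\<close> define
  bounded operators on all of \<open>L\<^sup>1\<close>. By density of the continuous functions every bounded extension
  agrees with these formulas almost everywhere (\<open>L1_extension_eq_direct\<close>). The exceptional null
  sets can be pulled back along \<open>u \<mapsto> u\<^sup>\<bottom>\<close> and \<open>\<xi> \<mapsto> \<xi>\<^sup>\<bottom>\<close>, because these maps carry invariant
  measures to invariant measures.
\<close>

section \<open>Uniqueness of invariant probability measures\<close>

text \<open>
  Integrate the indicator of \<open>{(x, y). dist x y < r}\<close> over the product. Integrating first over \<open>y\<close>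
  or first over \<open>x\<close> yields \<open>g r\<close> times a mass for \<open>M\<close> or \<open>N\<close>, so the factor \<open>g r\<close> cancels. No
  normalisation is involved, so Lebesgue measure is covered as well. The map \<open>e\<close> transports the metric to a space whose elements are not points of a metric type.
\<close>

lemma emeasure_open_le_if_equal_balls:
  fixes e :: "'a \<Rightarrow> 'e::{metric_space, second_countable_topology}"
  assumes "sigma_finite_measure M" "sigma_finite_measure N"
    and [measurable]: "e \<in> borel_measurable M" "e \<in> borel_measurable N"
    and gN: "\<And>x r. x \<in> space M \<Longrightarrow> 0 < r \<Longrightarrow> emeasure N {y\<in>space N. dist (e x) (e y) < r} = g r"
    and gM: "\<And>y r. y \<in> space N \<Longrightarrow> 0 < r \<Longrightarrow> emeasure M {x\<in>space M. dist (e x) (e y) < r} = g r"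
    and g: "\<And>r. 0 < r \<Longrightarrow> 0 < g r" "\<And>r. 0 < r \<Longrightarrow> g r < top"
    and U: "open U"
  shows "emeasure M {x\<in>space M. e x \<in> U} \<le> emeasure N {y\<in>space N. e y \<in> U}"
proof -
  interpret M: sigma_finite_measure M by fact
  interpret N: sigma_finite_measure N by fact
  interpret pair_sigma_finite M N ..
  \<comment> \<open>On \<open>V r\<close> the condition \<open>dist x y < r\<close> forces \<open>y \<in> U\<close>; the sets \<open>V r\<close> exhaust \<open>U\<close> as \<open>r \<rightarrow> 0\<close>.\<close>
  define V where "V r = {z. ball z r \<subseteq> U}" for r
  have V_borel [measurable]: "V r \<in> sets borel" for r
  proof -
    have "- V r = (\<Union>y\<in>-U. ball y r)"
      by (auto simp: V_def dist_commute subset_eq)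
    then have "open (- V r)" by auto
    then show ?thesis
      by (metis borel_comp borel_open double_complement)
  qed
  have [measurable]: "U \<in> sets borel" using U by auto
  have le: "emeasure M {x\<in>space M. e x \<in> V r} \<le> emeasure N {y\<in>space N. e y \<in> U}" if r: "0 < r" for r
  proof -
    have "g r * emeasure M {x\<in>space M. e x \<in> V r} = (\<integral>\<^sup>+x. g r * indicator {x\<in>space M. e x \<in> V r} x \<partial>M)"
      by (simp add: nn_integral_cmult)
    also have "\<dots> = (\<integral>\<^sup>+x. (\<integral>\<^sup>+y. indicator (V r) (e x) * indicator {y\<in>space N. dist (e x) (e y) < r} y \<partial>N) \<partial>M)"
    proof (intro nn_integral_cong)
      fix x assume x: "x \<in> space M"
      have "(\<integral>\<^sup>+y. indicator (V r) (e x) * indicator {y\<in>space N. dist (e x) (e y) < r} y \<partial>N)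
        = indicator (V r) (e x) * g r"
        using x by (simp add: nn_integral_cmult gN r)
      then show "g r * indicator {x\<in>space M. e x \<in> V r} x
        = (\<integral>\<^sup>+y. indicator (V r) (e x) * indicator {y\<in>space N. dist (e x) (e y) < r} y \<partial>N)"
        using x by (simp add: indicator_def)
    qed
    also have "\<dots> \<le> (\<integral>\<^sup>+x. (\<integral>\<^sup>+y. indicator U (e y) * indicator {z. z < r} (dist (e x) (e y)) \<partial>N) \<partial>M)"
      by (intro nn_integral_mono) (auto simp: V_def indicator_def subset_eq)
    also have "\<dots> = (\<integral>\<^sup>+y. (\<integral>\<^sup>+x. indicator U (e y) * indicator {z. z < r} (dist (e x) (e y)) \<partial>M) \<partial>N)"
      by (rule Fubini'[symmetric]) measurable
    also have "\<dots> = (\<integral>\<^sup>+y. (\<integral>\<^sup>+x. indicator U (e y) * indicator {x\<in>space M. dist (e x) (e y) < r} x \<partial>M) \<partial>N)"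
      by (intro nn_integral_cong) (auto simp: indicator_def)
    also have "\<dots> = (\<integral>\<^sup>+y. g r * indicator {y\<in>space N. e y \<in> U} y \<partial>N)"
    proof (intro nn_integral_cong)
      fix y assume y: "y \<in> space N"
      have "(\<integral>\<^sup>+x. indicator U (e y) * indicator {x\<in>space M. dist (e x) (e y) < r} x \<partial>M)
        = indicator U (e y) * g r"
        using y by (simp add: nn_integral_cmult gM r)
      then show "(\<integral>\<^sup>+x. indicator U (e y) * indicator {x\<in>space M. dist (e x) (e y) < r} x \<partial>M)
        = g r * indicator {y\<in>space N. e y \<in> U} y"
        using y by (simp add: indicator_def)
    qed
    also have "\<dots> = g r * emeasure N {y\<in>space N. e y \<in> U}"
      by (simp add: nn_integral_cmult)
    finally show ?thesis
      using g[OF r] by (subst (asm) ennreal_mult_le_mult_iff) auto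
  qed
  have "{x\<in>space M. e x \<in> U} = (\<Union>k. {x\<in>space M. e x \<in> V (1 / real (Suc k))})"
  proof (intro equalityI subsetI)
    fix x assume x: "x \<in> {x\<in>space M. e x \<in> U}"
    then obtain d where d: "d > 0" "ball (e x) d \<subseteq> U"
      using U open_contains_ball by blast
    then obtain k where "1 / real (Suc k) < d"
      by (metis inverse_eq_divide reals_Archimedean)
    then have "ball (e x) (1 / real (Suc k)) \<subseteq> U"
      using d by (meson less_imp_le order_trans subset_ball)
    then show "x \<in> (\<Union>k. {x\<in>space M. e x \<in> V (1 / real (Suc k))})"
      using x by (auto simp: V_def)
  qed (force simp: V_def)
  moreover have "(SUP k. emeasure M {x\<in>space M. e x \<in> V (1 / real (Suc k))})
    = emeasure M (\<Union>k. {x\<in>space M. e x \<in> V (1 / real (Suc k))})"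
  proof (intro SUP_emeasure_incseq incseq_SucI)
    fix k
    have "ball z (1 / real (Suc (Suc k))) \<subseteq> ball z (1 / real (Suc k))" for z :: 'e
      by (intro subset_ball) (simp add: field_simps)
    then show "{x\<in>space M. e x \<in> V (1 / real (Suc k))} \<subseteq> {x\<in>space M. e x \<in> V (1 / real (Suc (Suc k)))}"
      unfolding V_def by blast
  qed auto
  moreover have "(SUP k. emeasure M {x\<in>space M. e x \<in> V (1 / real (Suc k))}) \<le> emeasure N {y\<in>space N. e y \<in> U}"
    by (intro SUP_least le) auto
  ultimately show ?thesis by simp
qed

text \<open>
  Fubini's theorem applied to \<open>{(x, y). dist x y < r}\<close> shows that the two functions giving the mass
  of a ball agree; separability makes them positive, and the preceding comparison then gives equality
  on open sets.
\<close>

lemma uniformly_distributed_unique: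
  fixes e :: "'a \<Rightarrow> 'e::{metric_space, second_countable_topology}"
  assumes "prob_space M" "prob_space N"
    and setsM: "sets M = sets (vimage_algebra Y e borel)"
    and setsN: "sets N = sets (vimage_algebra Y e borel)"
    and gM: "\<And>x r. x \<in> Y \<Longrightarrow> 0 < r \<Longrightarrow> emeasure M {y\<in>Y. dist (e x) (e y) < r} = gM r"
    and gN: "\<And>x r. x \<in> Y \<Longrightarrow> 0 < r \<Longrightarrow> emeasure N {y\<in>Y. dist (e x) (e y) < r} = gN r"
  shows "M = N"
proof -
  interpret M: prob_space M by fact
  interpret N: prob_space N by fact
  interpret MN: pair_prob_space M N ..
  have Y: "space M = Y" "space N = Y"
    using setsM setsN by (metis sets_eq_imp_space_eq space_vimage_algebra)+
  have eV: "e \<in> borel_measurable (vimage_algebra Y e borel)"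
    by (intro measurable_vimage_algebra1) auto
  have [measurable]: "e \<in> borel_measurable M" "e \<in> borel_measurable N"
    by (subst measurable_cong_sets[OF setsM refl], rule eV) (subst measurable_cong_sets[OF setsN refl], rule eV)
  \<comment> \<open>Otherwise countably many null balls would cover the space.\<close>
  have pos: "0 < gM r" if r: "0 < r" for r
  proof (rule ccontr)
    assume "\<not> 0 < gM r"
    then have 0: "emeasure M {y\<in>Y. dist (e x) (e y) < r} = 0" if "x \<in> Y" for x
      using gM[OF that r] by simp
    obtain D :: "'e set" where D: "countable D" "\<And>X. open X \<Longrightarrow> X \<noteq> {} \<Longrightarrow> \<exists>d\<in>D. d \<in> X"
      by (rule countable_dense_setE) blast
    have "{y\<in>Y. dist d (e y) < r/2} \<in> null_sets M" for d
    proof (cases "\<exists>x\<in>Y. dist d (e x) < r/2")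
      case True
      then obtain x where x: "x \<in> Y" "dist d (e x) < r/2" by auto
      have "emeasure M {y\<in>Y. dist d (e y) < r/2} \<le> emeasure M {y\<in>Y. dist (e x) (e y) < r}"
      proof (rule emeasure_mono)
        show "{y\<in>Y. dist d (e y) < r/2} \<subseteq> {y\<in>Y. dist (e x) (e y) < r}"
          using x dist_triangle_half_r by auto
        show "{y\<in>Y. dist (e x) (e y) < r} \<in> sets M"
          unfolding Y(1)[symmetric] by measurable
      qed
      moreover have "{y\<in>Y. dist d (e y) < r/2} \<in> sets M"
        unfolding Y(1)[symmetric] by measurable
      ultimately show ?thesis using 0[OF x(1)] by auto
    next
      case False
      then have "{y\<in>Y. dist d (e y) < r/2} = {}" by auto
      then show ?thesis by (simp only: null_sets.empty_sets)
    qed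
    then have "(\<Union>d\<in>D. {y\<in>Y. dist d (e y) < r/2}) \<in> null_sets M"
      using D(1) by (intro null_sets_UN') auto
    moreover have "(\<Union>d\<in>D. {y\<in>Y. dist d (e y) < r/2}) = Y"
    proof -
      have "\<exists>d\<in>D. dist d (e y) < r/2" for y
        using D(2)[of "ball (e y) (r/2)"] r by (auto simp: dist_commute)
      then show ?thesis by auto
    qed
    ultimately show False
      using M.emeasure_space_1 by (auto simp: Y null_sets_def)
  qed
  \<comment> \<open>Both sides are the product measure of \<open>{(x, y). dist x y < r}\<close>.\<close>
  have eq: "gM r = gN r" if r: "0 < r" for r
  proof -
    have bM: "{y\<in>Y. dist (e x) (e y) < r} \<in> sets M" for x
      unfolding Y(1)[symmetric] by measurable
    have bN: "{y\<in>Y. dist (e x) (e y) < r} \<in> sets N" for x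
      unfolding Y(2)[symmetric] by measurable
    have "gN r = (\<integral>\<^sup>+x. gN r \<partial>M)"
      by (simp add: M.emeasure_space_1)
    also have "\<dots> = (\<integral>\<^sup>+x. (\<integral>\<^sup>+y. indicator {y\<in>Y. dist (e x) (e y) < r} y \<partial>N) \<partial>M)"
      by (intro nn_integral_cong) (simp add: Y gN r bN)
    also have "\<dots> = (\<integral>\<^sup>+x. (\<integral>\<^sup>+y. indicator {z. z < r} (dist (e x) (e y)) \<partial>N) \<partial>M)"
      by (intro nn_integral_cong) (auto simp: indicator_def Y)
    also have "\<dots> = (\<integral>\<^sup>+y. (\<integral>\<^sup>+x. indicator {z. z < r} (dist (e x) (e y)) \<partial>M) \<partial>N)"
      by (rule MN.Fubini'[symmetric]) measurable
    also have "\<dots> = (\<integral>\<^sup>+y. (\<integral>\<^sup>+x. indicator {x\<in>Y. dist (e y) (e x) < r} x \<partial>M) \<partial>N)"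
      by (intro nn_integral_cong) (auto simp: indicator_def Y dist_commute)
    also have "\<dots> = (\<integral>\<^sup>+y. gM r \<partial>N)"
      by (intro nn_integral_cong) (simp add: Y gM r bM)
    also have "\<dots> = gM r"
      by (simp add: N.emeasure_space_1)
    finally show ?thesis ..
  qed
  have fin: "gM r < top" if "0 < r" for r
  proof -
    obtain x where "x \<in> Y" using M.not_empty Y by auto
    then show ?thesis using gM[OF _ that] M.emeasure_finite by (metis top.not_eq_extremum)
  qed
  have *: "emeasure M {y\<in>Y. dist (e y) (e x) < r} = gM r" "emeasure N {y\<in>Y. dist (e y) (e x) < r} = gM r"
     "emeasure M {y\<in>Y. dist (e x) (e y) < r} = gM r" "emeasure N {y\<in>Y. dist (e x) (e y) < r} = gM r"
    if "x \<in> Y" "0 < r" for x r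
    using gM[OF that] gN[OF that] eq[OF that(2)] by (simp_all add: dist_commute)
  have open_eq: "emeasure M {x\<in>Y. e x \<in> U} = emeasure N {x\<in>Y. e x \<in> U}" if "open U" for U
    using emeasure_open_le_if_equal_balls[of M N e gM U] emeasure_open_le_if_equal_balls[of N M e gM U]
    by (intro antisym; simp add: Y * pos fin that M.sigma_finite_measure_axioms N.sigma_finite_measure_axioms)
  have distr_eq: "distr M borel e = distr N borel e"
  proof (rule measure_eqI_generator_eq[where E="{S. open S}" and \<Omega>=UNIV and A="\<lambda>_. UNIV"])
    show "Int_stable {S :: 'e set. open S}" by (auto simp: Int_stable_def)
    show "emeasure (distr M borel e) X = emeasure (distr N borel e) X" if "X \<in> {S. open S}" for X
      using open_eq[of X] that by (auto simp: emeasure_distr Y vimage_def Int_def conj_commute)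
    show "emeasure (distr M borel e) UNIV \<noteq> \<infinity>" 
      using M.emeasure_finite by (auto simp: emeasure_distr)
  qed (auto simp: borel_def)
  show ?thesis
  proof (rule measure_eqI)
    show "sets M = sets N" using setsM setsN by simp
    fix A assume "A \<in> sets M"
    then obtain B where B: "B \<in> sets borel" "A = e -` B \<inter> Y"
      using setsM by (subst (asm) sets_vimage_algebra2) (auto simp: setsM)
    then show "emeasure M A = emeasure N A"
      using arg_cong[OF distr_eq, of "\<lambda>M. emeasure M B"] by (simp add: emeasure_distr Y)
  qed
qed

lemma transitive_isometries_unique:
  fixes e :: "'a \<Rightarrow> 'e::{metric_space, second_countable_topology}"
  assumes "prob_space M" "prob_space N"
    and setsS: "sets S = sets (vimage_algebra Y e borel)"
    and setsM: "sets M = sets S"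
    and setsN: "sets N = sets S"
    and maps: "\<And>T. T \<in> \<T> \<Longrightarrow> T \<in> measurable S S"
    and isom: "\<And>T x y. T \<in> \<T> \<Longrightarrow> x \<in> Y \<Longrightarrow> y \<in> Y \<Longrightarrow> dist (e (T x)) (e (T y)) = dist (e x) (e y)"
    and trans: "\<And>x y. x \<in> Y \<Longrightarrow> y \<in> Y \<Longrightarrow> \<exists>T\<in>\<T>. T x = y"
    and invM: "\<And>T. T \<in> \<T> \<Longrightarrow> distr M S T = M"
    and invN: "\<And>T. T \<in> \<T> \<Longrightarrow> distr N S T = N"
  shows "M = N"
proof -
  have Y: "space S = Y"
    using setsS by (metis sets_eq_imp_space_eq space_vimage_algebra)
  have const: "emeasure L {y\<in>Y. dist (e x) (e y) < r} = emeasure L {y\<in>Y. dist (e x') (e y) < r}"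
    if L: "sets L = sets S" "\<And>T. T \<in> \<T> \<Longrightarrow> distr L S T = L" and x: "x \<in> Y" "x' \<in> Y" for L x x' r
  proof -
    obtain T where T: "T \<in> \<T>" "T x = x'" using trans x by blast
    have eV: "e \<in> borel_measurable S"
      by (subst measurable_cong_sets[OF setsS refl], rule measurable_vimage_algebra1) auto
    have set: "{y\<in>Y. dist (e x') (e y) < r} \<in> sets S"
      unfolding Y[symmetric] using eV by measurable
    have TL: "T \<in> measurable L S"
      by (subst measurable_cong_sets[OF L(1) refl], rule maps[OF T(1)])
    have "emeasure L {y\<in>Y. dist (e x') (e y) < r} = emeasure (distr L S T) {y\<in>Y. dist (e x') (e y) < r}"
      using L(2)[OF T(1)] by simp
    also have "\<dots> = emeasure L (T -` {y\<in>Y. dist (e x') (e y) < r} \<inter> space L)"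
      using TL set by (rule emeasure_distr)
    also have "T -` {y\<in>Y. dist (e x') (e y) < r} \<inter> space L = {y\<in>Y. dist (e x) (e y) < r}"
      using isom[OF T(1) x(1)] T(2) maps[OF T(1)] sets_eq_imp_space_eq[OF L(1)] Y
      by (auto simp: measurable_def)
    finally show ?thesis ..
  qed
  obtain x0 where x0: "x0 \<in> Y"
    using prob_space.not_empty[OF \<open>prob_space M\<close>] sets_eq_imp_space_eq[OF setsM] Y by auto
  show ?thesis
  proof (rule uniformly_distributed_unique[OF assms(1,2)])
    show "sets M = sets (vimage_algebra Y e borel)" "sets N = sets (vimage_algebra Y e borel)"
      using setsM setsN setsS by auto
    show "emeasure M {y\<in>Y. dist (e x) (e y) < r} = emeasure M {y\<in>Y. dist (e x0) (e y) < r}"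
      "emeasure N {y\<in>Y. dist (e x) (e y) < r} = emeasure N {y\<in>Y. dist (e x0) (e y) < r}" if "x \<in> Y" for x r
      using const[OF setsM invM that x0] const[OF setsN invN that x0] by auto
  qed
qed

lemma invariant_prob_eqI:
  fixes e :: "'a \<Rightarrow> 'e::{metric_space, second_countable_topology}"
  assumes "prob_space M"
    and setsS: "sets S = sets (vimage_algebra Y e borel)"
    and setsM: "sets M = sets S"
    and maps: "\<And>T. T \<in> \<T> \<Longrightarrow> T \<in> measurable S S"
    and isom: "\<And>T x y. T \<in> \<T> \<Longrightarrow> x \<in> Y \<Longrightarrow> y \<in> Y \<Longrightarrow> dist (e (T x)) (e (T y)) = dist (e x) (e y)"
    and trans: "\<And>x y. x \<in> Y \<Longrightarrow> y \<in> Y \<Longrightarrow> \<exists>T\<in>\<T>. T x = y"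
    and invM: "\<And>T. T \<in> \<T> \<Longrightarrow> distr M S T = M"
  shows "invariant_prob S \<T> = M"
  unfolding invariant_prob_def
proof (rule the_equality)
  show "sets M = sets S \<and> emeasure M (space M) = 1 \<and> (\<forall>T\<in>\<T>. distr M S T = M)"
    using prob_space.emeasure_space_1[OF assms(1)] setsM invM by auto
  fix N assume N: "sets N = sets S \<and> emeasure N (space N) = 1 \<and> (\<forall>T\<in>\<T>. distr N S T = N)"
  then have "prob_space N" by (auto intro: prob_spaceI)
  then show "N = M"
    by (rule transitive_isometries_unique[OF _ assms(1) setsS _ setsM maps isom trans]) (use N invM in blast)+
qed

text \<open>
  Lebesgue measure and its image give the same mass to all balls of the same radius, so the
  comparison of open sets applies in both directions.
\<close>

lemma lborel_orthogonal_invariant: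
  fixes T :: "'a::euclidean_space \<Rightarrow> 'a"
  assumes T: "orthogonal_transformation T"
  shows "distr lborel borel T = lborel"
proof -
  have [measurable]: "T \<in> borel_measurable borel"
    using orthogonal_transformation_linear[OF T] linear_continuous_on linear_conv_bounded_linear
    by (intro borel_measurable_continuous_onI) blast
  define L where "L = distr lborel borel T"
  have [simp]: "sets L = sets borel" "space L = UNIV" by (auto simp: L_def)
  obtain T' where T': "orthogonal_transformation T'" "\<And>x. T (T' x) = x" "\<And>x. T' (T x) = x"
    using orthogonal_transformation_inv[OF T] orthogonal_transformation_bij[OF T]
    by (metis T bij_inv_eq_iff)
  have dT: "dist (T x) (T y) = dist x y" for x y
    using T by (simp add: orthogonal_transformation_isometry)
  have ball: "emeasure lborel {y. dist x y < r} = emeasure lborel (ball (0::'a) r)" if "0 < r" for x :: 'a and r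
    using emeasure_ball[of r x] emeasure_ball[of r "0::'a"] that by (simp add: ball_def)
  have balls: "{x. dist x y < r} = {x. dist y x < r}" for y :: 'a and r by (simp add: dist_commute)
  have Lball: "emeasure L {y. dist x y < r} = emeasure lborel (ball (0::'a) r)" if "0 < r" for x :: 'a and r
  proof -
    have "emeasure L {y. dist x y < r} = emeasure lborel {y. dist x (T y) < r}"
      by (simp add: L_def emeasure_distr vimage_def)
    also have "{y. dist x (T y) < r} = {y. dist (T' x) y < r}"
      using dT[of "T' x"] T' by simp
    finally show ?thesis using ball that by simp
  qed
  have emeasure_L: "emeasure L A = emeasure lborel (T -` A)" if "A \<in> sets borel" for A
    using that by (simp add: L_def emeasure_distr)
  have cover: "(\<Union>n. ball (0::'a) (real (Suc n))) = UNIV"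
  proof -
    have "\<exists>n. norm x < real (Suc n)" for x :: 'a
      using reals_Archimedean2[of "norm x"] by (metis less_trans lessI of_nat_less_iff)
    then show ?thesis by (auto simp del: of_nat_Suc)
  qed
  have finite_ball: "emeasure L (ball 0 r) \<noteq> \<infinity>" if "0 < r" for r
    using Lball[of r 0] that emeasure_lborel_ball_finite[of "0::'a" r] by (simp add: ball_def)
  have sf: "sigma_finite_measure L"
  proof (rule sigma_finite_measure.intro, intro exI conjI)
    show "countable (range (\<lambda>n. ball (0::'a) (real (Suc n))))" by simp
    show "range (\<lambda>n. ball (0::'a) (real (Suc n))) \<subseteq> sets L" by auto
    show "\<Union> (range (\<lambda>n. ball (0::'a) (real (Suc n)))) = space L"
      using cover by simp
    show "\<forall>a\<in>range (\<lambda>n. ball (0::'a) (real (Suc n))). emeasure L a \<noteq> \<infinity>"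
      using finite_ball by auto
  qed
  have open_eq: "emeasure L U = emeasure lborel U" if "open U" for U
  proof -
    have "0 < emeasure lborel (ball (0::'a) r)" if "0 < r" for r
      using that by (simp add: emeasure_ball unit_ball_vol_pos ennreal_zero_less_mult_iff)
    moreover have "emeasure lborel (ball (0::'a) r) < top" for r
      using emeasure_lborel_ball_finite[of "0::'a" r] by simp
    ultimately show ?thesis
      using emeasure_open_le_if_equal_balls[of L lborel "\<lambda>x. x" "\<lambda>r. emeasure lborel (ball (0::'a) r)" U]
        emeasure_open_le_if_equal_balls[of lborel L "\<lambda>x. x" "\<lambda>r. emeasure lborel (ball (0::'a) r)" U]
      by (intro antisym; simp add: sf lborel.sigma_finite_measure_axioms ball Lball balls that measurable_ident_sets)
  qed
  have "L = lborel"
  proof (rule measure_eqI_generator_eq[where E="{S. open S}" and \<Omega>=UNIV and A="\<lambda>n. ball 0 (real (Suc n))"])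
    show "Int_stable {S :: 'a set. open S}" by (auto simp: Int_stable_def)
    show "(\<Union>n. ball (0::'a) (real (Suc n))) = UNIV" by (rule cover)
    show "emeasure L (ball 0 (real (Suc n))) \<noteq> \<infinity>" for n
      by (rule finite_ball) simp
    show "emeasure L X = emeasure lborel X" if "X \<in> {S. open S}" for X
      using open_eq that by simp
  qed (auto simp: borel_def)
  then show ?thesis by (simp add: L_def)
qed

section \<open>Orthogonal matrices\<close>

lemma orthogonal_matrix_transformation:
  "orthogonal_matrix g \<Longrightarrow> orthogonal_transformation (\<lambda>x. g *v (x :: real ^ 'n))"
  by (simp add: orthogonal_transformation_matrix)

lemma orthogonal_matrix_inner:
  "orthogonal_matrix g \<Longrightarrow> (g *v x) \<bullet> (g *v y) = x \<bullet> (y :: real ^ 'n)"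
  using orthogonal_matrix_transformation[of g] by (simp add: orthogonal_transformation_def)

lemma orthogonal_matrix_norm:
  "orthogonal_matrix g \<Longrightarrow> norm (g *v x) = norm (x :: real ^ 'n)"
  using orthogonal_matrix_inner[of g x x] by (simp add: norm_eq)

lemma rotation_orthogonal: "rotation_matrix g \<Longrightarrow> orthogonal_matrix g"
  by (simp add: rotation_matrix_def)

lemma rotation_mult: "rotation_matrix g \<Longrightarrow> rotation_matrix h \<Longrightarrow> rotation_matrix (g ** (h :: real^'n^'n))"
  by (simp add: rotation_matrix_def orthogonal_matrix_mul det_mul)

lemma rotation_transpose: "rotation_matrix g \<Longrightarrow> rotation_matrix (transpose (g :: real^'n^'n))"
  by (simp add: rotation_matrix_def)

lemma rotation_one: "rotation_matrix (mat 1 :: real^'n^'n)"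
  by (simp add: rotation_matrix_def orthogonal_matrix_id)

lemma orthogonal_cancel:
  fixes g :: "real^'n^'n"
  assumes "orthogonal_matrix g"
  shows "g ** transpose g = mat 1" "transpose g ** g = mat 1"
    "g *v (transpose g *v x) = x" "transpose g *v (g *v x) = x"
    "g ** (transpose g ** A) = A" "transpose g ** (g ** A) = A"
  using assms unfolding orthogonal_matrix_def matrix_vector_mul_assoc matrix_mul_assoc by simp_all

lemma image_matrix_mul: "(\<lambda>x. (A ** B) *v x) ` X = (\<lambda>x. A *v x) ` (\<lambda>x. B *v x) ` X"
  by (simp add: image_image matrix_vector_mul_assoc)

lemma dim_orthogonal_image:
  fixes g :: "real^'n^'n"
  assumes "orthogonal_matrix g"
  shows "dim ((\<lambda>x. g *v x) ` \<xi>) = dim \<xi>"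
  by (intro dim_image_eq matrix_vector_mul_linear inj_on_subset[OF orthogonal_transformation_inj])
    (simp_all add: orthogonal_matrix_transformation assms)

lemma subspace_matrix_image: "subspace \<xi> \<Longrightarrow> subspace ((\<lambda>x. g *v x) ` (\<xi> :: (real^'n) set))"
  by (intro linear_subspace_image matrix_vector_mul_linear)

text \<open>
  The matrix norm is the Euclidean norm of all entries: multiplication from the right by
  \<open>transpose g\<close> applies \<open>g\<close> to each row.
\<close>

lemma norm_matrix_times_transpose:
  fixes A g :: "real^'n^'n"
  assumes "orthogonal_matrix g"
  shows "norm (A ** transpose g) = norm A"
proof -
  have "(A ** transpose g) $ i = g *v (A $ i)" for i
    by (simp add: vec_eq_iff matrix_matrix_mult_def matrix_vector_mult_def transpose_def mult.commute)
  then show ?thesis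
    using assms by (simp add: norm_vec_def[of "_ :: real^'n^'n"] orthogonal_matrix_norm)
qed

lemma norm_transpose: "norm (transpose A) = norm (A :: real^'n^'n)"
proof -
  have "norm (transpose A) ^ 2 = norm A ^ 2"
    unfolding norm_vec_def L2_set_def transpose_def
    by (simp add: sum_nonneg) (rule sum.swap)
  then show ?thesis by simp
qed

lemma norm_orthogonal_times:
  fixes A g :: "real^'n^'n"
  assumes "orthogonal_matrix g"
  shows "norm (g ** A) = norm A"
  using norm_matrix_times_transpose[OF assms, of "transpose A"]
  by (metis matrix_transpose_mul norm_transpose)

lemma matrix_mult_diff: "A ** (B - C) = A ** B - A ** (C :: real^'n^'n)"
  by (simp add: vec_eq_iff matrix_matrix_mult_def right_diff_distrib sum_subtractf)

lemma matrix_diff_mult: "(B - C) ** A = B ** A - C ** (A :: real^'n^'n)"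
  by (simp add: vec_eq_iff matrix_matrix_mult_def left_diff_distrib sum_subtractf)

lemma dist_orthogonal_times:
  fixes A g :: "real^'n^'n"
  assumes "orthogonal_matrix g"
  shows "dist (g ** A) (g ** B) = dist A B"
  unfolding dist_norm matrix_mult_diff[symmetric] using assms by (rule norm_orthogonal_times)

text \<open>
  By \<open>projection_image\<close> below, this is the isometry that a rotation induces on projections.
\<close>

lemma dist_orthogonal_conj:
  fixes A g :: "real^'n^'n"
  assumes "orthogonal_matrix g"
  shows "dist (g ** A ** transpose g) (g ** B ** transpose g) = dist A B"
proof -
  have "g ** A ** transpose g - g ** B ** transpose g = g ** (A - B) ** transpose g"
    by (simp add: matrix_mult_diff matrix_diff_mult)
  then show ?thesis
    using assms by (simp add: dist_norm norm_matrix_times_transpose norm_orthogonal_times)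
qed

section \<open>Orthogonal projections\<close>

lemma closest_point_subspace:
  fixes \<xi> :: "'a::euclidean_space set"
  assumes "subspace \<xi>"
  shows "closest_point \<xi> x \<in> \<xi>" "y \<in> \<xi> \<Longrightarrow> (x - closest_point \<xi> x) \<bullet> y = 0"
proof -
  have cl: "closed \<xi>" "convex \<xi>" "\<xi> \<noteq> {}"
    using assms closed_subspace subspace_imp_convex subspace_0 by blast+
  show p: "closest_point \<xi> x \<in> \<xi>" using cl by (intro closest_point_in_set)
  show "(x - closest_point \<xi> x) \<bullet> y = 0" if y: "y \<in> \<xi>"
  proof -
    have "closest_point \<xi> x + y \<in> \<xi>" "closest_point \<xi> x - y \<in> \<xi>"
      using p y assms by (auto intro: subspace_add subspace_diff)
    from this[THEN closest_point_dot[OF cl(2,1), of _ x]] show ?thesis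
      by simp
  qed
qed

lemma closest_point_subspaceI:
  fixes \<xi> :: "'a::euclidean_space set"
  assumes "subspace \<xi>" "p \<in> \<xi>" "\<And>y. y \<in> \<xi> \<Longrightarrow> (x - p) \<bullet> y = 0"
  shows "closest_point \<xi> x = p"
proof -
  have "(x - p) - (x - closest_point \<xi> x) \<in> \<xi>"
    using closest_point_subspace[OF assms(1)] assms by (simp add: subspace_diff)
  then have "((x - p) - (x - closest_point \<xi> x)) \<bullet> ((x - p) - (x - closest_point \<xi> x)) = 0"
    using closest_point_subspace(2)[OF assms(1)] assms(3) by (simp only: inner_diff_left[of "x - p"])
  then show ?thesis by simp
qed

lemma linear_closest_point:
  fixes \<xi> :: "'a::euclidean_space set"
  assumes "subspace \<xi>"
  shows "linear (closest_point \<xi>)"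
proof (rule linearI)
  note cp = closest_point_subspace[OF assms]
  fix x y :: 'a and c :: real
  show "closest_point \<xi> (x + y) = closest_point \<xi> x + closest_point \<xi> y"
  proof (rule closest_point_subspaceI[OF assms])
    fix z assume z: "z \<in> \<xi>"
    have "(x + y - (closest_point \<xi> x + closest_point \<xi> y)) \<bullet> z
      = (x - closest_point \<xi> x) \<bullet> z + (y - closest_point \<xi> y) \<bullet> z"
      by (simp add: algebra_simps)
    then show "(x + y - (closest_point \<xi> x + closest_point \<xi> y)) \<bullet> z = 0"
      by (simp add: cp(2)[OF z])
  qed (use assms cp in \<open>simp add: subspace_add\<close>)
  show "closest_point \<xi> (c *\<^sub>R x) = c *\<^sub>R closest_point \<xi> x"
  proof (rule closest_point_subspaceI[OF assms])
    fix z assume z: "z \<in> \<xi>"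
    show "(c *\<^sub>R x - c *\<^sub>R closest_point \<xi> x) \<bullet> z = 0"
      using cp(2)[OF z, of x] by (simp add: inner_diff_left)
  qed (use assms cp in \<open>simp add: subspace_scale\<close>)
qed

abbreviation projection :: "(real ^ 'n) set \<Rightarrow> real ^ 'n ^ 'n" where
  "projection \<xi> \<equiv> matrix (closest_point \<xi>)"

lemma projection_apply: "subspace \<xi> \<Longrightarrow> projection \<xi> *v x = closest_point \<xi> x"
  using matrix_works[of "closest_point \<xi>"] linear_closest_point[of \<xi>]
  by (simp add: scalar_mult_eq_scaleR linear_def Vector_Spaces.linear_def)

lemma projection_eqI:
  assumes "subspace \<xi>" "\<And>x. A *v x \<in> \<xi>" "\<And>x y. y \<in> \<xi> \<Longrightarrow> (x - A *v x) \<bullet> y = 0"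
  shows "projection \<xi> = A"
  unfolding matrix_eq using closest_point_subspaceI[OF assms(1,2)] assms(3) projection_apply[OF assms(1)] by metis

lemma projection_image:
  fixes g :: "real^'n^'n"
  assumes g: "orthogonal_matrix g" and \<xi>: "subspace \<xi>"
  shows "projection ((\<lambda>x. g *v x) ` \<xi>) = g ** projection \<xi> ** transpose g"
proof (rule projection_eqI)
  note cp = closest_point_subspace[OF \<xi>]
  show "subspace ((\<lambda>x. g *v x) ` \<xi>)" using \<xi> by (rule subspace_matrix_image)
  have A: "g ** projection \<xi> ** transpose g *v x = g *v closest_point \<xi> (transpose g *v x)" for x
    by (simp only: matrix_vector_mul_assoc[symmetric] projection_apply[OF \<xi>])
  show "g ** projection \<xi> ** transpose g *v x \<in> (\<lambda>x. g *v x) ` \<xi>" for x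
    unfolding A using cp by blast
  fix x y assume "y \<in> (\<lambda>x. g *v x) ` \<xi>"
  then obtain z where z: "z \<in> \<xi>" "y = g *v z" by auto
  have "(x - g *v closest_point \<xi> (transpose g *v x)) \<bullet> y
    = (g *v (transpose g *v x - closest_point \<xi> (transpose g *v x))) \<bullet> (g *v z)"
    unfolding matrix_vector_mult_diff_distrib orthogonal_cancel(3)[OF g] z(2) ..
  also have "\<dots> = 0"
    unfolding orthogonal_matrix_inner[OF g] using cp(2)[OF z(1)] .
  finally show "(x - g ** projection \<xi> ** transpose g *v x) \<bullet> y = 0"
    unfolding A .
qed

lemma projection_orthogonal_comp:
  fixes \<xi> :: "(real ^ 'n) set"
  assumes "subspace \<xi>"
  shows "projection (\<xi>\<^sup>\<bottom>) = mat 1 - projection \<xi>"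
proof (rule projection_eqI)
  note cp = closest_point_subspace[OF assms]
  have A: "(mat 1 - projection \<xi>) *v x = x - closest_point \<xi> x" for x
    by (simp add: matrix_vector_mult_diff_rdistrib projection_apply[OF assms])
  show "(mat 1 - projection \<xi>) *v x \<in> \<xi>\<^sup>\<bottom>" for x
    unfolding A using cp(2) by (auto simp: orthogonal_comp_def orthogonal_def inner_commute)
  show "(x - (mat 1 - projection \<xi>) *v x) \<bullet> y = 0" if "y \<in> \<xi>\<^sup>\<bottom>" for x y
    unfolding A using that cp(1) by (auto simp: orthogonal_comp_def orthogonal_def)
qed (rule subspace_orthogonal_comp)

lemma projection_hyperplane:
  fixes u :: "real ^ 'n"
  assumes u: "norm u = 1"
  shows "projection ({u}\<^sup>\<bottom>) = (\<chi> i j. (if i = j then 1 else 0) - u $ i * u $ j)"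
proof (rule projection_eqI)
  have u1: "u \<bullet> u = 1" using u by (simp add: norm_eq_1)
  have A: "(\<chi> i j. (if i = j then 1 else 0) - u $ i * u $ j) *v x = x - (u \<bullet> x) *\<^sub>R u" for x
    by (simp add: vec_eq_iff matrix_vector_mult_def algebra_simps sum_subtractf mult_delta_right inner_vec_def
        sum_distrib_left)
  show "(\<chi> i j. (if i = j then 1 else 0) - u $ i * u $ j) *v x \<in> {u}\<^sup>\<bottom>" for x
    unfolding A by (simp add: orthogonal_comp_def orthogonal_def inner_diff_right u1)
  show "(x - (\<chi> i j. (if i = j then 1 else 0) - u $ i * u $ j) *v x) \<bullet> y = 0" if "y \<in> {u}\<^sup>\<bottom>" for x y
    unfolding A using that by (simp add: orthogonal_comp_def orthogonal_def)
qed (rule subspace_orthogonal_comp)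

lemma orthogonal_comp_image:
  fixes g :: "real^'n^'n"
  assumes g: "orthogonal_matrix g"
  shows "((\<lambda>x. g *v x) ` \<xi>)\<^sup>\<bottom> = (\<lambda>x. g *v x) ` (\<xi>\<^sup>\<bottom>)"
proof -
  have "y \<in> (\<lambda>x. g *v x) ` (\<xi>\<^sup>\<bottom>)" if "y \<in> ((\<lambda>x. g *v x) ` \<xi>)\<^sup>\<bottom>" for y
  proof
    show "y = g *v (transpose g *v y)" by (simp only: orthogonal_cancel(3)[OF g])
    have "x \<bullet> (transpose g *v y) = (g *v x) \<bullet> (g *v (transpose g *v y))" for x
      by (rule orthogonal_matrix_inner[OF g, symmetric])
    then show "transpose g *v y \<in> \<xi>\<^sup>\<bottom>"
      using that unfolding orthogonal_cancel(3)[OF g] by (auto simp: orthogonal_comp_def orthogonal_def)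
  qed
  then show ?thesis
    by (auto simp: orthogonal_comp_def orthogonal_def orthogonal_matrix_inner[OF g])
qed

lemma dim_orthogonal_comp:
  fixes \<xi> :: "(real ^ 'n) set"
  assumes "subspace \<xi>"
  shows "dim (\<xi>\<^sup>\<bottom>) + dim \<xi> = CARD('n)"
  using dim_subspace_orthogonal_to_vectors[OF assms subspace_UNIV]
  by (simp add: orthogonal_comp_def)

section \<open>Reflections and rotations\<close>

definition reflection :: "real ^ 'n \<Rightarrow> real ^ 'n ^ 'n" where
  "reflection v = (\<chi> i j. (if i = j then 1 else 0) - 2 / (v \<bullet> v) * (v $ i * v $ j))"

lemma reflection_apply: "reflection v *v x = x - (2 * (v \<bullet> x) / (v \<bullet> v)) *\<^sub>R v"
proof -
  have "(\<Sum>j\<in>UNIV. ((if i = j then 1 else 0) - 2 / (v \<bullet> v) * (v $ i * v $ j)) * x $ j)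
    = x $ i - 2 / (v \<bullet> v) * (\<Sum>j\<in>UNIV. v $ j * x $ j) * v $ i" for i
    by (simp add: algebra_simps sum_subtractf mult_delta_right sum_distrib_left)
  then show ?thesis
    by (simp add: reflection_def vec_eq_iff matrix_vector_mult_def inner_vec_def[of v x])
qed

lemma reflection_orthogonal: "v \<noteq> 0 \<Longrightarrow> orthogonal_matrix (reflection v)"
proof -
  assume v: "v \<noteq> 0"
  have "reflection v ** reflection v = mat 1"
    using v unfolding matrix_eq matrix_vector_mul_assoc[symmetric] reflection_apply
    by (simp add: inner_diff_right)
  moreover have "transpose (reflection v) = reflection v"
    by (simp add: reflection_def transpose_def vec_eq_iff mult.commute)
  ultimately show ?thesis by (simp add: orthogonal_matrix_def)
qed

lemma reflection_fixes: "v \<bullet> x = 0 \<Longrightarrow> reflection v *v x = x"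
  by (simp add: reflection_apply)

text \<open>
  Conjugation by an orthogonal matrix reduces the claim to the reflection in a coordinate axis, which
  is diagonal.
\<close>

lemma det_reflection:
  fixes v :: "real ^ 'n"
  assumes v: "v \<noteq> 0"
  shows "det (reflection v) = -1"
proof -
  obtain k :: 'n where True by simp
  obtain g where g: "orthogonal_matrix g" "g *v axis k 1 = v /\<^sub>R norm v"
    using orthogonal_matrix_exists_basis[of "v /\<^sub>R norm v" k] v by auto
  define D :: "real^'n^'n" where "D = (\<chi> i j. if i = j then (if i = k then -1 else 1) else 0)"
  have D: "D *v x = x - (2 * x $ k) *\<^sub>R axis k 1" for x
    by (simp add: D_def vec_eq_iff matrix_vector_mult_def axis_def mult_delta_left)
  \<comment> \<open>\<open>D\<close> is the reflection in \<open>e\<^sub>k\<close>, and \<open>g\<close> takes \<open>e\<^sub>k\<close> to the direction of \<open>v\<close>.\<close>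
  have "reflection v ** g = g ** D"
    unfolding matrix_eq
  proof
    fix x
    have v': "v = norm v *\<^sub>R (g *v axis k 1)" using g(2) v by simp
    have "v \<bullet> (g *v x) = norm v * ((g *v axis k 1) \<bullet> (g *v x))"
      by (subst v') simp
    also have "\<dots> = norm v * x $ k"
      unfolding orthogonal_matrix_inner[OF g(1)] by (simp add: inner_axis')
    finally have "(2 * (v \<bullet> (g *v x)) / (v \<bullet> v)) *\<^sub>R v = (2 * x $ k / norm v) *\<^sub>R v"
      using v by (simp add: dot_square_norm power2_eq_square)
    also have "\<dots> = (2 * x $ k) *\<^sub>R (g *v axis k 1)"
      unfolding g(2) by (simp add: divide_inverse)
    finally show "reflection v ** g *v x = g ** D *v x"
      by (simp add: matrix_vector_mul_assoc[symmetric] reflection_apply D matrix_vector_mult_diff_distrib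
          matrix_vector_mult_scaleR)
  qed
  then have "det (reflection v) * det g = det g * det D"
    by (metis det_mul)
  moreover have "det g \<noteq> 0"
    using det_orthogonal_matrix[OF g(1)] by auto
  ultimately have "det (reflection v) = det D" by simp
  also have "\<dots> = (\<Prod>i\<in>UNIV. D $ i $ i)"
    by (rule det_diagonal) (simp add: D_def)
  also have "\<dots> = -1"
    by (simp add: D_def prod.delta)
  finally show ?thesis .
qed

lemma rotation_two_reflections: "v \<noteq> 0 \<Longrightarrow> w \<noteq> 0 \<Longrightarrow> rotation_matrix (reflection v ** reflection w)"
  by (simp add: rotation_matrix_def orthogonal_matrix_mul reflection_orthogonal det_mul det_reflection)

text \<open>
  Reflecting \<open>a\<close> in itself gives \<open>- a\<close>, and the mirror orthogonal to \<open>a + b\<close> exchanges \<open>- a\<close> and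
  \<open>b\<close>. Being a product of two reflections, the map is a rotation; it fixes what is orthogonal to both
  vectors.
\<close>

lemma two_reflections_apply:
  fixes a b :: "real ^ 'n"
  assumes "norm a = 1" "norm b = 1" "a + b \<noteq> 0"
  shows "(reflection (a + b) ** reflection a) *v a = b"
proof -
  have 1: "a \<bullet> a = 1" "b \<bullet> b = 1" using assms by (simp_all add: norm_eq_1)
  then have *: "(a + b) \<bullet> (a + b) = 2 * ((a + b) \<bullet> a)"
    by (simp add: algebra_simps inner_commute)
  have "(a + b) \<bullet> (a + b) \<noteq> 0" using assms(3) by simp
  then have nz: "(a + b) \<bullet> a \<noteq> 0" using * by linarith
  then have "2 * ((a + b) \<bullet> a) / ((a + b) \<bullet> (a + b)) = 1"
    using * by simp
  moreover have "reflection (a + b) *v (- a) = - a + (2 * ((a + b) \<bullet> a) / ((a + b) \<bullet> (a + b))) *\<^sub>R (a + b)"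
    unfolding reflection_apply inner_minus_right by simp
  moreover have "reflection a *v a = - a"
    by (simp add: reflection_apply 1 scaleR_2)
  ultimately show ?thesis
    unfolding matrix_vector_mul_assoc[symmetric] by (simp add: nz)
qed

lemma two_reflections_antipode:
  fixes a z :: "real ^ 'n"
  assumes "norm a = 1" "z \<bullet> a = 0"
  shows "(reflection a ** reflection z) *v a = - a"
proof -
  have 1: "a \<bullet> a = 1" using assms by (simp add: norm_eq_1)
  have "reflection a *v a = - a"
    by (simp add: reflection_apply 1 scaleR_2)
  then show ?thesis
    unfolding matrix_vector_mul_assoc[symmetric] by (simp add: reflection_fixes assms)
qed

lemma reflection_image:
  assumes "subspace \<xi>" "v \<noteq> 0" "v \<in> \<xi> \<or> (\<forall>x\<in>\<xi>. v \<bullet> x = 0)"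
  shows "(\<lambda>x. reflection v *v x) ` \<xi> = \<xi>"
proof -
  have sub: "reflection v *v x \<in> \<xi>" if "x \<in> \<xi>" for x
    using assms that by (auto simp: reflection_apply reflection_fixes subspace_diff subspace_scale)
  have "x = reflection v *v (reflection v *v x)" for x
    using assms(2) by (simp add: reflection_apply inner_diff_right)
  then show ?thesis using sub by blast
qed

text \<open>
  The auxiliary vector \<open>z\<close> serves the antipodal case \<open>b = - a\<close>, where the reflection in \<open>a\<close> already
  moves \<open>a\<close> to \<open>b\<close> and a second reflection has to restore the determinant.
\<close>

lemma rotation_moving_unit_vector:
  fixes a b z :: "real ^ 'n"
  assumes "norm a = 1" "norm b = 1" "z \<noteq> 0" "z \<bullet> a = 0"
  obtains g where "rotation_matrix g" "g *v a = b"
    "\<And>x. x \<bullet> a = 0 \<Longrightarrow> x \<bullet> b = 0 \<Longrightarrow> x \<bullet> z = 0 \<Longrightarrow> g *v x = x"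
    "\<And>\<xi>. subspace \<xi> \<Longrightarrow> a \<in> \<xi> \<Longrightarrow> b \<in> \<xi> \<Longrightarrow> z \<in> \<xi> \<or> (\<forall>x\<in>\<xi>. z \<bullet> x = 0) \<Longrightarrow> (\<lambda>x. g *v x) ` \<xi> = \<xi>"
proof (cases "a + b = 0")
  case True
  then have b: "b = - a" by (simp add: add_eq_0_iff)
  have a: "a \<noteq> 0" using assms by auto
  show ?thesis
  proof
    show "rotation_matrix (reflection a ** reflection z)"
      using a assms by (intro rotation_two_reflections)
    show "(reflection a ** reflection z) *v a = b"
      using assms b by (simp add: two_reflections_antipode)
    show "(reflection a ** reflection z) *v x = x" if "x \<bullet> a = 0" "x \<bullet> b = 0" "x \<bullet> z = 0" for x
      using that unfolding matrix_vector_mul_assoc[symmetric]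
      by (simp add: reflection_fixes inner_commute)
    show "(\<lambda>x. (reflection a ** reflection z) *v x) ` \<xi> = \<xi>"
      if "subspace \<xi>" "a \<in> \<xi>" "b \<in> \<xi>" "z \<in> \<xi> \<or> (\<forall>x\<in>\<xi>. z \<bullet> x = 0)" for \<xi>
      unfolding image_matrix_mul using that a assms by (simp add: reflection_image)
  qed
next
  case False
  have a: "a \<noteq> 0" using assms by auto
  show ?thesis
  proof
    show "rotation_matrix (reflection (a + b) ** reflection a)"
      using a False by (intro rotation_two_reflections)
    show "(reflection (a + b) ** reflection a) *v a = b"
      using assms False by (simp add: two_reflections_apply)
    show "(reflection (a + b) ** reflection a) *v x = x" if "x \<bullet> a = 0" "x \<bullet> b = 0" "x \<bullet> z = 0" for x
      using that unfolding matrix_vector_mul_assoc[symmetric]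
      by (simp add: reflection_fixes inner_commute inner_add_right)
    show "(\<lambda>x. (reflection (a + b) ** reflection a) *v x) ` \<xi> = \<xi>"
      if "subspace \<xi>" "a \<in> \<xi>" "b \<in> \<xi>" "z \<in> \<xi> \<or> (\<forall>x\<in>\<xi>. z \<bullet> x = 0)" for \<xi>
      unfolding image_matrix_mul using that a False by (simp add: reflection_image subspace_add)
  qed
qed

text \<open>
  If \<open>\<xi>\<close> is a line, the vector \<open>z\<close> that corrects the determinant has to be taken orthogonal to \<open>\<xi>\<close>;
  otherwise it is taken in \<open>\<xi>\<close>.
\<close>

lemma rotation_transitive_on_section:
  fixes \<xi> :: "(real ^ 'n) set"
  assumes n: "CARD('n) \<ge> 2" and \<xi>: "subspace \<xi>"
    and a: "a \<in> \<xi>" "norm a = 1" and b: "b \<in> \<xi>" "norm b = 1"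
  obtains g where "rotation_matrix g" "(\<lambda>x. g *v x) ` \<xi> = \<xi>" "g *v a = b"
proof -
  have "\<exists>z. z \<noteq> 0 \<and> z \<bullet> a = 0 \<and> (z \<in> \<xi> \<or> (\<forall>x\<in>\<xi>. z \<bullet> x = 0))"
  proof (cases "\<exists>z\<in>\<xi>. z \<noteq> 0 \<and> z \<bullet> a = 0")
    case False
    obtain z where z: "z \<noteq> 0" "orthogonal a z"
      using orthogonal_to_vector_exists[of a] n by auto
    have "z \<bullet> x = 0" if x: "x \<in> \<xi>" for x
    proof -
      have "a \<bullet> a = 1" using a by (simp add: norm_eq_1)
      then have "(x - (x \<bullet> a) *\<^sub>R a) \<bullet> a = 0" by (simp add: inner_diff_left)
      moreover have "x - (x \<bullet> a) *\<^sub>R a \<in> \<xi>" using x a \<xi> by (simp add: subspace_diff subspace_scale)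
      ultimately have "x - (x \<bullet> a) *\<^sub>R a = 0" using False by blast
      then have "z \<bullet> x = (x \<bullet> a) * (z \<bullet> a)"
        by (metis eq_iff_diff_eq_0 inner_scaleR_right)
      then show ?thesis using z by (simp add: orthogonal_def inner_commute)
    qed
    then show ?thesis using z by (auto simp: orthogonal_def inner_commute)
  qed auto
  then obtain z where "z \<noteq> 0" "z \<bullet> a = 0" "z \<in> \<xi> \<or> (\<forall>x\<in>\<xi>. z \<bullet> x = 0)" by auto
  with rotation_moving_unit_vector[OF a(2) b(2)] a(1) b(1) \<xi> that show thesis by metis
qed

text \<open>
  Three dimensions are needed to have a vector orthogonal to both \<open>a\<close> and \<open>\<theta>\<close> for the antipodal
  case.
\<close>

lemma rotation_fixing_transitive_on_equator:
  fixes \<theta> :: "real ^ 'n"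
  assumes n: "CARD('n) \<ge> 3" and a: "norm a = 1" "a \<bullet> \<theta> = 0" and b: "norm b = 1" "b \<bullet> \<theta> = 0"
  obtains g where "rotation_matrix g" "g *v \<theta> = \<theta>" "g *v a = b"
proof -
  have "dim {a, \<theta>} \<le> card {a, \<theta>}" by (rule dim_le_card') simp
  also have "\<dots> \<le> 2" by (simp add: card_insert_if)
  finally have "dim {a, \<theta>} < DIM(real^'n)" using n by simp
  then obtain z where z: "z \<noteq> 0" "\<And>y. y \<in> span {a, \<theta>} \<Longrightarrow> orthogonal z y"
    using orthogonal_to_subspace_exists[of "{a, \<theta>}"] by auto
  have "z \<bullet> a = 0" "z \<bullet> \<theta> = 0"
    using z(2)[of a] z(2)[of \<theta>] by (simp_all add: span_base orthogonal_def)
  with rotation_moving_unit_vector[OF a(1) b(1) z(1)] a b that show thesis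
    by (metis inner_commute)
qed

text \<open>
  Isometries between the two subspaces and between their complements combine to an orthogonal map. If
  its determinant is negative, a reflection in a vector of \<open>\<xi>\<close> corrects it.
\<close>

lemma rotation_transitive_on_subspaces:
  fixes \<xi> \<eta> :: "(real ^ 'n) set"
  assumes \<xi>: "subspace \<xi>" and \<eta>: "subspace \<eta>" and d: "dim \<xi> = dim \<eta>" "0 < dim \<xi>"
  obtains g where "rotation_matrix g" "(\<lambda>x. g *v x) ` \<xi> = \<eta>"
proof -
  have "dim (\<xi>\<^sup>\<bottom>) = dim (\<eta>\<^sup>\<bottom>)"
    using dim_orthogonal_comp[OF \<xi>] dim_orthogonal_comp[OF \<eta>] d by simp
  then obtain f' where f': "linear f'" "f' ` (\<xi>\<^sup>\<bottom>) = \<eta>\<^sup>\<bottom>" "\<And>x. x \<in> \<xi>\<^sup>\<bottom> \<Longrightarrow> norm (f' x) = norm x"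
    by (rule isometries_subspaces[OF subspace_orthogonal_comp subspace_orthogonal_comp]) blast
  obtain f where f: "linear f" "f ` \<xi> = \<eta>" "\<And>x. x \<in> \<xi> \<Longrightarrow> norm (f x) = norm x"
    by (rule isometries_subspaces[OF \<xi> \<eta> d(1)]) blast
  define h where "h x = f (closest_point \<xi> x) + f' (x - closest_point \<xi> x)" for x
  note cp = closest_point_subspace[OF \<xi>]
  have cp': "x - closest_point \<xi> x \<in> \<xi>\<^sup>\<bottom>" for x
    using cp(2) by (auto simp: orthogonal_comp_def orthogonal_def inner_commute)
  have lin: "linear h"
  proof -
    have cpl: "linear (closest_point \<xi>)" by (rule linear_closest_point[OF \<xi>])
    have "linear (\<lambda>x. x - closest_point \<xi> x)" 
      by (rule linear_compose_sub[OF linear_ident cpl])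
    from linear_compose[OF this f'(1)] linear_compose[OF cpl f(1)]
    show ?thesis unfolding h_def o_def by (rule linear_compose_add[rotated])
  qed
  have "norm (h x) = norm x" for x
  proof -
    have "(norm (h x))\<^sup>2 = (norm (f (closest_point \<xi> x)))\<^sup>2 + (norm (f' (x - closest_point \<xi> x)))\<^sup>2"
      unfolding h_def
    proof (rule norm_add_Pythagorean)
      have "f (closest_point \<xi> x) \<in> \<eta>" "f' (x - closest_point \<xi> x) \<in> \<eta>\<^sup>\<bottom>"
        using f(2) f'(2) cp(1) cp' by blast+
      then show "orthogonal (f (closest_point \<xi> x)) (f' (x - closest_point \<xi> x))"
        by (auto simp: orthogonal_comp_def)
    qed
    also have "\<dots> = (norm (closest_point \<xi> x))\<^sup>2 + (norm (x - closest_point \<xi> x))\<^sup>2"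
      using f(3) f'(3) cp(1) cp' by simp
    also have "\<dots> = (norm (closest_point \<xi> x + (x - closest_point \<xi> x)))\<^sup>2"
      using cp(1) cp' by (intro norm_add_Pythagorean[symmetric]) (auto simp: orthogonal_comp_def)
    finally show ?thesis by simp
  qed
  then have "orthogonal_matrix (matrix h)"
    using lin orthogonal_transformation[of h] orthogonal_transformation_matrix[of h] by auto
  moreover have "matrix h *v x = h x" for x
    using matrix_works[of h] lin by (simp add: scalar_mult_eq_scaleR linear_def Vector_Spaces.linear_def)
  moreover have "h x = f x" if "x \<in> \<xi>" for x
    using that f'(1) by (simp add: h_def closest_point_self linear_0)
  ultimately have m: "orthogonal_matrix (matrix h)" "(\<lambda>x. matrix h *v x) ` \<xi> = \<eta>"
    using f(2) by auto
  show thesis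
  proof (cases "det (matrix h) = 1")
    case True
    then show thesis using that m by (simp add: rotation_matrix_def)
  next
    case False
    then have det: "det (matrix h) = -1" using det_orthogonal_matrix[OF m(1)] by auto
    obtain z where z: "z \<in> \<xi>" "z \<noteq> 0"
      using d(2) dim_eq_0[of \<xi>] by fastforce
    show thesis
    proof (rule that)
      show "rotation_matrix (matrix h ** reflection z)"
        using m z det by (simp add: rotation_matrix_def orthogonal_matrix_mul reflection_orthogonal det_mul det_reflection)
      show "(\<lambda>x. (matrix h ** reflection z) *v x) ` \<xi> = \<eta>"
        unfolding image_matrix_mul using m z \<xi> by (simp add: reflection_image)
    qed
  qed
qed

section \<open>Measurability of matrix operations\<close>

lemma borel_measurable_matrix_vector [measurable (raw)]:
  fixes A :: "'a \<Rightarrow> real ^ 'n ^ 'm"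
  assumes "A \<in> borel_measurable M" "f \<in> borel_measurable M"
  shows "(\<lambda>x. A x *v f x) \<in> borel_measurable M"
proof (rule borel_measurable_continuous_Pair[OF assms])
  show "continuous_on UNIV (\<lambda>x. (fst x :: real ^ 'n ^ 'm) *v snd x)"
    unfolding matrix_vector_mult_def by (intro continuous_intros)
qed

lemma borel_measurable_matrix_matrix [measurable (raw)]:
  fixes A :: "'a \<Rightarrow> real ^ 'n ^ 'm" and B :: "'a \<Rightarrow> real ^ 'k ^ 'n"
  assumes "A \<in> borel_measurable M" "B \<in> borel_measurable M"
  shows "(\<lambda>x. A x ** B x) \<in> borel_measurable M"
proof (rule borel_measurable_continuous_Pair[OF assms])
  show "continuous_on UNIV (\<lambda>x. (fst x :: real ^ 'n ^ 'm) ** (snd x :: real ^ 'k ^ 'n))"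
    unfolding matrix_matrix_mult_def by (intro continuous_intros)
qed

lemma borel_measurable_transpose [measurable (raw)]:
  fixes A :: "'a \<Rightarrow> real ^ 'n ^ 'm"
  assumes "A \<in> borel_measurable M"
  shows "(\<lambda>x. transpose (A x)) \<in> borel_measurable M"
proof (rule borel_measurable_continuous_on[OF _ assms])
  show "continuous_on UNIV (transpose :: real ^ 'n ^ 'm \<Rightarrow> _)"
    unfolding transpose_def by (intro continuous_intros)
qed

section \<open>The invariant measure on the sphere of a subspace\<close>

text \<open>
  Any rotation-invariant law on \<open>\<real>\<^sup>n\<close> with a density would do: its radial part is divided out.
\<close>

definition ball_measure :: "(real ^ 'n) measure" where
  "ball_measure = uniform_measure lborel (ball 0 1)"

lemma emeasure_unit_ball: "emeasure lborel (ball (0::real^'n) 1) \<noteq> 0" "emeasure lborel (ball (0::real^'n) 1) \<noteq> \<infinity>"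
  by (auto simp: emeasure_ball unit_ball_vol_pos less_imp_neq[symmetric] ennreal_eq_0_iff not_le)

interpretation ball_measure: prob_space "ball_measure :: (real ^ 'n) measure"
  unfolding ball_measure_def by (intro prob_space_uniform_measure emeasure_unit_ball)

lemma sets_ball_measure [simp, measurable_cong]: "sets ball_measure = sets borel"
  by (simp add: ball_measure_def)

lemma space_ball_measure [simp]: "space ball_measure = UNIV"
  by (simp add: ball_measure_def)

lemma distr_ball_measure:
  fixes g :: "real ^ 'n ^ 'n"
  assumes g: "orthogonal_matrix g"
  shows "distr ball_measure ball_measure (\<lambda>x. g *v x) = ball_measure"
proof (rule measure_eqI)
  fix A :: "(real ^ 'n) set" assume "A \<in> sets (distr ball_measure ball_measure (\<lambda>x. g *v x))"
  then have [measurable]: "A \<in> sets borel" by simp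
  have [measurable]: "(\<lambda>x. g *v x) \<in> borel_measurable borel" by measurable
  have pre [measurable]: "(\<lambda>x. g *v x) -` X \<in> sets borel" if "X \<in> sets borel" for X
    using measurable_sets[of "\<lambda>x. g *v x" borel borel X] that by simp
  have "emeasure lborel (ball 0 1 \<inter> (\<lambda>x. g *v x) -` A) = emeasure lborel ((\<lambda>x. g *v x) -` (ball 0 1 \<inter> A))"
    by (rule arg_cong[where f="emeasure lborel"]) (auto simp: orthogonal_matrix_norm[OF g])
  also have "\<dots> = emeasure (distr lborel borel (\<lambda>x. g *v x)) (ball 0 1 \<inter> A)"
    by (simp add: emeasure_distr)
  also have "\<dots> = emeasure lborel (ball 0 1 \<inter> A)"
    by (simp add: lborel_orthogonal_invariant orthogonal_matrix_transformation g)
  finally show "emeasure (distr ball_measure ball_measure (\<lambda>x. g *v x)) A = emeasure ball_measure A"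
    by (subst emeasure_distr) (simp_all add: ball_measure_def pre)
qed simp

text \<open>
  The kernel of the projection is a proper subspace, hence a null set.
\<close>

lemma AE_projection_nonzero:
  fixes \<xi> :: "(real ^ 'n) set"
  assumes \<xi>: "subspace \<xi>" "0 < dim \<xi>"
  shows "AE x in ball_measure. projection \<xi> *v x \<noteq> 0"
proof -
  have sub: "{x. projection \<xi> *v x = 0} \<subseteq> \<xi>\<^sup>\<bottom>"
  proof
    fix x assume "x \<in> {x. projection \<xi> *v x = 0}"
    then have "closest_point \<xi> x = 0" by (simp add: projection_apply[OF \<xi>(1)])
    then show "x \<in> \<xi>\<^sup>\<bottom>"
      using closest_point_subspace(2)[OF \<xi>(1), of _ x]
      by (auto simp: orthogonal_comp_def orthogonal_def inner_commute)
  qed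
  have "negligible (\<xi>\<^sup>\<bottom>)"
    using dim_orthogonal_comp[OF \<xi>(1)] \<xi>(2) by (intro negligible_lowdim) simp
  then have "\<xi>\<^sup>\<bottom> \<in> null_sets lebesgue" by (simp add: negligible_iff_null_sets)
  moreover have "closed (\<xi>\<^sup>\<bottom>)" by (intro closed_subspace subspace_orthogonal_comp)
  ultimately have "\<xi>\<^sup>\<bottom> \<in> null_sets lborel"
    using null_sets_completion_iff[of "\<xi>\<^sup>\<bottom>" lborel] by simp
  then have "AE x in lborel. x \<notin> \<xi>\<^sup>\<bottom>" by (rule AE_not_in)
  then have "AE x in lborel. projection \<xi> *v x \<noteq> 0" using sub by (auto elim: eventually_mono)
  moreover have "{x. projection \<xi> *v x \<noteq> 0} \<in> sets borel" by measurable
  ultimately show ?thesis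
    unfolding ball_measure_def by (intro AE_uniform_measureI) auto
qed

text \<open>
  The law of a random unit vector of a random subspace: \<open>\<kappa>\<close> is drawn from \<open>K\<close>, then a point of the ball
  is projected to \<open>\<xi> \<kappa>\<close> and normalised. The result lies on the sphere of \<open>V\<close> almost surely if all
  \<open>\<xi> \<kappa>\<close> are nonzero subspaces of \<open>V\<close>.
\<close>

definition mixture :: "'k measure \<Rightarrow> ('k \<Rightarrow> (real ^ 'n) set) \<Rightarrow> (real ^ 'n) set \<Rightarrow> (real ^ 'n) measure" where
  "mixture K \<xi> V = restrict_space
     (distr (K \<Otimes>\<^sub>M ball_measure) borel (\<lambda>(\<kappa>, x). sgn (projection (\<xi> \<kappa>) *v x))) (sphere 0 1 \<inter> V)"

locale subspace_family = prob_space K for K :: "'k measure" +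
  fixes \<xi> :: "'k \<Rightarrow> (real ^ 'n) set" and V :: "(real ^ 'n) set"
  assumes V: "subspace V"
    and sub: "\<And>\<kappa>. \<kappa> \<in> space K \<Longrightarrow> subspace (\<xi> \<kappa>)"
    and subset: "\<And>\<kappa>. \<kappa> \<in> space K \<Longrightarrow> \<xi> \<kappa> \<subseteq> V"
    and dim: "\<And>\<kappa>. \<kappa> \<in> space K \<Longrightarrow> 0 < dim (\<xi> \<kappa>)"
    and measurable_projection [measurable]: "(\<lambda>\<kappa>. projection (\<xi> \<kappa>)) \<in> borel_measurable K"
begin

sublocale pair: pair_prob_space K "ball_measure :: (real ^ 'n) measure" ..

definition direction :: "'k \<times> (real ^ 'n) \<Rightarrow> real ^ 'n" where
  "direction = (\<lambda>(\<kappa>, x). sgn (projection (\<xi> \<kappa>) *v x))"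

lemma direction_measurable [measurable]: "direction \<in> borel_measurable (K \<Otimes>\<^sub>M ball_measure)"
  unfolding direction_def split_beta by measurable

lemma mixture_direction: "mixture K \<xi> V = restrict_space (distr (K \<Otimes>\<^sub>M ball_measure) borel direction) (sphere 0 1 \<inter> V)"
  by (simp add: mixture_def direction_def)

lemma sphere_V [measurable]: "sphere 0 1 \<inter> V \<in> sets borel"
  using closed_subspace[OF V] by (intro borel_closed closed_Int) auto

lemma direction_in_subspace: "\<kappa> \<in> space K \<Longrightarrow> direction (\<kappa>, x) \<in> \<xi> \<kappa>"
  using closest_point_subspace(1)[OF sub, of \<kappa> x]
  by (auto simp: direction_def sgn_div_norm projection_apply[OF sub] subspace_scale[OF sub])

lemma sets_mixture: "sets (mixture K \<xi> V) = sets (restrict_space borel (sphere 0 1 \<inter> V))"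
  unfolding mixture_def by (rule sets_restrict_space_cong) simp

lemma AE_direction: "AE p in K \<Otimes>\<^sub>M ball_measure. direction p \<in> sphere 0 1 \<inter> V"
proof (rule pair.AE_pair_measure)
  show "{p \<in> space (K \<Otimes>\<^sub>M ball_measure). direction p \<in> sphere 0 1 \<inter> V} \<in> sets (K \<Otimes>\<^sub>M ball_measure)"
    by measurable
  show "AE \<kappa> in K. AE x in ball_measure. direction (\<kappa>, x) \<in> sphere 0 1 \<inter> V"
  proof (rule AE_I2)
    fix \<kappa> assume \<kappa>: "\<kappa> \<in> space K"
    show "AE x in ball_measure. direction (\<kappa>, x) \<in> sphere 0 1 \<inter> V"
      using AE_projection_nonzero[OF sub[OF \<kappa>] dim[OF \<kappa>]]
    proof eventually_elim
      case (elim x)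
      then show ?case
        using direction_in_subspace[OF \<kappa>] subset[OF \<kappa>] by (auto simp: direction_def norm_sgn)
    qed
  qed
qed

lemma emeasure_mixture:
  assumes A: "A \<in> sets (restrict_space borel (sphere 0 1 \<inter> V))"
  shows "emeasure (mixture K \<xi> V) A = emeasure (K \<Otimes>\<^sub>M ball_measure) {p \<in> space (K \<Otimes>\<^sub>M ball_measure). direction p \<in> A}"
proof -
  have "A \<subseteq> sphere 0 1 \<inter> V" "A \<in> sets borel"
    using A sphere_V sets_restrict_space_iff[of "sphere 0 1 \<inter> V" borel A] by auto
  then show ?thesis
    unfolding mixture_direction
    by (subst emeasure_restrict_space) (auto simp: emeasure_distr vimage_def intro!: arg_cong[where f="emeasure _"])
qed

lemma prob_space_mixture: "prob_space (mixture K \<xi> V)"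
proof -
  interpret D: prob_space "distr (K \<Otimes>\<^sub>M ball_measure) borel direction"
    by (intro pair.prob_space_distr) measurable
  have "AE y in distr (K \<Otimes>\<^sub>M ball_measure) borel direction. y \<in> sphere 0 1 \<inter> V"
  proof (subst AE_distr_iff[OF direction_measurable])
    show "{y \<in> space borel. y \<in> sphere 0 1 \<inter> V} \<in> sets borel"
      using sphere_V by (simp only: space_borel UNIV_I simp_thms Collect_mem_eq)
  qed (rule AE_direction)
  then have "emeasure (distr (K \<Otimes>\<^sub>M ball_measure) borel direction) (sphere 0 1 \<inter> V) = 1"
    using sphere_V by (subst D.emeasure_eq_1_AE) auto
  then show ?thesis
    unfolding mixture_direction using sphere_V by (intro prob_space_restrict_space) auto
qed

text \<open>
  Applying \<open>g\<close> to the normalised projection amounts to applying \<open>g\<close> to the subspace and to the point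
  of the ball. The former is realised by the measure-preserving map \<open>t\<close> of the parameter, the latter
  preserves the ball measure.
\<close>

lemma mixture_invariant:
  assumes g: "orthogonal_matrix g" and gV: "(\<lambda>x. g *v x) ` V = V"
    and t: "t \<in> measurable K K" "distr K K t = K"
    and t\<xi>: "\<And>\<kappa>. \<kappa> \<in> space K \<Longrightarrow> \<xi> (t \<kappa>) = (\<lambda>x. g *v x) ` \<xi> \<kappa>"
  shows "distr (mixture K \<xi> V) (restrict_space borel (sphere 0 1 \<inter> V)) (\<lambda>x. g *v x) = mixture K \<xi> V"
    (is "distr ?M ?R ?g = ?M")
proof (rule measure_eqI)
  show "sets (distr ?M ?R ?g) = sets ?M" by (simp add: sets_mixture)
  have gR: "?g \<in> measurable ?R ?R"
  proof (rule measurable_restrict_space2)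
    show "?g \<in> space ?R \<rightarrow> sphere 0 1 \<inter> V"
      using gV by (auto simp: space_restrict_space orthogonal_matrix_norm[OF g])
    show "?g \<in> measurable ?R borel"
      by (intro measurable_restrict_space1) measurable
  qed
  have mem: "?g y \<in> V \<longleftrightarrow> y \<in> V" for y
  proof
    assume "?g y \<in> V"
    then obtain z where "z \<in> V" "?g y = ?g z" using gV by (metis imageE)
    then show "y \<in> V" using orthogonal_cancel(4)[OF g] by metis
  qed (use gV in auto)
  have equiv: "direction (t \<kappa>, ?g x) = ?g (direction (\<kappa>, x))" if "\<kappa> \<in> space K" for \<kappa> x
  proof -
    have "projection (\<xi> (t \<kappa>)) *v ?g x = ?g (projection (\<xi> \<kappa>) *v x)"
      unfolding t\<xi>[OF that] projection_image[OF g sub[OF that]]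
      by (simp only: matrix_vector_mul_assoc[symmetric] orthogonal_cancel(4)[OF g])
    then show ?thesis
      by (simp add: direction_def sgn_div_norm orthogonal_matrix_norm[OF g] matrix_vector_mult_scaleR)
  qed
  let ?P = "K \<Otimes>\<^sub>M ball_measure :: ('k \<times> (real ^ 'n)) measure"
  have sf: "sigma_finite_measure (ball_measure :: (real ^ 'n) measure)"
    by (rule ball_measure.sigma_finite_measure_axioms)
  have distr: "distr ?P ?P (\<lambda>(\<kappa>, x). (t \<kappa>, ?g x)) = ?P"
    using pair_measure_distr[of t K K ?g ball_measure ball_measure] t distr_ball_measure[OF g]
      sf by simp
  fix A assume "A \<in> sets (distr ?M ?R ?g)"
  then have A: "A \<in> sets ?R" by simp
  then have A': "A \<subseteq> sphere 0 1 \<inter> V" and [measurable]: "A \<in> sets borel"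
    using sphere_V sets_restrict_space_iff[of "sphere 0 1 \<inter> V" borel A] by auto
  have [measurable]: "t \<in> measurable K K" by fact
  have gM: "?g \<in> measurable ?M ?R"
    by (subst measurable_cong_sets[OF sets_mixture refl], rule gR)
  have spM: "space ?M = space ?R"
    by (rule sets_eq_imp_space_eq[OF sets_mixture])
  have "emeasure (distr ?M ?R ?g) A = emeasure ?M (?g -` A \<inter> space ?R)"
    using gM A by (subst emeasure_distr) (auto simp: spM)
  also have "\<dots> = emeasure ?P {p \<in> space ?P. direction p \<in> ?g -` A \<inter> space ?R}"
    using measurable_sets[OF gR A] by (rule emeasure_mixture)
  also have "{p \<in> space ?P. direction p \<in> ?g -` A \<inter> space ?R}
    = (\<lambda>(\<kappa>, x). (t \<kappa>, ?g x)) -` {p \<in> space ?P. direction p \<in> A} \<inter> space ?P"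
    using A' measurable_space[OF t(1)]
    by (auto simp: space_pair_measure equiv space_restrict_space mem orthogonal_matrix_norm[OF g] subset_eq)
  also have "emeasure ?P \<dots> = emeasure (distr ?P ?P (\<lambda>(\<kappa>, x). (t \<kappa>, ?g x))) {p \<in> space ?P. direction p \<in> A}"
    by (rule emeasure_distr[symmetric]) measurable
  also have "\<dots> = emeasure ?M A"
    unfolding distr using A by (rule emeasure_mixture[symmetric])
  finally show "emeasure (distr ?M ?R ?g) A = emeasure ?M A" .
qed

end

definition section_group :: "(real ^ 'n) set \<Rightarrow> (real ^ 'n ^ 'n) set" where
  "section_group V = {g. rotation_matrix g \<and> (\<lambda>x. g *v x) ` V = V}"

lemma subspace_family_const:
  assumes "subspace V" "0 < dim (V :: (real ^ 'n) set)"
  shows "subspace_family (return (count_space UNIV) ()) (\<lambda>_. V) V"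
  by (intro subspace_family.intro subspace_family_axioms.intro prob_space_return) (use assms in auto)

lemma section_action:
  fixes g :: "real ^ 'n ^ 'n"
  assumes V: "subspace V" and g: "g \<in> section_group V"
  shows "(\<lambda>x. g *v x) \<in> measurable (restrict_space borel (sphere 0 1 \<inter> V)) (restrict_space borel (sphere 0 1 \<inter> V))"
proof (rule measurable_restrict_space2)
  have "orthogonal_matrix g" "(\<lambda>x. g *v x) ` V = V"
    using g by (simp_all add: section_group_def rotation_orthogonal)
  then show "(\<lambda>x. g *v x) \<in> space (restrict_space borel (sphere 0 1 \<inter> V)) \<rightarrow> sphere 0 1 \<inter> V"
    by (auto simp: space_restrict_space orthogonal_matrix_norm)
  show "(\<lambda>x. g *v x) \<in> borel_measurable (restrict_space borel (sphere 0 1 \<inter> V))"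
    by (intro measurable_restrict_space1) measurable
qed

text \<open>
  A one-point parameter space gives an invariant measure, so the definite description in the
  definition of \<open>section_measure\<close> denotes it.
\<close>

lemma section_measure_eq_const_mixture:
  fixes V :: "(real ^ 'n) set"
  assumes n: "CARD('n) \<ge> 2" and V: "subspace V" "0 < dim V"
  shows "section_measure V = mixture (return (count_space UNIV) ()) (\<lambda>_. V) V"
    and "g \<in> section_group V \<Longrightarrow>
      distr (section_measure V) (restrict_space borel (sphere 0 1 \<inter> V)) (\<lambda>x. g *v x) = section_measure V"
proof -
  interpret subspace_family "return (count_space UNIV) ()" "\<lambda>_. V" V
    using V by (rule subspace_family_const)
  let ?M = "mixture (return (count_space UNIV) ()) (\<lambda>_. V) V" and ?R = "restrict_space borel (sphere 0 1 \<inter> V)"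
  have inv: "distr ?M ?R (\<lambda>x. g *v x) = ?M" if "g \<in> section_group V" for g
    by (rule mixture_invariant[OF _ _ measurable_ident_sets[OF refl] distr_id])
      (use that in \<open>auto simp: section_group_def rotation_orthogonal\<close>)
  show *: "section_measure V = ?M"
    unfolding section_measure_def
  proof (rule invariant_prob_eqI[where e="\<lambda>x. x" and Y="sphere 0 1 \<inter> V"])
    show "sets ?R = sets (vimage_algebra (sphere 0 1 \<inter> V) (\<lambda>x. x) borel)"
      by (rule restrict_space_eq_vimage_algebra) simp
    show "\<exists>T\<in>{(*v) g |g. rotation_matrix g \<and> (*v) g ` V = V}. T x = y"
      if "x \<in> sphere 0 1 \<inter> V" "y \<in> sphere 0 1 \<inter> V" for x y
      using rotation_transitive_on_section[OF n V(1), of x y] that by (auto; metis)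
    show "dist (T x) (T y) = dist x y" if "T \<in> {(*v) g |g. rotation_matrix g \<and> (*v) g ` V = V}" for T x y
      using that orthogonal_transformation_isometry orthogonal_matrix_transformation rotation_orthogonal by blast
  qed (use inv section_action[OF V(1)] in \<open>auto simp: prob_space_mixture sets_mixture section_group_def\<close>)
  show "distr (section_measure V) ?R (\<lambda>x. g *v x) = section_measure V" if "g \<in> section_group V"
    unfolding * using that by (rule inv)
qed

text \<open>
  A random unit vector of a random subspace of \<open>V\<close> is uniformly distributed as soon as the law of the
  random subspace is invariant under a family of rotations that is transitive on the sphere of \<open>V\<close>.
\<close>

lemma (in subspace_family) mixture_eq_section_measure:
  assumes n: "CARD('n) \<ge> 2" and G: "G \<subseteq> section_group V"
    and trans: "\<And>x y. x \<in> sphere 0 1 \<inter> V \<Longrightarrow> y \<in> sphere 0 1 \<inter> V \<Longrightarrow> \<exists>g\<in>G. g *v x = y"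
    and t: "\<And>g. g \<in> G \<Longrightarrow> \<exists>t\<in>measurable K K. distr K K t = K \<and> (\<forall>\<kappa>\<in>space K. \<xi> (t \<kappa>) = (\<lambda>x. g *v x) ` \<xi> \<kappa>)"
  shows "mixture K \<xi> V = section_measure V"
proof -
  let ?R = "restrict_space borel (sphere 0 1 \<inter> V)"
  obtain \<kappa> where \<kappa>: "\<kappa> \<in> space K" using not_empty by auto
  have dV: "0 < dim V" using dim[OF \<kappa>] dim_subset[OF subset[OF \<kappa>]] by simp
  interpret C: subspace_family "return (count_space UNIV) ()" "\<lambda>_. V" V
    using V dV by (rule subspace_family_const)
  note S = section_measure_eq_const_mixture[OF n V dV]
  show ?thesis
  proof (rule transitive_isometries_unique[where e="\<lambda>x. x" and Y="sphere 0 1 \<inter> V" and S="?R" and \<T>="{(*v) g |g. g \<in> G}"])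
    show "sets ?R = sets (vimage_algebra (sphere 0 1 \<inter> V) (\<lambda>x. x) borel)"
      by (rule restrict_space_eq_vimage_algebra) simp
    show "prob_space (mixture K \<xi> V)" by (rule prob_space_mixture)
    show "prob_space (section_measure V)" unfolding S(1) by (rule C.prob_space_mixture)
    show "sets (mixture K \<xi> V) = sets ?R" by (rule sets_mixture)
    show "sets (section_measure V) = sets ?R" unfolding S(1) by (rule C.sets_mixture)
    show "\<exists>T\<in>{(*v) g |g. g \<in> G}. T x = y"
      if "x \<in> sphere 0 1 \<inter> V" "y \<in> sphere 0 1 \<inter> V" for x y
      using trans[OF that] by blast
    fix T assume "T \<in> {(*v) g |g. g \<in> G}"
    then obtain g where g: "T = (*v) g" "g \<in> G" "g \<in> section_group V" using G by auto
    then have og: "orthogonal_matrix g" "(*v) g ` V = V" by (auto simp: section_group_def rotation_orthogonal)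
    show "T \<in> measurable ?R ?R" unfolding g(1) by (rule section_action[OF V g(3)])
    show "dist (T x) (T y) = dist x y" for x y
      unfolding g(1) using og orthogonal_transformation_isometry orthogonal_matrix_transformation by blast
    show "distr (section_measure V) ?R T = section_measure V" unfolding g(1) by (rule S(2)[OF g(3)])
    obtain t where "t \<in> measurable K K" "distr K K t = K" "\<forall>\<kappa>\<in>space K. \<xi> (t \<kappa>) = (\<lambda>x. g *v x) ` \<xi> \<kappa>"
      using t[OF g(2)] by blast
    then show "distr (mixture K \<xi> V) ?R T = mixture K \<xi> V"
      unfolding g(1) by (intro mixture_invariant[OF og]) auto
  qed
qed

lemma section_measure_projection:
  fixes \<xi> :: "(real ^ 'n) set"
  assumes n: "CARD('n) \<ge> 2" and \<xi>: "subspace \<xi>" "0 < dim \<xi>"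
  shows "section_measure \<xi> = restrict_space (distr ball_measure borel (\<lambda>x. sgn (projection \<xi> *v x))) (sphere 0 1 \<inter> \<xi>)"
    and "prob_space (section_measure \<xi>)"
    and "sets (section_measure \<xi>) = sets (restrict_space borel (sphere 0 1 \<inter> \<xi>))"
proof -
  interpret C: subspace_family "return (count_space UNIV) ()" "\<lambda>_. \<xi>" \<xi>
    using \<xi> by (rule subspace_family_const)
  let ?K = "return (count_space UNIV) ()" and ?B = "ball_measure :: (real ^ 'n) measure"
  note S = section_measure_eq_const_mixture[OF n \<xi>]
  have "distr (?K \<Otimes>\<^sub>M ?B) ?B snd = ?B"
  proof (rule measure_eqI)
    fix A assume "A \<in> sets (distr (?K \<Otimes>\<^sub>M ?B) ?B snd)"
    then have A: "A \<in> sets ?B" by simp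
    have "emeasure (distr (?K \<Otimes>\<^sub>M ?B) ?B snd) A = emeasure (?K \<Otimes>\<^sub>M ?B) (space ?K \<times> A)"
      using A by (subst emeasure_distr) (auto intro!: arg_cong[where f="emeasure _"] simp: space_pair_measure)
    also have "\<dots> = emeasure ?B A"
      using A C.emeasure_space_1 by (subst ball_measure.emeasure_pair_measure_Times) auto
    finally show "emeasure (distr (?K \<Otimes>\<^sub>M ?B) ?B snd) A = emeasure ?B A" .
  qed simp
  then have "distr ?B borel (\<lambda>x. sgn (projection \<xi> *v x)) = distr (distr (?K \<Otimes>\<^sub>M ?B) ?B snd) borel (\<lambda>x. sgn (projection \<xi> *v x))"
    by simp
  also have "\<dots> = distr (?K \<Otimes>\<^sub>M ?B) borel (\<lambda>(\<kappa>, x). sgn (projection \<xi> *v x))"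
    by (subst distr_distr) (auto simp: o_def case_prod_unfold)
  finally show "section_measure \<xi> = restrict_space (distr ?B borel (\<lambda>x. sgn (projection \<xi> *v x))) (sphere 0 1 \<inter> \<xi>)"
    unfolding S(1) mixture_def by simp
  show "prob_space (section_measure \<xi>)" unfolding S(1) by (rule C.prob_space_mixture)
  show "sets (section_measure \<xi>) = sets (restrict_space borel (sphere 0 1 \<inter> \<xi>))" unfolding S(1) by (rule C.sets_mixture)
qed

text \<open>
  The indicator of the sphere only removes the null set of points whose projection vanishes; there
  \<open>sgn\<close> takes the value \<open>0\<close>, at which \<open>f\<close> is not controlled.
\<close>

lemma section_integral:
  fixes \<xi> :: "(real ^ 'n) set" and f :: "real ^ 'n \<Rightarrow> 'c::{banach, second_countable_topology}"
  assumes n: "CARD('n) \<ge> 2" and \<xi>: "subspace \<xi>" "0 < dim \<xi>"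
    and f: "f \<in> borel_measurable (restrict_space borel (sphere 0 1 \<inter> \<xi>))"
  shows "integrable (section_measure \<xi>) f \<longleftrightarrow>
      integrable ball_measure (\<lambda>x. indicator (sphere 0 1) (sgn (projection \<xi> *v x)) *\<^sub>R f (sgn (projection \<xi> *v x)))"
    and "(\<integral>y. f y \<partial>section_measure \<xi>) =
      (\<integral>x. indicator (sphere 0 1) (sgn (projection \<xi> *v x)) *\<^sub>R f (sgn (projection \<xi> *v x)) \<partial>ball_measure)"
proof -
  have [measurable]: "sphere 0 1 \<inter> \<xi> \<in> sets borel"
    using closed_subspace[OF \<xi>(1)] by (intro borel_closed closed_Int) auto
  have F [measurable]: "(\<lambda>y. indicator (sphere 0 1 \<inter> \<xi>) y *\<^sub>R f y) \<in> borel_measurable borel"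
    using f by (subst (asm) borel_measurable_restrict_space_iff) auto
  have "sgn (projection \<xi> *v x) \<in> \<xi>" for x
    using closest_point_subspace(1)[OF \<xi>(1)]
    by (simp add: sgn_div_norm projection_apply[OF \<xi>(1)] subspace_scale[OF \<xi>(1)])
  then have ind: "indicator (sphere 0 1 \<inter> \<xi>) (sgn (projection \<xi> *v x)) = (indicator (sphere 0 1) (sgn (projection \<xi> *v x)) :: real)" for x
    by (auto simp: indicator_def)
  note S = section_measure_projection(1)[OF n \<xi>]
  show "integrable (section_measure \<xi>) f \<longleftrightarrow>
      integrable ball_measure (\<lambda>x. indicator (sphere 0 1) (sgn (projection \<xi> *v x)) *\<^sub>R f (sgn (projection \<xi> *v x)))"
    unfolding S by (subst integrable_restrict_space; simp?) (subst integrable_distr_eq; simp add: ind)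
  show "(\<integral>y. f y \<partial>section_measure \<xi>) =
      (\<integral>x. indicator (sphere 0 1) (sgn (projection \<xi> *v x)) *\<^sub>R f (sgn (projection \<xi> *v x)) \<partial>ball_measure)"
    unfolding S by (subst integral_restrict_space; simp?) (subst integral_distr; simp add: ind)
qed

text \<open>
  Two-stage integration: first over the sphere of the random subspace, then over the parameter.
\<close>

lemma (in subspace_family) mixture_fubini:
  fixes f :: "real ^ 'n \<Rightarrow> 'c::{real_normed_field, banach, second_countable_topology}"
  assumes n: "CARD('n) \<ge> 2" and f: "integrable (mixture K \<xi> V) f"
  shows "AE \<kappa> in K. integrable (section_measure (\<xi> \<kappa>)) f"
    and "integrable K (\<lambda>\<kappa>. radon f (\<xi> \<kappa>))"
    and "(\<integral>\<kappa>. radon f (\<xi> \<kappa>) \<partial>K) = (\<integral>y. f y \<partial>mixture K \<xi> V)"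
    and "(\<integral>\<kappa>. norm (radon f (\<xi> \<kappa>)) \<partial>K) \<le> (\<integral>y. norm (f y) \<partial>mixture K \<xi> V)"
proof -
  let ?P = "K \<Otimes>\<^sub>M ball_measure :: ('k \<times> (real ^ 'n)) measure"
  define h where "h p = indicator (sphere 0 1) (direction p) *\<^sub>R f (direction p)" for p
  have fm: "f \<in> borel_measurable (restrict_space borel (sphere 0 1 \<inter> V))"
    using borel_measurable_integrable[OF f] by (subst (asm) measurable_cong_sets[OF sets_mixture refl])
  have F [measurable]: "(\<lambda>y. indicator (sphere 0 1 \<inter> V) y *\<^sub>R f y) \<in> borel_measurable borel"
    using fm by (subst (asm) borel_measurable_restrict_space_iff) auto
  have Fn [measurable]: "(\<lambda>y. indicator (sphere 0 1 \<inter> V) y *\<^sub>R norm (f y)) \<in> borel_measurable borel"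
  proof -
    have "(\<lambda>y. norm (indicat_real (sphere 0 1 \<inter> V) y *\<^sub>R f y)) \<in> borel_measurable borel"
      by measurable
    then show ?thesis by simp
  qed
  have ind: "indicator (sphere 0 1 \<inter> V) (direction p) = (indicator (sphere 0 1) (direction p) :: real)" if "p \<in> space ?P" for p
    using that direction_in_subspace subset by (fastforce simp: space_pair_measure indicator_def)
  have h: "integrable ?P h"
  proof -
    have "integrable ?P (\<lambda>p. indicator (sphere 0 1 \<inter> V) (direction p) *\<^sub>R f (direction p))"
      using f unfolding mixture_direction
      by (subst (asm) integrable_restrict_space; simp?) (subst (asm) integrable_distr_eq; simp)
    then show ?thesis
      by (rule Bochner_Integration.integrable_cong[THEN iffD1, rotated -1]) (simp_all add: h_def ind)
  qed
  have int_h: "(\<integral>y. f y \<partial>mixture K \<xi> V) = (\<integral>p. h p \<partial>?P)"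
    unfolding mixture_direction
    by (subst integral_restrict_space; simp?) (subst integral_distr; simp add: h_def ind cong: Bochner_Integration.integral_cong)
  have "(\<integral>y. norm (f y) \<partial>mixture K \<xi> V)
    = (\<integral>y. indicator (sphere 0 1 \<inter> V) y *\<^sub>R norm (f y) \<partial>distr ?P borel direction)"
    unfolding mixture_direction by (rule integral_restrict_space) simp
  also have "\<dots> = (\<integral>p. indicator (sphere 0 1 \<inter> V) (direction p) *\<^sub>R norm (f (direction p)) \<partial>?P)"
    by (rule integral_distr[OF direction_measurable Fn])
  also have "\<dots> = (\<integral>p. norm (h p) \<partial>?P)"
    by (rule Bochner_Integration.integral_cong) (simp_all add: h_def ind)
  finally have int_nh: "(\<integral>y. norm (f y) \<partial>mixture K \<xi> V) = (\<integral>p. norm (h p) \<partial>?P)" .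
  have sec: "integrable (section_measure (\<xi> \<kappa>)) f \<longleftrightarrow> integrable ball_measure (\<lambda>x. h (\<kappa>, x))"
    "radon f (\<xi> \<kappa>) = (\<integral>x. h (\<kappa>, x) \<partial>ball_measure)" if \<kappa>: "\<kappa> \<in> space K" for \<kappa>
  proof -
    have "f \<in> borel_measurable (restrict_space (restrict_space borel (sphere 0 1 \<inter> V)) (sphere 0 1 \<inter> \<xi> \<kappa>))"
      using fm by (rule measurable_restrict_space1)
    also have "restrict_space (restrict_space borel (sphere 0 1 \<inter> V)) (sphere 0 1 \<inter> \<xi> \<kappa>)
      = restrict_space borel (sphere 0 1 \<inter> \<xi> \<kappa>)"
    proof (subst restrict_restrict_space)
      show "sphere 0 1 \<inter> \<xi> \<kappa> \<inter> space borel \<in> sets borel"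
        using closed_subspace[OF sub[OF \<kappa>]] by (intro borel_closed sets.Int) auto
      show "restrict_space borel (sphere 0 1 \<inter> V \<inter> (sphere 0 1 \<inter> \<xi> \<kappa>)) = restrict_space borel (sphere 0 1 \<inter> \<xi> \<kappa>)"
        using subset[OF \<kappa>] by (intro arg_cong[where f="restrict_space borel"]) auto
    qed simp
    finally have m: "f \<in> borel_measurable (restrict_space borel (sphere 0 1 \<inter> \<xi> \<kappa>))" .
    show "integrable (section_measure (\<xi> \<kappa>)) f \<longleftrightarrow> integrable ball_measure (\<lambda>x. h (\<kappa>, x))"
      "radon f (\<xi> \<kappa>) = (\<integral>x. h (\<kappa>, x) \<partial>ball_measure)"
      using section_integral[OF n sub[OF \<kappa>] dim[OF \<kappa>] m] by (simp_all add: radon_def h_def direction_def)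
  qed
  show "AE \<kappa> in K. integrable (section_measure (\<xi> \<kappa>)) f"
    using pair.AE_integrable_fst'[OF h] by (rule AE_mp) (auto simp: sec)
  have *: "integrable K (\<lambda>\<kappa>. \<integral>x. h (\<kappa>, x) \<partial>ball_measure)"
    by (rule pair.integrable_fst'[OF h])
  then show "integrable K (\<lambda>\<kappa>. radon f (\<xi> \<kappa>))"
    by (simp add: sec cong: Bochner_Integration.integrable_cong)
  show "(\<integral>\<kappa>. radon f (\<xi> \<kappa>) \<partial>K) = (\<integral>y. f y \<partial>mixture K \<xi> V)"
    using pair.integral_fst'[OF h] by (simp add: sec int_h cong: Bochner_Integration.integral_cong)
  have "(\<integral>\<kappa>. norm (radon f (\<xi> \<kappa>)) \<partial>K) = (\<integral>\<kappa>. norm (\<integral>x. h (\<kappa>, x) \<partial>ball_measure) \<partial>K)"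
    by (simp add: sec cong: Bochner_Integration.integral_cong)
  also have "\<dots> \<le> (\<integral>\<kappa>. (\<integral>x. norm (h (\<kappa>, x)) \<partial>ball_measure) \<partial>K)"
    using * pair.integrable_fst'[OF integrable_norm[OF h]]
    by (intro integral_mono) (auto intro: integral_norm_bound)
  also have "\<dots> = (\<integral>y. norm (f y) \<partial>mixture K \<xi> V)"
    using pair.integral_fst'[OF integrable_norm[OF h]] by (simp add: int_nh)
  finally show "(\<integral>\<kappa>. norm (radon f (\<xi> \<kappa>)) \<partial>K) \<le> (\<integral>y. norm (f y) \<partial>mixture K \<xi> V)" .
qed

section \<open>Haar measure on the pointwise stabilisers of coordinate axes\<close>

definition fix_group :: "'n set \<Rightarrow> (real ^ 'n ^ 'n) set" where
  "fix_group J = {g. rotation_matrix g \<and> (\<forall>j\<in>J. g *v axis j 1 = axis j 1)}"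

definition axes_comp :: "'n set \<Rightarrow> (real ^ 'n) set" where
  "axes_comp J = {axis j 1 |j. j \<in> J}\<^sup>\<bottom>"

definition haar :: "'n set \<Rightarrow> (real ^ 'n ^ 'n) measure \<Rightarrow> bool" where
  "haar J M \<longleftrightarrow> prob_space M \<and> sets M = sets (restrict_space borel (fix_group J)) \<and>
     (\<forall>h\<in>fix_group J. distr M (restrict_space borel (fix_group J)) (\<lambda>g. h ** g) = M)"

lemma fix_group_mult: "g \<in> fix_group J \<Longrightarrow> h \<in> fix_group J \<Longrightarrow> g ** h \<in> fix_group J"
  by (auto simp: fix_group_def rotation_mult matrix_vector_mul_assoc[symmetric])

lemma fix_group_transpose:
  assumes "g \<in> fix_group J"
  shows "transpose g \<in> fix_group J"
  using assms orthogonal_cancel(4)[of g] unfolding fix_group_def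
  by (auto simp: rotation_transpose simp del: transpose_matrix_vector) (metis rotation_orthogonal)

lemma mat_1_fix_group: "mat 1 \<in> fix_group J"
  by (simp add: fix_group_def rotation_one)

lemma space_fix_group: "space (restrict_space borel (fix_group J)) = fix_group J"
  by (simp add: space_restrict_space)

lemma fix_group_section_group:
  fixes J :: "'n::finite set"
  shows "fix_group J \<subseteq> section_group (axes_comp J)"
proof
  fix g :: "real ^ 'n ^ 'n" assume g: "g \<in> fix_group J"
  then have "(*v) g ` {axis j 1 |j. j \<in> J} = {axis j 1 |j. j \<in> J}"
    by (force simp: fix_group_def image_iff)
  then have "(*v) g ` axes_comp J = axes_comp J"
    using orthogonal_comp_image[of g "{axis j 1 |j. j \<in> J}"] g
    by (simp add: axes_comp_def fix_group_def rotation_orthogonal)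
  with g show "g \<in> section_group (axes_comp J)"
    by (simp add: fix_group_def section_group_def)
qed

lemma axis_in_axes_comp: "k \<notin> J \<Longrightarrow> axis k 1 \<in> axes_comp J"
  by (auto simp: axes_comp_def orthogonal_comp_def orthogonal_def inner_axis_axis)

text \<open>
  If at most one axis is left free, orthogonality makes the matrix diagonal and the determinant fixes
  the remaining entry.
\<close>

lemma fix_group_trivial:
  fixes J :: "'n::finite set"
  assumes "card (- J) \<le> 1"
  shows "fix_group J = {mat 1 :: real ^ 'n ^ 'n}"
proof -
  have "g = mat 1" if g: "g \<in> fix_group J" for g :: "real ^ 'n ^ 'n"
  proof -
    obtain k where k: "- J \<subseteq> {k}"
      using assms card_le_Suc0_iff_eq[of "- J"] by (cases "- J = {}") auto
    have col: "g $ i $ j = (g *v axis j 1) $ i" for i j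
      by (simp add: matrix_vector_mult_def axis_def mult_delta_right)
    have g1: "g *v axis j 1 = axis j 1" if "j \<noteq> k" for j
      using g k that by (auto simp: fix_group_def)
    have ort: "orthogonal_matrix g" using g by (simp add: fix_group_def rotation_orthogonal)
    have "g $ i $ k = 0" if "i \<noteq> k" for i
    proof -
      have "(g *v axis i 1) \<bullet> (g *v axis k 1) = 0"
        unfolding orthogonal_matrix_inner[OF ort] using that by (simp add: inner_axis_axis)
      then show ?thesis using that by (simp add: g1 col inner_axis')
    qed
    then have offdiag: "g $ i $ j = 0" if "i \<noteq> j" for i j
    proof (cases "j = k")
      case False
      have "(axis j 1 :: real ^ 'n) $ i = 0" using that by (simp add: axis_def)
      then show ?thesis using False by (simp add: col g1)
    qed (use that in simp)
    have diag: "g $ i $ i = 1" if "i \<noteq> k" for i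
    proof -
      have "(axis i 1 :: real ^ 'n) $ i = 1" by simp
      then show ?thesis unfolding col g1[OF that] .
    qed
    have "1 = det g" using g by (simp add: fix_group_def rotation_matrix_def)
    also have "\<dots> = (\<Prod>i\<in>UNIV. g $ i $ i)" using offdiag by (rule det_diagonal)
    also have "\<dots> = (\<Prod>i\<in>UNIV. if i = k then g $ k $ k else 1)"
      using diag by (intro prod.cong) auto
    also have "\<dots> = g $ k $ k" by simp
    finally have "g $ i $ i = 1" for i using diag by (cases "i = k") auto
    then show ?thesis
      using offdiag by (auto simp: vec_eq_iff mat_def)
  qed
  then show ?thesis using mat_1_fix_group by blast
qed

lemma reflection_measurable [measurable (raw)]:
  fixes f :: "'a \<Rightarrow> real ^ 'n"
  assumes [measurable]: "f \<in> borel_measurable M"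
  shows "(\<lambda>x. reflection (f x)) \<in> borel_measurable M"
proof -
  have [measurable]: "(\<lambda>v :: real ^ 'n. \<chi> i j. v $ i * v $ j) \<in> borel_measurable borel"
    by (intro borel_measurable_continuous_onI continuous_intros)
  have eq: "reflection v = mat 1 - (2 / (v \<bullet> v)) *\<^sub>R (\<chi> i j. v $ i * v $ j)" for v :: "real ^ 'n"
    by (simp add: reflection_def vec_eq_iff mat_def)
  show ?thesis unfolding eq by measurable
qed

text \<open>
  A Borel section of \<open>g \<mapsto> g e\<^sub>k\<close> by products of two reflections; the axis \<open>l\<close> only serves the
  antipode of \<open>e\<^sub>k\<close>, where the general formula degenerates.
\<close>

definition axis_rotation :: "'n \<Rightarrow> 'n \<Rightarrow> real ^ 'n \<Rightarrow> real ^ 'n ^ 'n" where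
  "axis_rotation k l \<theta> =
     (if \<theta> = - axis k 1 then reflection (axis k 1) ** reflection (axis l 1)
      else reflection (axis k 1 + \<theta>) ** reflection (axis k 1))"

lemma axis_rotation_measurable [measurable (raw)]:
  assumes [measurable]: "f \<in> borel_measurable M"
  shows "(\<lambda>x. axis_rotation k l (f x)) \<in> borel_measurable M"
  unfolding axis_rotation_def by measurable

lemma axis_rotation:
  fixes J :: "'n::finite set"
  assumes k: "k \<notin> J" "l \<notin> J" "k \<noteq> l" and \<theta>: "norm \<theta> = 1" "\<theta> \<in> axes_comp J"
  shows "axis_rotation k l \<theta> \<in> fix_group J" "axis_rotation k l \<theta> *v axis k 1 = \<theta>"
proof -
  let ?a = "axis k 1 :: real ^ 'n" and ?l = "axis l 1 :: real ^ 'n"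
  have nz: "?a \<noteq> 0" "?l \<noteq> 0" by (simp_all add: axis_eq_0_iff)
  have orth: "?l \<bullet> ?a = 0" using k by (simp add: inner_axis_axis)
  have fix_a: "?a \<bullet> axis j 1 = 0" "?l \<bullet> axis j 1 = 0" "\<theta> \<bullet> axis j 1 = 0" if "j \<in> J" for j
    using that k \<theta>(2) by (auto simp: inner_axis_axis axes_comp_def orthogonal_comp_def orthogonal_def inner_commute)
  show "axis_rotation k l \<theta> *v axis k 1 = \<theta>"
    using two_reflections_antipode[of ?a ?l] two_reflections_apply[of ?a \<theta>] \<theta>(1) orth
    by (auto simp: axis_rotation_def add_eq_0_iff)
  have "rotation_matrix (axis_rotation k l \<theta>)"
    using nz rotation_two_reflections[of ?a ?l] rotation_two_reflections[of "?a + \<theta>" ?a]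
    by (auto simp: axis_rotation_def add_eq_0_iff)
  moreover have "axis_rotation k l \<theta> *v axis j 1 = axis j 1" if "j \<in> J" for j
    by (auto simp: axis_rotation_def matrix_vector_mul_assoc[symmetric] reflection_fixes fix_a[OF that] inner_add_left)
  ultimately show "axis_rotation k l \<theta> \<in> fix_group J" by (simp add: fix_group_def)
qed

lemma fix_group_left_mult:
  assumes "h \<in> fix_group J"
  shows "(\<lambda>g. h ** g) \<in> measurable (restrict_space borel (fix_group J)) (restrict_space borel (fix_group J))"
proof (rule measurable_restrict_space2)
  show "(\<lambda>g. h ** g) \<in> space (restrict_space borel (fix_group J)) \<rightarrow> fix_group J"
    using fix_group_mult[OF assms] by (auto simp: space_fix_group)
  show "(\<lambda>g. h ** g) \<in> borel_measurable (restrict_space borel (fix_group J))"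
    by (intro measurable_restrict_space1) measurable
qed

text \<open>
  Since \<open>axis_rotation k l\<close> is a measurable section of the orbit map \<open>g \<mapsto> g e\<^sub>k\<close>, every element of
  the group is uniquely a product of a value of this section and an element fixing also \<open>e\<^sub>k\<close>. A left
  translation by \<open>h\<close> moves the orbit point \<open>\<theta>\<close> to \<open>h \<theta>\<close> and translates the second factor by an
  element depending on \<open>\<theta>\<close>; both operations preserve the product measure.
\<close>

lemma haar_step:
  fixes M' :: "(real ^ 'n ^ 'n) measure"
  assumes M': "haar (insert k J) M'" and k: "k \<notin> J" "l \<notin> J" "k \<noteq> l"
  shows "(\<lambda>(\<theta>, \<gamma>). axis_rotation k l \<theta> ** \<gamma>) \<in>
      measurable (section_measure (axes_comp J) \<Otimes>\<^sub>M M') (restrict_space borel (fix_group J))" (is "?m \<in> measurable (?S \<Otimes>\<^sub>M _) ?R")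
    and "haar J (distr (section_measure (axes_comp J) \<Otimes>\<^sub>M M') (restrict_space borel (fix_group J))
      (\<lambda>(\<theta>, \<gamma>). axis_rotation k l \<theta> ** \<gamma>))"
proof -
  let ?W = "axes_comp J" and ?R' = "restrict_space borel (fix_group (insert k J))" and ?r = "axis_rotation k l"
  have "card {k, l} \<le> CARD('n)" by (intro card_mono) auto
  then have n: "CARD('n) \<ge> 2" using k by simp
  have W: "subspace ?W" by (simp add: axes_comp_def subspace_orthogonal_comp)
  have dW: "0 < dim ?W"
  proof (rule gr0I)
    assume "dim ?W = 0"
    then have "axis k 1 = (0 :: real ^ 'n)"
      using axis_in_axes_comp[OF k(1)] dim_eq_0[of ?W] by blast
    then show False by (simp add: axis_eq_0_iff)
  qed
  note S = section_measure_projection[OF n W dW]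
  interpret S: prob_space ?S by (rule S(2))
  interpret M': prob_space M' using M' by (simp add: haar_def)
  interpret P: pair_prob_space ?S M' ..
  have spS: "space ?S = sphere 0 1 \<inter> ?W"
    using sets_eq_imp_space_eq[OF S(3)] by (simp add: space_restrict_space)
  have setsM': "sets M' = sets ?R'" using M' by (simp add: haar_def)
  have spM': "space M' = fix_group (insert k J)"
    using sets_eq_imp_space_eq[OF setsM'] by (simp add: space_fix_group)
  have [measurable]: "(\<lambda>x. x) \<in> borel_measurable ?S"
    by (subst measurable_cong_sets[OF S(3) refl]) (intro measurable_restrict_space1 measurable_ident_sets refl)
  have [measurable]: "(\<lambda>x. x) \<in> borel_measurable M'"
    by (subst measurable_cong_sets[OF setsM' refl]) (intro measurable_restrict_space1 measurable_ident_sets refl)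
  have fst [measurable]: "fst \<in> borel_measurable (?S \<Otimes>\<^sub>M M')"
    using measurable_compose[OF measurable_fst, of "\<lambda>x. x" ?S borel M'] by simp
  have snd [measurable]: "snd \<in> borel_measurable (?S \<Otimes>\<^sub>M M')"
    using measurable_compose[OF measurable_snd, of "\<lambda>x. x" M' borel ?S] by simp
  have r: "?r \<theta> \<in> fix_group J" "?r \<theta> *v axis k 1 = \<theta>" if "\<theta> \<in> space ?S" for \<theta>
    using axis_rotation[OF k, of \<theta>] that by (auto simp: spS)
  have sub: "fix_group (insert k J) \<subseteq> fix_group J" by (auto simp: fix_group_def)
  show m [measurable]: "?m \<in> measurable (?S \<Otimes>\<^sub>M M') ?R"
  proof (rule measurable_restrict_space2)
    show "?m \<in> space (?S \<Otimes>\<^sub>M M') \<rightarrow> fix_group J"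
      by (auto simp: space_pair_measure spM' intro!: fix_group_mult[of _ J] r(1) dest: subsetD[OF sub])
    show "?m \<in> borel_measurable (?S \<Otimes>\<^sub>M M')"
      unfolding split_beta by measurable
  qed
  define M where "M = distr (?S \<Otimes>\<^sub>M M') ?R ?m"
  have M_eq: "emeasure M A = (\<integral>\<^sup>+\<theta>. emeasure M' {\<gamma>\<in>space M'. ?r \<theta> ** \<gamma> \<in> A} \<partial>?S)"
    and phi: "(\<lambda>\<theta>. emeasure M' {\<gamma>\<in>space M'. ?r \<theta> ** \<gamma> \<in> A}) \<in> borel_measurable ?S"
    if [measurable]: "A \<in> sets ?R" for A
  proof -
    let ?Q = "?m -` A \<inter> space (?S \<Otimes>\<^sub>M M')"
    have Q: "?Q \<in> sets (?S \<Otimes>\<^sub>M M')" by measurable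
    have slice: "Pair \<theta> -` ?Q = {\<gamma>\<in>space M'. ?r \<theta> ** \<gamma> \<in> A}" if "\<theta> \<in> space ?S" for \<theta>
      using that by (auto simp: space_pair_measure)
    have "emeasure M A = emeasure (?S \<Otimes>\<^sub>M M') ?Q"
      unfolding M_def by (rule emeasure_distr) measurable
    also have "\<dots> = (\<integral>\<^sup>+\<theta>. emeasure M' (Pair \<theta> -` ?Q) \<partial>?S)"
      by (rule M'.emeasure_pair_measure_alt[OF Q])
    also have "\<dots> = (\<integral>\<^sup>+\<theta>. emeasure M' {\<gamma>\<in>space M'. ?r \<theta> ** \<gamma> \<in> A} \<partial>?S)"
      by (rule nn_integral_cong) (simp only: slice)
    finally show "emeasure M A = (\<integral>\<^sup>+\<theta>. emeasure M' {\<gamma>\<in>space M'. ?r \<theta> ** \<gamma> \<in> A} \<partial>?S)" .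
    show "(\<lambda>\<theta>. emeasure M' {\<gamma>\<in>space M'. ?r \<theta> ** \<gamma> \<in> A}) \<in> borel_measurable ?S"
      by (rule measurable_cong[THEN iffD1, OF _ M'.measurable_emeasure_Pair[OF Q]]) (simp only: slice)
  qed
  have "distr M ?R (\<lambda>g. h ** g) = M" if h: "h \<in> fix_group J" for h
  proof (rule measure_eqI)
    show "sets (distr M ?R (\<lambda>g. h ** g)) = sets M" by (simp add: M_def)
    fix A assume "A \<in> sets (distr M ?R (\<lambda>g. h ** g))"
    then have A: "A \<in> sets ?R" by simp
    have lm: "(\<lambda>g. h ** g) \<in> measurable ?R ?R" by (rule fix_group_left_mult[OF h])
    have hS: "h *v \<theta> \<in> space ?S" if "\<theta> \<in> space ?S" for \<theta>
      using that h fix_group_section_group[of J]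
      by (force simp: spS section_group_def orthogonal_matrix_norm[OF rotation_orthogonal])
    have inv: "emeasure M' {\<gamma>\<in>space M'. ?r \<theta> ** \<gamma> \<in> (\<lambda>g. h ** g) -` A \<inter> fix_group J}
      = emeasure M' {\<gamma>\<in>space M'. ?r (h *v \<theta>) ** \<gamma> \<in> A}" if \<theta>: "\<theta> \<in> space ?S" for \<theta>
    proof -
      \<comment> \<open>The element \<open>u\<close> measures the failure of the section to commute with \<open>h\<close>; it fixes \<open>e\<^sub>k\<close>.\<close>
      define u where "u = transpose (?r (h *v \<theta>)) ** (h ** ?r \<theta>)"
      have r\<theta>: "?r \<theta> \<in> fix_group J" and rh\<theta>: "?r (h *v \<theta>) \<in> fix_group J"
        using r(1) \<theta> hS by auto
      then have orh: "orthogonal_matrix (?r (h *v \<theta>))" by (simp add: fix_group_def rotation_orthogonal)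
      have "u *v axis k 1 = transpose (?r (h *v \<theta>)) *v (?r (h *v \<theta>) *v axis k 1)"
        unfolding u_def r(2)[OF hS[OF \<theta>]] by (simp only: matrix_vector_mul_assoc[symmetric] r(2)[OF \<theta>])
      also have "\<dots> = axis k 1" by (rule orthogonal_cancel(4)[OF orh])
      finally have "u *v axis k 1 = axis k 1" .
      moreover have "u \<in> fix_group J"
        unfolding u_def using h r\<theta> rh\<theta> by (intro fix_group_mult fix_group_transpose)
      ultimately have u: "u \<in> fix_group (insert k J)" by (auto simp: fix_group_def)
      have ru: "?r (h *v \<theta>) ** u = h ** ?r \<theta>"
        unfolding u_def by (rule orthogonal_cancel(5)[OF orh])
      have um: "(\<lambda>\<gamma>. u ** \<gamma>) \<in> measurable M' ?R'"
        by (subst measurable_cong_sets[OF setsM' refl], rule fix_group_left_mult[OF u])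
      have sm: "{\<gamma>\<in>space M'. ?r (h *v \<theta>) ** \<gamma> \<in> A} \<in> sets M'"
      proof -
        have "(\<lambda>\<gamma>. ?r (h *v \<theta>) ** \<gamma>) \<in> measurable M' ?R"
        proof (rule measurable_restrict_space2)
          show "(\<lambda>\<gamma>. ?r (h *v \<theta>) ** \<gamma>) \<in> space M' \<rightarrow> fix_group J"
            using rh\<theta> by (auto simp: spM' intro!: fix_group_mult[of _ J] dest: subsetD[OF sub])
        qed measurable
        from measurable_sets[OF this A] show ?thesis
          by (simp add: vimage_def Int_def conj_commute)
      qed
      have "emeasure M' {\<gamma>\<in>space M'. ?r (h *v \<theta>) ** \<gamma> \<in> A}
        = emeasure (distr M' ?R' (\<lambda>\<gamma>. u ** \<gamma>)) {\<gamma>\<in>space M'. ?r (h *v \<theta>) ** \<gamma> \<in> A}"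
        using M' u by (simp add: haar_def)
      also have "\<dots> = emeasure M' ((\<lambda>\<gamma>. u ** \<gamma>) -` {\<gamma>\<in>space M'. ?r (h *v \<theta>) ** \<gamma> \<in> A} \<inter> space M')"
        using um sm by (subst emeasure_distr) (auto simp: setsM')
      also have "(\<lambda>\<gamma>. u ** \<gamma>) -` {\<gamma>\<in>space M'. ?r (h *v \<theta>) ** \<gamma> \<in> A} \<inter> space M'
        = {\<gamma>\<in>space M'. ?r \<theta> ** \<gamma> \<in> (\<lambda>g. h ** g) -` A \<inter> fix_group J}"
        using fix_group_mult[OF u] fix_group_mult[OF r\<theta>] sub
        by (auto simp: spM' matrix_mul_assoc ru)
      finally show ?thesis ..
    qed
    have "emeasure (distr M ?R (\<lambda>g. h ** g)) A = emeasure M ((\<lambda>g. h ** g) -` A \<inter> fix_group J)"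
      using lm A by (subst emeasure_distr) (simp_all add: M_def space_fix_group)
    also have "\<dots> = (\<integral>\<^sup>+\<theta>. emeasure M' {\<gamma>\<in>space M'. ?r \<theta> ** \<gamma> \<in> (\<lambda>g. h ** g) -` A \<inter> fix_group J} \<partial>?S)"
      using measurable_sets[OF lm A] by (intro M_eq) (simp add: space_fix_group)
    also have "\<dots> = (\<integral>\<^sup>+\<theta>. emeasure M' {\<gamma>\<in>space M'. ?r (h *v \<theta>) ** \<gamma> \<in> A} \<partial>?S)"
      by (intro nn_integral_cong inv)
    also have "\<dots> = (\<integral>\<^sup>+\<theta>. emeasure M' {\<gamma>\<in>space M'. ?r \<theta> ** \<gamma> \<in> A}
        \<partial>distr ?S (restrict_space borel (sphere 0 1 \<inter> ?W)) (\<lambda>x. h *v x))"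
    proof (rule nn_integral_distr[symmetric])
      have hg: "h \<in> section_group ?W" using h fix_group_section_group by auto
      show "(\<lambda>x. h *v x) \<in> measurable ?S (restrict_space borel (sphere 0 1 \<inter> ?W))"
        by (subst measurable_cong_sets[OF S(3) refl], rule section_action[OF W hg])
      have "sets (distr ?S (restrict_space borel (sphere 0 1 \<inter> ?W)) (\<lambda>x. h *v x)) = sets ?S"
        by (simp add: S(3))
      then show "(\<lambda>\<theta>. emeasure M' {\<gamma>\<in>space M'. ?r \<theta> ** \<gamma> \<in> A})
          \<in> borel_measurable (distr ?S (restrict_space borel (sphere 0 1 \<inter> ?W)) (\<lambda>x. h *v x))"
        using phi[OF A] by (rule measurable_cong_sets[OF _ refl, THEN equalityD2, THEN subsetD])
    qed
    also have "\<dots> = emeasure M A"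
      using section_measure_eq_const_mixture(2)[OF n W dW] h fix_group_section_group[of J] M_eq[OF A]
      by auto
    finally show "emeasure (distr M ?R (\<lambda>g. h ** g)) A = emeasure M A" .
  qed
  moreover have "prob_space M" unfolding M_def by (intro P.prob_space_distr m)
  ultimately show "haar J (distr (?S \<Otimes>\<^sub>M M') ?R ?m)"
    unfolding haar_def M_def[symmetric] by (simp add: M_def)
qed

lemma haar_exists:
  fixes J :: "'n::finite set"
  shows "\<exists>M :: (real ^ 'n ^ 'n) measure. haar J M"
proof (induction "card (- J)" arbitrary: J rule: less_induct)
  case less
  show ?case
  proof (cases "card (- J) \<le> 1")
    case True
    let ?R = "restrict_space borel (fix_group J)"
    have 1: "fix_group J = {mat 1 :: real ^ 'n ^ 'n}" using True by (rule fix_group_trivial)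
    have "haar J (return ?R (mat 1))"
      unfolding haar_def
    proof (intro conjI ballI)
      show "prob_space (return ?R (mat 1))"
        by (intro prob_space_return) (simp add: space_fix_group mat_1_fix_group)
      fix h assume h: "h \<in> fix_group J"
      then have "distr (return ?R (mat 1)) ?R (\<lambda>g. h ** g) = return ?R (h ** mat 1)"
        using fix_group_left_mult[OF h] by (intro distr_return) (auto simp: space_fix_group mat_1_fix_group)
      then show "distr (return ?R (mat 1)) ?R (\<lambda>g. h ** g) = return ?R (mat 1)"
        using h 1 by simp
    qed simp
    then show ?thesis ..
  next
    case False
    then obtain k l where kl: "k \<in> - J" "l \<in> - J" "k \<noteq> l"
      using card_le_Suc0_iff_eq[of "- J"] by auto
    have "card (- insert k J) < card (- J)"
      using kl by (intro psubset_card_mono) auto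
    then obtain M' :: "(real ^ 'n ^ 'n) measure" where "haar (insert k J) M'" using less by blast
    then show ?thesis using haar_step(2)[of k J M' l] kl by blast
  qed
qed

lemma fix_group_transitive:
  assumes "x \<in> fix_group J" "y \<in> fix_group J"
  shows "\<exists>h\<in>fix_group J. h ** x = y"
proof
  have "transpose x ** x = mat 1" using assms by (simp add: fix_group_def rotation_orthogonal orthogonal_cancel)
  then show "(y ** transpose x) ** x = y" by (simp flip: matrix_mul_assoc)
  show "y ** transpose x \<in> fix_group J" using assms by (intro fix_group_mult fix_group_transpose)
qed

lemma haar_prob_fix_group:
  fixes J :: "'n::finite set"
  shows "haar J (haar_prob (fix_group J))"
proof -
  obtain M :: "(real ^ 'n ^ 'n) measure" where M: "haar J M" using haar_exists by blast
  let ?R = "restrict_space borel (fix_group J)"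
  have "haar_prob (fix_group J) = M"
    unfolding haar_prob_def
  proof (rule invariant_prob_eqI[where e="\<lambda>x. x" and Y="fix_group J"])
    show "sets ?R = sets (vimage_algebra (fix_group J) (\<lambda>x. x) borel)"
      by (rule restrict_space_eq_vimage_algebra) simp
    show "dist (T x) (T y) = dist x y" if "T \<in> {(**) g |g. g \<in> fix_group J}" for T and x y :: "real ^ 'n ^ 'n"
      using that by (auto simp: fix_group_def dist_orthogonal_times rotation_orthogonal)
    show "\<exists>T\<in>{(**) g |g. g \<in> fix_group J}. T x = y" if "x \<in> fix_group J" "y \<in> fix_group J" for x y
      using fix_group_transitive[OF that] by blast
  qed (use M fix_group_left_mult[of _ J] in \<open>auto simp: haar_def\<close>)
  with M show ?thesis by simp
qed

section \<open>The invariant measure on the Grassmannian\<close>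

definition grassmann_space :: "nat \<Rightarrow> (real ^ 'n) set measure" where
  "grassmann_space k = sigma (grassmannian k) {U. openin (grassmann_topology k) U}"

text \<open>
  The Borel sets of the Grassmannian are the preimages of Borel sets of matrices under \<open>projection\<close>,
  so measurability of a subspace-valued map can be checked on the projection matrices.
\<close>

lemma sets_grassmann_space:
  "sets (grassmann_space k) = sets (vimage_algebra (grassmannian k) projection borel)"
proof -
  have "vimage_algebra (grassmannian k) projection (sigma UNIV {S. open S})
    = sigma (grassmannian k) {projection -` A \<inter> grassmannian k |A. A \<in> {S :: (real ^ 'n ^ 'n) set. open S}}"
    by (rule vimage_algebra_sigma) auto
  also have "{projection -` A \<inter> grassmannian k |A. A \<in> {S :: (real ^ 'n ^ 'n) set. open S}}
    = {U. openin (grassmann_topology k) U}"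
    by (auto simp: grassmann_topology_def openin_pullback_topology)
  finally show ?thesis
    unfolding grassmann_space_def borel_def by (rule arg_cong[where f=sets, OF sym])
qed

lemma space_grassmann_space [simp]: "space (grassmann_space k) = grassmannian k"
  using sets_eq_imp_space_eq[OF sets_grassmann_space] by simp

lemma projection_measurable: "projection \<in> borel_measurable (grassmann_space k)"
  by (subst measurable_cong_sets[OF sets_grassmann_space refl], rule measurable_vimage_algebra1) auto

lemma measurable_grassmann_spaceI:
  assumes "\<And>x. x \<in> space M \<Longrightarrow> \<Xi> x \<in> grassmannian k" "(\<lambda>x. projection (\<Xi> x)) \<in> borel_measurable M"
  shows "\<Xi> \<in> measurable M (grassmann_space k)"
  by (subst measurable_cong_sets[OF refl sets_grassmann_space], rule measurable_vimage_algebra2) (use assms in auto)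

lemma grassmannian_image:
  fixes g :: "real ^ 'n ^ 'n"
  assumes "rotation_matrix g" "\<xi> \<in> grassmannian k"
  shows "(\<lambda>x. g *v x) ` \<xi> \<in> grassmannian k"
  using assms by (simp add: grassmannian_def subspace_matrix_image dim_orthogonal_image rotation_orthogonal)

lemma grassmann_action_measurable:
  fixes g :: "real ^ 'n ^ 'n"
  assumes g: "rotation_matrix g"
  shows "(\<lambda>\<xi>. (\<lambda>x. g *v x) ` \<xi>) \<in> measurable (grassmann_space k) (grassmann_space k)"
proof (rule measurable_grassmann_spaceI)
  have "(\<lambda>\<xi>. g ** projection \<xi> ** transpose g) \<in> borel_measurable (grassmann_space k)"
    using projection_measurable by measurable
  then show "(\<lambda>\<xi>. projection ((\<lambda>x. g *v x) ` \<xi>)) \<in> borel_measurable (grassmann_space k)"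
    by (rule measurable_cong[THEN iffD1, rotated])
      (simp add: projection_image rotation_orthogonal[OF g] grassmannian_def)
qed (use g grassmannian_image in auto)

lemma grassmann_action_isometric:
  fixes g :: "real ^ 'n ^ 'n"
  assumes "rotation_matrix g" "\<xi> \<in> grassmannian k" "\<eta> \<in> grassmannian k"
  shows "dist (projection ((\<lambda>x. g *v x) ` \<xi>)) (projection ((\<lambda>x. g *v x) ` \<eta>)) = dist (projection \<xi>) (projection \<eta>)"
  using assms by (simp add: grassmannian_def projection_image rotation_orthogonal dist_orthogonal_conj)

lemma grassmann_measure_eqI:
  fixes M :: "(real ^ 'n) set measure"
  assumes k: "0 < k" and "prob_space M" "sets M = sets (grassmann_space k)"
    and inv: "\<And>g. rotation_matrix g \<Longrightarrow> distr M (grassmann_space k) (\<lambda>\<xi>. (\<lambda>x. g *v x) ` \<xi>) = M"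
  shows "grassmann_measure k = M"
  unfolding grassmann_measure_def grassmann_space_def[symmetric]
proof (rule invariant_prob_eqI[where e=projection and Y="grassmannian k"])
  show "\<exists>T\<in>{(`) ((*v) g) |g. rotation_matrix g}. T \<xi> = \<eta>"
    if "\<xi> \<in> grassmannian k" "\<eta> \<in> grassmannian k" for \<xi> \<eta> :: "(real ^ 'n) set"
    using rotation_transitive_on_subspaces[of \<xi> \<eta>] that k by (auto simp: grassmannian_def) metis
qed (use assms sets_grassmann_space grassmann_action_measurable grassmann_action_isometric in auto)

lemma orbit_measurable:
  fixes \<xi> :: "(real ^ 'n) set"
  assumes \<xi>: "\<xi> \<in> grassmannian k"
    and A: "A \<in> borel_measurable M" "\<And>x. x \<in> space M \<Longrightarrow> rotation_matrix (A x)"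
  shows "(\<lambda>x. (\<lambda>y. A x *v y) ` \<xi>) \<in> measurable M (grassmann_space k)"
proof (rule measurable_grassmann_spaceI)
  have "(\<lambda>x. A x ** projection \<xi> ** transpose (A x)) \<in> borel_measurable M"
    using A by measurable
  then show "(\<lambda>x. projection ((\<lambda>y. A x *v y) ` \<xi>)) \<in> borel_measurable M"
    by (rule measurable_cong[THEN iffD1, rotated])
      (use A(2) \<xi> in \<open>simp add: projection_image rotation_orthogonal grassmannian_def\<close>)
qed (use A \<xi> grassmannian_image in auto)

text \<open>
  The image of Haar measure under an orbit map is invariant, so it is the invariant measure.
\<close>

lemma grassmann_measure_haar:
  fixes \<xi> :: "(real ^ 'n) set" and M :: "(real ^ 'n ^ 'n) measure" and g :: "real ^ 'n ^ 'n"
  assumes k: "0 < k" and \<xi>: "\<xi> \<in> grassmannian k" and M: "haar {} M"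
  shows "grassmann_measure k = distr M (grassmann_space k) (\<lambda>g. (\<lambda>x. g *v x) ` \<xi>)"
    and "rotation_matrix g \<Longrightarrow>
      distr (grassmann_measure k) (grassmann_space k) (\<lambda>\<xi>. (\<lambda>x. g *v x) ` \<xi>) = grassmann_measure k"
    and "prob_space (grassmann_measure k :: (real ^ 'n) set measure)"
    and "sets (grassmann_measure k :: (real ^ 'n) set measure) = sets (grassmann_space k)"
proof -
  let ?R = "restrict_space borel (fix_group {}) :: (real ^ 'n ^ 'n) measure"
  let ?N = "grassmann_space k :: (real ^ 'n) set measure"
  let ?o = "\<lambda>g. (\<lambda>x. g *v x) ` \<xi>"
  have M: "prob_space M" "sets M = sets ?R" "\<And>h. rotation_matrix h \<Longrightarrow> distr M ?R (\<lambda>g. h ** g) = M"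
    using M by (auto simp: haar_def fix_group_def)
  have oR: "?o \<in> measurable ?R ?N"
    by (rule orbit_measurable[OF \<xi> measurable_restrict_space1]) (auto simp: space_restrict_space fix_group_def)
  have oM: "?o \<in> measurable M ?N"
    by (subst measurable_cong_sets[OF M(2) refl], rule oR)
  have inv: "distr (distr M ?N ?o) ?N (\<lambda>\<xi>. (\<lambda>x. h *v x) ` \<xi>) = distr M ?N ?o" if h: "rotation_matrix h" for h
  proof -
    have hM: "(\<lambda>g. h ** g) \<in> measurable M ?R"
      by (subst measurable_cong_sets[OF M(2) refl], rule fix_group_left_mult) (simp add: fix_group_def h)
    have "distr (distr M ?N ?o) ?N (\<lambda>\<xi>. (\<lambda>x. h *v x) ` \<xi>) = distr M ?N (\<lambda>g. ?o (h ** g))"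
      using oM grassmann_action_measurable[OF h] by (subst distr_distr) (auto simp: o_def image_matrix_mul)
    also have "\<dots> = distr (distr M ?R (\<lambda>g. h ** g)) ?N ?o"
      using oR hM by (subst distr_distr) (auto simp: o_def)
    finally show ?thesis using M(3)[OF h] by simp
  qed
  show eq: "grassmann_measure k = distr M ?N ?o"
    using k by (rule grassmann_measure_eqI) (auto simp: inv prob_space.prob_space_distr[OF M(1) oM])
  show "distr (grassmann_measure k) ?N (\<lambda>\<xi>. (\<lambda>x. g *v x) ` \<xi>) = grassmann_measure k" if "rotation_matrix g"
    unfolding eq using that by (rule inv)
  show "prob_space (grassmann_measure k :: (real ^ 'n) set measure)"
    unfolding eq by (rule prob_space.prob_space_distr[OF M(1) oM])
  show "sets (grassmann_measure k :: (real ^ 'n) set measure) = sets ?N" unfolding eq by simp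
qed

lemma grassmannian_nonempty: "k \<le> CARD('n) \<Longrightarrow> \<exists>\<xi> :: (real ^ 'n) set. \<xi> \<in> grassmannian k"
  using choose_subspace_of_subspace[of k "UNIV :: (real ^ 'n) set"] by (auto simp: grassmannian_def)

lemma grassmann_measure:
  assumes "0 < k" "k \<le> CARD('n)"
  shows "prob_space (grassmann_measure k :: (real ^ 'n) set measure)"
    and "sets (grassmann_measure k :: (real ^ 'n) set measure) = sets (grassmann_space k)"
    and "rotation_matrix g \<Longrightarrow> distr (grassmann_measure k) (grassmann_space k) (\<lambda>\<xi>. (\<lambda>x. g *v x) ` \<xi>)
      = (grassmann_measure k :: (real ^ 'n) set measure)"
  using grassmannian_nonempty[OF assms(2)] haar_exists[of "{} :: 'n set"] grassmann_measure_haar[OF assms(1)] by blast+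

section \<open>Bounded extensions to integrable functions\<close>

lemma L1_bounded_operatorD:
  fixes T :: "('a \<Rightarrow> 'c) \<Rightarrow> 'b \<Rightarrow> 'c::{real_normed_field, banach, second_countable_topology}"
  assumes "L1_bounded_operator \<mu> \<nu> T"
  shows "integrable \<mu> f \<Longrightarrow> integrable \<nu> (T f)"
    and "integrable \<mu> f \<Longrightarrow> integrable \<mu> g \<Longrightarrow> AE y in \<nu>. T (\<lambda>x. a * f x + b * g x) y = a * T f y + b * T g y"
  using assms unfolding L1_bounded_operator_def by blast+

lemma L1_bounded_operator_bound:
  fixes T :: "('a \<Rightarrow> 'c) \<Rightarrow> 'b \<Rightarrow> 'c::{real_normed_field, banach, second_countable_topology}"
  assumes "L1_bounded_operator \<mu> \<nu> T"
  obtains C where "0 \<le> C"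
    "\<And>f g. integrable \<mu> f \<Longrightarrow> integrable \<mu> g \<Longrightarrow>
      (\<integral>y. norm (T f y - T g y) \<partial>\<nu>) \<le> C * (\<integral>x. norm (f x - g x) \<partial>\<mu>)"
proof -
  from assms obtain C where C: "\<And>f. integrable \<mu> f \<Longrightarrow> (\<integral>y. norm (T f y) \<partial>\<nu>) \<le> C * (\<integral>x. norm (f x) \<partial>\<mu>)"
    unfolding L1_bounded_operator_def by blast
  note T = L1_bounded_operatorD[OF assms]
  show thesis
  proof
    fix f g :: "'a \<Rightarrow> 'c" assume f: "integrable \<mu> f" and g: "integrable \<mu> g"
    have fg: "integrable \<mu> (\<lambda>x. 1 * f x + (-1) * g x)"
      using f g by (intro Bochner_Integration.integrable_add integrable_mult_right)
    have "(\<integral>y. norm (T f y - T g y) \<partial>\<nu>) = (\<integral>y. norm (T (\<lambda>x. 1 * f x + (-1) * g x) y) \<partial>\<nu>)"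
    proof (rule integral_cong_AE)
      show "AE y in \<nu>. norm (T f y - T g y) = norm (T (\<lambda>x. 1 * f x + (-1) * g x) y)"
        using T(2)[OF f g, of 1 "-1"] by eventually_elim simp
      show "(\<lambda>y. norm (T f y - T g y)) \<in> borel_measurable \<nu>"
        "(\<lambda>y. norm (T (\<lambda>x. 1 * f x + (-1) * g x) y)) \<in> borel_measurable \<nu>"
        using T(1)[OF f] T(1)[OF g] T(1)[OF fg] by measurable
    qed
    also have "\<dots> \<le> C * (\<integral>x. norm (1 * f x + (-1) * g x) \<partial>\<mu>)"
      by (rule C[OF fg])
    also have "\<dots> \<le> max C 0 * (\<integral>x. norm (1 * f x + (-1) * g x) \<partial>\<mu>)"
      by (intro mult_right_mono) auto
    finally show "(\<integral>y. norm (T f y - T g y) \<partial>\<nu>) \<le> max C 0 * (\<integral>x. norm (f x - g x) \<partial>\<mu>)"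
      by simp
  qed simp
qed

lemma AE_eq_if_integral_norm_eq_0:
  fixes f g :: "'a \<Rightarrow> 'c::{banach, second_countable_topology}"
  assumes "integrable M f" "integrable M g" "(\<integral>x. norm (f x - g x) \<partial>M) = 0"
  shows "AE x in M. f x = g x"
proof -
  have "integrable M (\<lambda>x. norm (f x - g x))" using assms by simp
  then have "AE x in M. norm (f x - g x) = 0"
    using assms(3) by (subst (asm) integral_nonneg_eq_0_iff_AE) auto
  then show ?thesis by eventually_elim simp
qed

lemma L1_bounded_operator_AE_cong:
  fixes T :: "('a \<Rightarrow> 'c) \<Rightarrow> 'b \<Rightarrow> 'c::{real_normed_field, banach, second_countable_topology}"
  assumes T: "L1_bounded_operator \<mu> \<nu> T" and "integrable \<mu> f" "integrable \<mu> g" "AE x in \<mu>. f x = g x"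
  shows "AE y in \<nu>. T f y = T g y"
proof (rule AE_eq_if_integral_norm_eq_0)
  obtain C where C: "0 \<le> C" "(\<integral>y. norm (T f y - T g y) \<partial>\<nu>) \<le> C * (\<integral>x. norm (f x - g x) \<partial>\<mu>)"
    using L1_bounded_operator_bound[OF T] assms by metis
  have "(\<integral>x. norm (f x - g x) \<partial>\<mu>) = (\<integral>x. 0 \<partial>\<mu>)"
    using assms by (intro integral_cong_AE) auto
  then show "(\<integral>y. norm (T f y - T g y) \<partial>\<nu>) = 0"
    using C by (intro antisym) (auto intro: integral_nonneg_AE)
qed (use assms L1_bounded_operatorD(1)[OF T] in auto)

text \<open>
  Density of the continuous functions in \<open>L\<^sup>1\<close>, as an induction principle. Indicators of open sets are
  pointwise limits of bounded continuous functions; the sets whose indicators belong to the class form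
  a Dynkin system; general integrable functions are dominated limits of simple functions.
\<close>

lemma integrable_induct_continuous:
  fixes e :: "'a \<Rightarrow> 'e::metric_space" and E :: "('a \<Rightarrow> 'c::{real_normed_field, banach, second_countable_topology}) \<Rightarrow> bool"
  assumes "finite_measure \<mu>" and sets: "sets \<mu> = sets (vimage_algebra Y e borel)"
    and cont: "\<And>g. continuous_on UNIV g \<Longrightarrow> integrable \<mu> (\<lambda>x. g (e x)) \<Longrightarrow> E (\<lambda>x. g (e x))"
    and lin: "\<And>f g a b. integrable \<mu> f \<Longrightarrow> integrable \<mu> g \<Longrightarrow> E f \<Longrightarrow> E g \<Longrightarrow> E (\<lambda>x. a * f x + b * g x)"
    and lim: "\<And>f s. integrable \<mu> f \<Longrightarrow> (\<And>i. integrable \<mu> (s i)) \<Longrightarrow> (\<And>i::nat. E (s i)) \<Longrightarrow>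
      (\<lambda>i. \<integral>x. norm (s i x - f x) \<partial>\<mu>) \<longlonglongrightarrow> 0 \<Longrightarrow> E f"
    and f: "integrable \<mu> f"
  shows "E f"
proof -
  interpret finite_measure \<mu> by fact
  have Y: "space \<mu> = Y" using sets_eq_imp_space_eq[OF sets] by simp
  have e [measurable]: "e \<in> borel_measurable \<mu>"
    by (subst measurable_cong_sets[OF sets refl], rule measurable_vimage_algebra1) auto
  have dom: "E f" if s: "\<And>i. integrable \<mu> (s i)" "\<And>i::nat. E (s i)"
    and f: "integrable \<mu> f" and pw: "\<And>x. x \<in> Y \<Longrightarrow> (\<lambda>i. s i x) \<longlonglongrightarrow> f x"
    and w: "integrable \<mu> w" "\<And>i x. x \<in> Y \<Longrightarrow> norm (s i x) \<le> w x" for f s and w :: "'a \<Rightarrow> real"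
  proof (rule lim[OF f s])
    have "(\<lambda>i. \<integral>x. norm (s i x - f x) \<partial>\<mu>) \<longlonglongrightarrow> (\<integral>x. 0 \<partial>\<mu>)"
    proof (rule integral_dominated_convergence[where w="\<lambda>x. w x + norm (f x)"])
      show "AE x in \<mu>. (\<lambda>i. norm (s i x - f x)) \<longlonglongrightarrow> 0"
      proof (rule AE_I2)
        fix x assume "x \<in> space \<mu>"
        then have "(\<lambda>i. s i x - f x) \<longlonglongrightarrow> f x - f x" using pw Y by (intro tendsto_diff) auto
        then show "(\<lambda>i. norm (s i x - f x)) \<longlonglongrightarrow> 0"
          by (simp add: tendsto_norm_zero)
      qed
      show "AE x in \<mu>. norm (norm (s i x - f x)) \<le> w x + norm (f x)" for i
      proof (rule AE_I2)
        fix x assume "x \<in> space \<mu>"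
        then show "norm (norm (s i x - f x)) \<le> w x + norm (f x)"
          using norm_triangle_ineq4[of "s i x" "f x"] w(2)[of x i] Y by simp
      qed
    qed (use f s w in auto)
    then show "(\<lambda>i. \<integral>x. norm (s i x - f x) \<partial>\<mu>) \<longlonglongrightarrow> 0" by simp
  qed
  have cong: "E g" if "integrable \<mu> f" "E f" "integrable \<mu> g" "\<And>x. x \<in> Y \<Longrightarrow> f x = g x" for f g
    using that by (intro dom[of "\<lambda>_. f" g "\<lambda>x. norm (f x)"]) auto
  define I :: "'a set \<Rightarrow> 'a \<Rightarrow> 'c" where "I A x = of_real (indicator A x)" for A x
  have I_int: "integrable \<mu> (I A)" if "A \<in> sets \<mu>" for A
    unfolding I_def[abs_def] using that emeasure_finite
    by (intro integrable_of_real) (simp add: integrable_indicator_iff less_top[symmetric] Int_absorb2 sets.sets_into_space)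
  have E1: "E (\<lambda>x. 1)"
    by (rule cont) auto
  have gen: "sets \<mu> = sigma_sets Y {e -` U \<inter> Y |U. open U}"
  proof -
    have "vimage_algebra Y e (sigma UNIV {S. open S}) = sigma Y {e -` A \<inter> Y |A. A \<in> {S. open S}}"
      by (rule vimage_algebra_sigma) auto
    then have "sets (vimage_algebra Y e borel) = sets (sigma Y {e -` U \<inter> Y |U. open U})"
      unfolding borel_def by simp
    also have "\<dots> = sigma_sets Y {e -` U \<inter> Y |U. open U}"
      by (intro sets_measure_of) auto
    finally show ?thesis using sets by simp
  qed
  have E_I: "E (I A)" if "A \<in> sets \<mu>" for A
  proof -
    have "Int_stable {e -` U \<inter> Y |U. open U}"
    proof (rule Int_stableI)
      fix A B assume "A \<in> {e -` U \<inter> Y |U. open U}" "B \<in> {e -` U \<inter> Y |U. open U}"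
      then obtain U V where "open U" "open V" "A = e -` U \<inter> Y" "B = e -` V \<inter> Y" by auto
      then show "A \<inter> B \<in> {e -` U \<inter> Y |U. open U}"
        by (intro CollectI exI[of _ "U \<inter> V"]) auto
    qed
    moreover have "{e -` U \<inter> Y |U. open U} \<subseteq> Pow Y" by auto
    moreover have "A \<in> sigma_sets Y {e -` U \<inter> Y |U. open U}" using that gen by simp
    ultimately show ?thesis
    proof (induction rule: sigma_sets_induct_disjoint)
      case (basic A)
      then obtain U where U: "open U" "A = e -` U \<inter> Y" by auto
      \<comment> \<open>The convention \<open>infdist z {} = 0\<close> requires a separate clause for the whole space.\<close>
      define g :: "nat \<Rightarrow> 'e \<Rightarrow> 'c" where
        "g i z = of_real (if U = UNIV then 1 else min 1 (real i * infdist z (- U)))" for i z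
      have g_cont: "continuous_on UNIV (g i)" for i
        unfolding g_def by (cases "U = UNIV") (auto intro!: continuous_intros)
      have g_bound: "norm (g i z) \<le> 1" for i z
        by (auto simp: g_def infdist_nonneg)
      have [measurable]: "g i \<in> borel_measurable borel" for i
        using g_cont by (intro borel_measurable_continuous_onI)
      have g_int: "integrable \<mu> (\<lambda>x. g i (e x))" for i
        by (rule integrable_const_bound[of _ 1]) (auto simp: g_bound)
      have g_lim: "(\<lambda>i. g i z) \<longlonglongrightarrow> of_real (indicator U z)" for z
      proof (cases "z \<in> U \<and> U \<noteq> UNIV")
        case True
        then have "infdist z (- U) > 0"
          using U(1) infdist_pos_not_in_closed[of "- U" z] by auto
        then obtain N :: nat where N: "1 < real N * infdist z (- U)"
          using reals_Archimedean3 by blast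
        have "g i z = of_real (indicator U z)" if "i \<ge> N" for i
        proof -
          have "real N * infdist z (- U) \<le> real i * infdist z (- U)"
            using that by (intro mult_right_mono) (auto simp: infdist_nonneg)
          then show ?thesis using N True by (simp add: g_def)
        qed
        then show ?thesis
          by (intro tendsto_eventually eventually_sequentiallyI[of N])
      next
        case False
        then have "g i z = of_real (indicator U z)" for i
          by (cases "z \<in> U") (auto simp: g_def)
        then show ?thesis by simp
      qed
      show ?case
      proof (rule dom[where s="\<lambda>i x. g i (e x)" and w="\<lambda>_. 1"])
        show "integrable \<mu> (I A)"
          using basic gen by (intro I_int) (auto intro: sigma_sets.Basic)
        show "(\<lambda>i. g i (e x)) \<longlonglongrightarrow> I A x" if "x \<in> Y" for x
          using g_lim[of "e x"] that by (simp add: I_def U indicator_def)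
      qed (use g_cont g_int g_bound cont in auto)
    next
      case empty
      have "E (\<lambda>x. 0 * 1 + 0 * 1)" by (rule lin) (auto simp: E1)
      then show ?case by (simp add: I_def[abs_def])
    next
      case (compl A)
      then have A: "A \<in> sets \<mu>" using gen by simp
      have "integrable \<mu> (\<lambda>x. 1 * 1 + (-1) * I A x)"
        using I_int[OF A] by auto
      moreover have "E (\<lambda>x. 1 * 1 + (-1) * I A x)"
        by (rule lin) (auto simp: E1 I_int A compl)
      moreover have "integrable \<mu> (I (Y - A))"
        using A Y by (intro I_int) auto
      ultimately show ?case
        by (rule cong) (auto simp: I_def indicator_def)
    next
      case (union A)
      then have A: "A i \<in> sets \<mu>" for i using gen by auto
      define s where "s n x = (\<Sum>i<n. I (A i) x)" for n :: nat and x
      have s_int: "integrable \<mu> (s n)" for n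
        unfolding s_def by (intro Bochner_Integration.integrable_sum I_int A)
      have s_E: "E (s n)" for n
      proof (induction n)
        case 0
        have "E (\<lambda>x. 0 * 1 + 0 * 1)" by (rule lin) (auto simp: E1)
        then show ?case by (simp add: s_def[abs_def])
      next
        case (Suc n)
        have "E (\<lambda>x. 1 * s n x + 1 * I (A n) x)"
          using Suc union s_int I_int A by (intro lin) auto
        then show ?case by (simp add: s_def[abs_def])
      qed
      have s_eq: "s n x = of_real (indicator (\<Union>i<n. A i) x)" for n x
      proof -
        have "disjoint_family_on A {..<n}" using union(1) by (auto simp: disjoint_family_on_def)
        then show ?thesis
          by (simp add: s_def I_def indicator_UN_disjoint)
      qed
      have lim: "(\<lambda>n. s n x) \<longlonglongrightarrow> I (\<Union>i. A i) x" for x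
        unfolding s_eq I_def by (intro tendsto_of_real LIMSEQ_indicator_UN)
      show ?case
      proof (rule dom[where s=s and w="\<lambda>_. 1"])
        show "integrable \<mu> (I (\<Union>i. A i))" using A by (intro I_int) auto
        show "norm (s i x) \<le> 1" for i x by (simp add: s_eq indicator_def)
      qed (use s_int s_E lim in auto)
    qed
  qed
  from f show "E f"
  proof (induction rule: integrable_induct)
    case (base A c)
    have "E (\<lambda>x. c * I A x + 0 * I A x)"
      using base by (intro lin I_int E_I)
    moreover have "(\<lambda>x. c * I A x + 0 * I A x) = (\<lambda>x. indicator A x *\<^sub>R c)"
      by (auto simp: I_def indicator_def)
    ultimately show ?case by simp
  next
    case (add f g)
    then show ?case using lin[of f g 1 1] by simp
  next
    case (lim f s)
    then show ?case
      by (intro dom[of s f "\<lambda>x. 2 * norm (f x)"]) (auto simp: Y)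
  qed
qed

text \<open>
  The operator \<open>T\<close> itself witnesses that a bounded extension exists, and two bounded operators that
  agree on the continuous functions agree on all integrable functions.
\<close>

lemma L1_extension_eq_direct:
  fixes e :: "'a \<Rightarrow> 'e::metric_space"
    and T :: "('a \<Rightarrow> 'c) \<Rightarrow> 'b \<Rightarrow> 'c::{real_normed_field, banach, second_countable_topology}"
  assumes fin: "finite_measure \<mu>" and sets: "sets \<mu> = sets (vimage_algebra Y e borel)"
    and X: "X = pullback_topology Y e euclidean"
    and T: "L1_bounded_operator \<mu> \<nu> T"
  shows "L1_bounded_operator \<mu> \<nu> (L1_extension X \<mu> \<nu> T)"
    and "integrable \<mu> f \<Longrightarrow> AE y in \<nu>. L1_extension X \<mu> \<nu> T f y = T f y"
proof -
  let ?T = "L1_extension X \<mu> \<nu> T"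
  have "\<exists>T'. L1_bounded_operator \<mu> \<nu> T' \<and> (\<forall>f. continuous_map X euclidean f \<longrightarrow> (AE y in \<nu>. T' f y = T f y))"
    using T by auto
  from someI_ex[OF this] have T': "L1_bounded_operator \<mu> \<nu> ?T"
    and agree: "\<And>f. continuous_map X euclidean f \<Longrightarrow> AE y in \<nu>. ?T f y = T f y"
    unfolding L1_extension_def[symmetric] by blast+
  show "L1_bounded_operator \<mu> \<nu> ?T" by (rule T')
  show "AE y in \<nu>. ?T f y = T f y" if "integrable \<mu> f"
    using fin sets _ _ _ that
  proof (rule integrable_induct_continuous)
    fix g :: "'e \<Rightarrow> 'c" assume g: "continuous_on UNIV g"
    have "continuous_map X euclidean (g \<circ> e)"
      unfolding X using g by (intro continuous_map_pullback) simp
    then show "AE y in \<nu>. ?T (\<lambda>x. g (e x)) y = T (\<lambda>x. g (e x)) y"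
      using agree by (simp add: o_def)
  next
    fix f g :: "'a \<Rightarrow> 'c" and a b
    assume fg: "integrable \<mu> f" "integrable \<mu> g" and E: "AE y in \<nu>. ?T f y = T f y" "AE y in \<nu>. ?T g y = T g y"
    show "AE y in \<nu>. ?T (\<lambda>x. a * f x + b * g x) y = T (\<lambda>x. a * f x + b * g x) y"
      using E L1_bounded_operatorD(2)[OF T fg, of a b] L1_bounded_operatorD(2)[OF T' fg, of a b]
      by eventually_elim simp
  next
    fix f :: "'a \<Rightarrow> 'c" and s :: "nat \<Rightarrow> 'a \<Rightarrow> 'c"
    assume f: "integrable \<mu> f" and s: "\<And>i. integrable \<mu> (s i)" and E: "\<And>i. AE y in \<nu>. ?T (s i) y = T (s i) y"
      and lim: "(\<lambda>i. \<integral>x. norm (s i x - f x) \<partial>\<mu>) \<longlonglongrightarrow> 0"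
    obtain C where C: "\<And>i. (\<integral>y. norm (T (s i) y - T f y) \<partial>\<nu>) \<le> C * (\<integral>x. norm (s i x - f x) \<partial>\<mu>)"
      using L1_bounded_operator_bound[OF T] s f by metis
    obtain C' where C': "\<And>i. (\<integral>y. norm (?T (s i) y - ?T f y) \<partial>\<nu>) \<le> C' * (\<integral>x. norm (s i x - f x) \<partial>\<mu>)"
      using L1_bounded_operator_bound[OF T'] s f by metis
    note int = L1_bounded_operatorD(1)[OF T f] L1_bounded_operatorD(1)[OF T' f]
      L1_bounded_operatorD(1)[OF T s] L1_bounded_operatorD(1)[OF T' s]
    have le: "(\<integral>y. norm (?T f y - T f y) \<partial>\<nu>) \<le> (C + C') * (\<integral>x. norm (s i x - f x) \<partial>\<mu>)" for i
    proof -
      have "(\<integral>y. norm (?T f y - T f y) \<partial>\<nu>) \<le> (\<integral>y. norm (T (s i) y - T f y) + norm (?T (s i) y - ?T f y) \<partial>\<nu>)"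
      proof (rule integral_mono_AE)
        show "AE y in \<nu>. norm (?T f y - T f y) \<le> norm (T (s i) y - T f y) + norm (?T (s i) y - ?T f y)"
          using E[of i]
        proof eventually_elim
          case (elim y)
          have "norm (?T f y - T f y) = norm ((T (s i) y - T f y) - (?T (s i) y - ?T f y))"
            using elim by simp
          then show ?case using norm_triangle_ineq4 by metis
        qed
      qed (use int in auto)
      also have "\<dots> = (\<integral>y. norm (T (s i) y - T f y) \<partial>\<nu>) + (\<integral>y. norm (?T (s i) y - ?T f y) \<partial>\<nu>)"
        using int by (intro Bochner_Integration.integral_add) auto
      finally show ?thesis using C[of i] C'[of i] by (simp add: algebra_simps)
    qed
    have "(\<lambda>i. (C + C') * (\<integral>x. norm (s i x - f x) \<partial>\<mu>)) \<longlonglongrightarrow> (C + C') * 0"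
      by (intro tendsto_mult_left lim)
    then have "(\<integral>y. norm (?T f y - T f y) \<partial>\<nu>) \<le> 0"
      using le by (intro LIMSEQ_le_const) auto
    then have "(\<integral>y. norm (?T f y - T f y) \<partial>\<nu>) = 0"
      by (intro antisym) (auto intro: integral_nonneg_AE)
    with int show "AE y in \<nu>. ?T f y = T f y"
      by (intro AE_eq_if_integral_norm_eq_0)
  qed
qed

section \<open>The Radon transform and its dual on integrable functions\<close>

lemma sphere_measure:
  assumes n: "CARD('n) \<ge> 2"
  shows "prob_space (sphere_measure :: (real ^ 'n) measure)"
    and "sets (sphere_measure :: (real ^ 'n) measure) = sets (restrict_space borel (sphere 0 1))"
    and "space (sphere_measure :: (real ^ 'n) measure) = sphere 0 1"
proof -
  have d: "0 < dim (UNIV :: (real ^ 'n) set)" by simp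
  note S = section_measure_projection[OF n subspace_UNIV d]
  show "prob_space (sphere_measure :: (real ^ 'n) measure)"
    using S(2) by (simp add: sphere_measure_def)
  show *: "sets (sphere_measure :: (real ^ 'n) measure) = sets (restrict_space borel (sphere 0 1))"
    using S(3) by (simp add: sphere_measure_def)
  show "space (sphere_measure :: (real ^ 'n) measure) = sphere 0 1"
    using sets_eq_imp_space_eq[OF *] by (simp add: space_restrict_space)
qed

lemma sphere_measure_invariant:
  fixes g :: "real ^ 'n ^ 'n"
  assumes n: "CARD('n) \<ge> 2" and g: "rotation_matrix g"
  shows "distr sphere_measure sphere_measure (\<lambda>x. g *v x) = sphere_measure"
proof -
  have "(\<lambda>x. g *v x) ` UNIV = UNIV"
    using orthogonal_cancel(3)[OF rotation_orthogonal[OF g]] by (metis surj_def)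
  then have "g \<in> section_group UNIV" using g by (simp add: section_group_def)
  from section_measure_eq_const_mixture(2)[OF n subspace_UNIV _ this]
  have "distr sphere_measure (restrict_space borel (sphere 0 1)) (\<lambda>x. g *v x) = sphere_measure"
    by (simp add: sphere_measure_def)
  moreover have "distr sphere_measure (restrict_space borel (sphere 0 1)) (\<lambda>x. g *v x)
    = distr sphere_measure sphere_measure (\<lambda>x. g *v x)"
    by (intro distr_cong) (simp_all add: sphere_measure(2)[OF n])
  ultimately show ?thesis by simp
qed

lemma grassmann_family:
  assumes "0 < k" "k \<le> CARD('n)"
  shows "subspace_family (grassmann_measure k :: (real ^ 'n) set measure) (\<lambda>\<xi>. \<xi>) UNIV"
proof -
  note G = grassmann_measure[OF assms]
  have sp: "space (grassmann_measure k :: (real ^ 'n) set measure) = grassmannian k"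
    using sets_eq_imp_space_eq[OF G(2)] by simp
  show ?thesis
  proof (intro subspace_family.intro subspace_family_axioms.intro G(1))
    show "(\<lambda>\<xi> :: (real ^ 'n) set. projection \<xi>) \<in> borel_measurable (grassmann_measure k)"
      by (rule measurable_cong_sets[OF G(2) refl, THEN equalityD2, THEN subsetD, OF projection_measurable])
  qed (use sp assms in \<open>auto simp: grassmannian_def\<close>)
qed

text \<open>
  A random unit vector of a random \<open>k\<close>-dimensional subspace is uniform on the whole sphere.
\<close>

lemma grassmann_mixture:
  assumes n: "CARD('n) \<ge> 2" and k: "0 < k" "k \<le> CARD('n)"
  shows "mixture (grassmann_measure k) (\<lambda>\<xi>. \<xi>) UNIV = (sphere_measure :: (real ^ 'n) measure)"
proof -
  interpret subspace_family "grassmann_measure k :: (real ^ 'n) set measure" "\<lambda>\<xi>. \<xi>" UNIV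
    using k by (rule grassmann_family)
  note G = grassmann_measure[OF k]
  show ?thesis
    unfolding sphere_measure_def
  proof (rule mixture_eq_section_measure[OF n subset_refl])
    fix x y :: "real ^ 'n" assume "x \<in> sphere 0 1 \<inter> UNIV" "y \<in> sphere 0 1 \<inter> UNIV"
    then show "\<exists>g\<in>section_group UNIV. g *v x = y"
      using rotation_transitive_on_section[OF n subspace_UNIV, of x y] by (auto simp: section_group_def)
  next
    fix g :: "real ^ 'n ^ 'n" assume "g \<in> section_group UNIV"
    then have g: "rotation_matrix g" by (simp add: section_group_def)
    show "\<exists>t\<in>grassmann_measure k \<rightarrow>\<^sub>M grassmann_measure k. distr (grassmann_measure k) (grassmann_measure k) t = grassmann_measure k \<and>
      (\<forall>\<xi>\<in>space (grassmann_measure k). t \<xi> = (\<lambda>x. g *v x) ` \<xi>)"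
    proof (intro bexI[of _ "\<lambda>\<xi>. (\<lambda>x. g *v x) ` \<xi>"] conjI ballI refl)
      show "(\<lambda>\<xi>. (\<lambda>x. g *v x) ` \<xi>) \<in> grassmann_measure k \<rightarrow>\<^sub>M grassmann_measure k"
        by (subst measurable_cong_sets[OF G(2) G(2)], rule grassmann_action_measurable[OF g])
      have "distr (grassmann_measure k) (grassmann_measure k) (\<lambda>\<xi>. (\<lambda>x. g *v x) ` \<xi>)
        = distr (grassmann_measure k) (grassmann_space k) (\<lambda>\<xi>. (\<lambda>x. g *v x) ` \<xi>)"
        by (intro distr_cong) (simp_all add: G(2))
      then show "distr (grassmann_measure k) (grassmann_measure k) (\<lambda>\<xi>. (\<lambda>x. g *v x) ` \<xi>) = grassmann_measure k"
        using G(3)[OF g] by simp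
    qed
  qed
qed

lemma radon_integrable:
  fixes f :: "real ^ 'n \<Rightarrow> 'c::{real_normed_field, banach, second_countable_topology}"
  assumes n: "CARD('n) \<ge> 2" and k: "0 < k" "k \<le> CARD('n)" and f: "integrable sphere_measure f"
  shows "AE \<xi> in grassmann_measure k. integrable (section_measure \<xi>) f"
    and "integrable (grassmann_measure k) (radon f)"
    and "(\<integral>\<xi>. norm (radon f \<xi>) \<partial>grassmann_measure k) \<le> (\<integral>x. norm (f x) \<partial>sphere_measure)"
proof -
  interpret subspace_family "grassmann_measure k :: (real ^ 'n) set measure" "\<lambda>\<xi>. \<xi>" UNIV
    using k by (rule grassmann_family)
  note M = grassmann_mixture[OF n k]
  note * = mixture_fubini[unfolded M, OF n f]
  show "AE \<xi> in grassmann_measure k. integrable (section_measure \<xi>) f" by (rule *(1))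
  show "integrable (grassmann_measure k) (radon f)" by (rule *(2))
  show "(\<integral>\<xi>. norm (radon f \<xi>) \<partial>grassmann_measure k) \<le> (\<integral>x. norm (f x) \<partial>sphere_measure)" by (rule *(4))
qed

lemma radon_L1_bounded:
  assumes n: "CARD('n) \<ge> 2" and k: "0 < k" "k \<le> CARD('n)"
  shows "L1_bounded_operator (sphere_measure :: (real ^ 'n) measure) (grassmann_measure k)
    (radon :: (real ^ 'n \<Rightarrow> 'c::{real_normed_field, banach, second_countable_topology}) \<Rightarrow> _)"
  unfolding L1_bounded_operator_def
proof (intro conjI allI impI)
  note R = radon_integrable[OF n k]
  fix f g :: "real ^ 'n \<Rightarrow> 'c" and a b
  assume fg: "integrable sphere_measure f" "integrable sphere_measure g"
  show "AE \<xi> in grassmann_measure k. radon (\<lambda>x. a * f x + b * g x) \<xi> = a * radon f \<xi> + b * radon g \<xi>"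
    using R(1)[OF fg(1)] R(1)[OF fg(2)] by eventually_elim (simp add: radon_def)
next
  show "\<exists>C. \<forall>f :: real ^ 'n \<Rightarrow> 'c. integrable sphere_measure f \<longrightarrow>
      (\<integral>\<xi>. norm (radon f \<xi>) \<partial>grassmann_measure k) \<le> C * (\<integral>x. norm (f x) \<partial>sphere_measure)"
    by (intro exI[of _ 1] allI impI) (simp add: radon_integrable(3)[OF n k])
qed (rule radon_integrable(2)[OF n k])

lemma radon_L1:
  fixes f :: "real ^ 'n \<Rightarrow> 'c::{real_normed_field, banach, second_countable_topology}"
  assumes n: "CARD('n) \<ge> 2" and k: "0 < k" "k \<le> CARD('n)" and f: "integrable sphere_measure f"
  shows "integrable (grassmann_measure k) (radon_L1 k f)"
    and "AE \<xi> in grassmann_measure k. radon_L1 k f \<xi> = radon f \<xi>"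
proof -
  have X: "top_of_set (sphere 0 1) = pullback_topology (sphere 0 1) (\<lambda>x::real ^ 'n. x) euclidean"
    unfolding topology_eq openin_pullback_topology openin_subtopology by auto
  have sets: "sets (sphere_measure :: (real ^ 'n) measure) = sets (vimage_algebra (sphere 0 1) (\<lambda>x. x) borel)"
    unfolding sphere_measure(2)[OF n] by (rule restrict_space_eq_vimage_algebra) simp
  note E = L1_extension_eq_direct[OF prob_space.finite_measure[OF sphere_measure(1)[OF n]] sets X radon_L1_bounded[OF n k],
    folded radon_L1_def]
  show "integrable (grassmann_measure k) (radon_L1 k f)" by (rule L1_bounded_operatorD(1)[OF E(1) f])
  show "AE \<xi> in grassmann_measure k. radon_L1 k f \<xi> = radon f \<xi>" by (rule E(2)[OF f])
qed

lemma axis_stabilizer_eq: "axis_stabilizer = fix_group {Max UNIV}"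
  by (simp add: axis_stabilizer_def fix_group_def last_axis_def)

lemma rotation_to:
  fixes \<theta> :: "real ^ 'n::{finite, linorder}"
  assumes "CARD('n) \<ge> 2" "norm \<theta> = 1"
  shows "rotation_matrix (rotation_to \<theta>)" "rotation_to \<theta> *v last_axis = \<theta>"
proof -
  have "\<exists>r. rotation_matrix r \<and> r *v last_axis = \<theta>"
    using rotation_matrix_exists_basis[OF assms, of "Max UNIV"] unfolding last_axis_def by metis
  from someI_ex[OF this] show "rotation_matrix (rotation_to \<theta>)" "rotation_to \<theta> *v last_axis = \<theta>"
    unfolding rotation_to_def by blast+
qed

text \<open>
  Counting the larger indices numbers the indices from the top, bijectively by \<open>0, \<dots>, n - 1\<close>.
\<close>

lemma card_last_indices:
  assumes "i \<le> CARD('n::{finite, linorder})"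
  shows "card {j :: 'n. card {j<..} < i} = i"
proof -
  let ?r = "\<lambda>j :: 'n. card {j<..}"
  have inj: "inj ?r"
  proof (rule injI, rule ccontr)
    fix x y :: 'n assume eq: "?r x = ?r y" and "x \<noteq> y"
    have "?r b < ?r a" if "a < b" for a b :: 'n
      using that by (intro psubset_card_mono) auto
    then show False using eq \<open>x \<noteq> y\<close> by (metis less_irrefl linorder_neqE)
  qed
  have "?r j < CARD('n)" for j
    by (intro psubset_card_mono) auto
  then have "range ?r \<subseteq> {..<CARD('n)}" by auto
  then have range: "range ?r = {..<CARD('n)}"
    using inj by (intro card_subset_eq) (simp_all add: card_image)
  have "?r ` {j. ?r j < i} = {..<i}"
  proof
    show "{..<i} \<subseteq> ?r ` {j. ?r j < i}"
    proof
      fix m assume m: "m \<in> {..<i}"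
      then have "m \<in> range ?r" using range assms by auto
      then show "m \<in> ?r ` {j. ?r j < i}" using m by auto
    qed
  qed auto
  then show ?thesis
    using card_image[OF inj_on_subset[OF inj], of "{j. ?r j < i}"] by simp
qed

lemma last_plane:
  assumes "i \<le> CARD('n::{finite, linorder})"
  shows "(last_plane i :: (real ^ 'n::_) set) \<in> grassmannian i"
    and "0 < i \<Longrightarrow> last_axis \<in> (last_plane i :: (real ^ 'n::_) set)"
proof -
  let ?B = "{axis j 1 |j :: 'n. card {j<..} < i} :: (real ^ 'n::_) set"
  have B: "?B = (\<lambda>j. axis j 1) ` {j :: 'n. card {j<..} < i}" by auto
  have "card ?B = i"
    unfolding B by (subst card_image) (auto simp: inj_on_def axis_eq_axis card_last_indices assms)
  moreover have "independent ?B"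
    by (rule independent_mono[OF independent_Basis]) (auto simp: Basis_vec_def)
  ultimately show "(last_plane i :: (real ^ 'n::_) set) \<in> grassmannian i"
    by (simp add: grassmannian_def last_plane_def dim_eq_card_independent)
  have "{Max (UNIV :: 'n set)<..} = {}"
    by (auto simp: not_less)
  then have "card {Max (UNIV :: 'n set)<..} < i" if "0 < i" using that by simp
  then show "0 < i \<Longrightarrow> last_axis \<in> (last_plane i :: (real ^ 'n::_) set)"
    unfolding last_plane_def last_axis_def by (intro span_base) blast
qed

lemma haar_axis_stabilizer:
  "prob_space (haar_prob (axis_stabilizer :: (real ^ 'n::{finite, linorder} ^ 'n::_) set))"
  "sets (haar_prob (axis_stabilizer :: (real ^ 'n::_ ^ 'n::_) set)) = sets (restrict_space borel axis_stabilizer)"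
  "space (haar_prob (axis_stabilizer :: (real ^ 'n::_ ^ 'n::_) set)) = axis_stabilizer"
  "h \<in> axis_stabilizer \<Longrightarrow> (\<lambda>\<gamma>. h ** \<gamma>) \<in> measurable (haar_prob axis_stabilizer) (haar_prob (axis_stabilizer :: (real ^ 'n::_ ^ 'n::_) set))"
  "h \<in> axis_stabilizer \<Longrightarrow> distr (haar_prob axis_stabilizer) (haar_prob axis_stabilizer) (\<lambda>\<gamma>. h ** \<gamma>)
    = haar_prob (axis_stabilizer :: (real ^ 'n::_ ^ 'n::_) set)"
  "(\<lambda>\<gamma>. \<gamma>) \<in> borel_measurable (haar_prob (axis_stabilizer :: (real ^ 'n::_ ^ 'n::_) set))"
proof -
  let ?H = "haar_prob (axis_stabilizer :: (real ^ 'n::_ ^ 'n::_) set)" and ?R = "restrict_space borel (axis_stabilizer :: (real ^ 'n::_ ^ 'n::_) set)"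
  have H: "prob_space ?H" "sets ?H = sets ?R" "\<And>h. h \<in> axis_stabilizer \<Longrightarrow> distr ?H ?R (\<lambda>g. h ** g) = ?H"
    using haar_prob_fix_group[of "{Max UNIV} :: 'n set"] by (auto simp: haar_def axis_stabilizer_eq)
  show "prob_space ?H" "sets ?H = sets ?R" by fact+
  show "space ?H = axis_stabilizer"
    using sets_eq_imp_space_eq[OF H(2)] by (simp add: space_restrict_space)
  show "(\<lambda>\<gamma>. h ** \<gamma>) \<in> measurable ?H ?H" if "h \<in> axis_stabilizer"
    using fix_group_left_mult[of h "{Max UNIV}"] that
    by (subst measurable_cong_sets[OF H(2) H(2)]) (simp add: axis_stabilizer_eq)
  show "distr ?H ?H (\<lambda>\<gamma>. h ** \<gamma>) = ?H" if "h \<in> axis_stabilizer"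
    using H(3)[OF that] distr_cong[of ?H ?H ?R ?H "\<lambda>\<gamma>. h ** \<gamma>" "\<lambda>\<gamma>. h ** \<gamma>"] H(2) by simp
  show "(\<lambda>\<gamma>. \<gamma>) \<in> borel_measurable ?H"
    by (rule measurable_cong_sets[OF H(2) refl, THEN equalityD2, THEN subsetD])
      (intro measurable_restrict_space1 measurable_ident_sets refl)
qed

lemma sphere_measure_ident_measurable:
  assumes n: "CARD('n) \<ge> 2"
  shows "(\<lambda>x. x) \<in> borel_measurable (sphere_measure :: (real ^ 'n) measure)"
  by (rule measurable_cong_sets[OF sphere_measure(2)[OF n] refl, THEN equalityD2, THEN subsetD])
    (intro measurable_restrict_space1 measurable_ident_sets refl)

text \<open>
  Applying the construction of Haar measure to the empty set of axes writes a random rotation as a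
  measurable rotation taking the last axis to a random \<open>\<theta>\<close>, followed by a random element of the
  stabiliser. Its orbit map gives a random subspace in two stages.
\<close>

lemma dual_disintegration:
  fixes \<eta> :: "(real ^ 'n::{finite, linorder}) set" and l :: 'n
  assumes n: "CARD('n) \<ge> 2" and i: "0 < i" and \<eta>: "\<eta> \<in> grassmannian i" and l: "Max UNIV \<noteq> l"
  shows "(\<lambda>(\<theta>, \<gamma>). (\<lambda>x. (axis_rotation (Max UNIV) l \<theta> ** \<gamma>) *v x) ` \<eta>)
      \<in> measurable (sphere_measure \<Otimes>\<^sub>M haar_prob axis_stabilizer) (grassmann_space i)"
    and "grassmann_measure i = distr (sphere_measure \<Otimes>\<^sub>M haar_prob axis_stabilizer) (grassmann_space i)
      (\<lambda>(\<theta>, \<gamma>). (\<lambda>x. (axis_rotation (Max UNIV) l \<theta> ** \<gamma>) *v x) ` \<eta>)"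
proof -
  let ?k = "Max (UNIV :: 'n set)"
  let ?P = "sphere_measure \<Otimes>\<^sub>M haar_prob axis_stabilizer :: ((real ^ 'n::_) \<times> (real ^ 'n::_ ^ 'n::_)) measure"
  let ?R = "restrict_space borel (fix_group {}) :: (real ^ 'n::_ ^ 'n::_) measure"
  have H: "haar (insert ?k {}) (haar_prob (axis_stabilizer :: (real ^ 'n::_ ^ 'n::_) set))"
    using haar_prob_fix_group[of "{?k}"] by (simp add: axis_stabilizer_eq)
  have ac: "axes_comp ({} :: 'n set) = UNIV" by (auto simp: axes_comp_def orthogonal_comp_def)
  note hs = haar_step[OF H _ _ l, unfolded ac sphere_measure_def[symmetric], simplified]
  let ?m = "\<lambda>(\<theta>, \<gamma>). axis_rotation ?k l \<theta> ** \<gamma>"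
  have o: "(\<lambda>g. (\<lambda>x. g *v x) ` \<eta>) \<in> measurable ?R (grassmann_space i)"
    by (rule orbit_measurable[OF \<eta> measurable_restrict_space1]) (auto simp: space_restrict_space fix_group_def)
  have eq: "(\<lambda>(\<theta>, \<gamma>). (\<lambda>x. (axis_rotation ?k l \<theta> ** \<gamma>) *v x) ` \<eta>) = (\<lambda>g. (\<lambda>x. g *v x) ` \<eta>) \<circ> ?m"
    by auto
  show "(\<lambda>(\<theta>, \<gamma>). (\<lambda>x. (axis_rotation ?k l \<theta> ** \<gamma>) *v x) ` \<eta>) \<in> measurable ?P (grassmann_space i)"
    unfolding eq using hs(1) o by (rule measurable_comp)
  show "grassmann_measure i = distr ?P (grassmann_space i) (\<lambda>(\<theta>, \<gamma>). (\<lambda>x. (axis_rotation ?k l \<theta> ** \<gamma>) *v x) ` \<eta>)"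
    unfolding eq grassmann_measure_haar(1)[OF i \<eta> hs(2)] using o hs(1) by (rule distr_distr)
qed

text \<open>
  The function \<open>rotation_to\<close> is an arbitrary choice and need not be measurable in \<open>\<theta>\<close>. Any other
  rotation taking the last axis to \<open>\<theta>\<close> differs from it by an element of the stabiliser, which Haar
  measure absorbs, so a measurable choice gives the same value.
\<close>

lemma radon_dual_eq:
  fixes \<phi> :: "(real ^ 'n::{finite, linorder}) set \<Rightarrow> 'c::{real_normed_field, banach, second_countable_topology}"
  assumes n: "CARD('n) \<ge> 2" and i: "i \<le> CARD('n)" and \<phi>: "\<phi> \<in> borel_measurable (grassmann_space i)"
    and r: "rotation_matrix r" "r *v last_axis = \<theta>" and \<theta>: "norm \<theta> = 1"
  shows "radon_dual i \<phi> \<theta> = (\<integral>\<gamma>. \<phi> ((\<lambda>x. (r ** \<gamma>) *v x) ` last_plane i) \<partial>haar_prob axis_stabilizer)"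
proof -
  let ?H = "haar_prob (axis_stabilizer :: (real ^ 'n::_ ^ 'n::_) set)" and ?\<rho> = "rotation_to \<theta>"
  define u where "u = transpose r ** ?\<rho>"
  note \<rho> = rotation_to[OF n \<theta>]
  note ort = rotation_orthogonal[OF r(1)]
  have "u *v last_axis = transpose r *v (r *v last_axis)"
    by (simp only: u_def matrix_vector_mul_assoc[symmetric] \<rho>(2) r(2))
  also have "\<dots> = last_axis" by (rule orthogonal_cancel(4)[OF ort])
  finally have "u *v last_axis = last_axis" .
  moreover have "rotation_matrix u"
    unfolding u_def using \<rho>(1) r(1) by (intro rotation_mult rotation_transpose)
  ultimately have u: "u \<in> axis_stabilizer" by (simp add: axis_stabilizer_def)
  have ru: "r ** u = ?\<rho>" unfolding u_def by (rule orthogonal_cancel(5)[OF ort])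
  have m: "(\<lambda>\<gamma>. \<phi> ((\<lambda>x. (r ** \<gamma>) *v x) ` last_plane i)) \<in> borel_measurable ?H"
  proof (rule measurable_compose[OF orbit_measurable[OF last_plane(1)[OF i]] \<phi>])
    show "(\<lambda>\<gamma>. r ** \<gamma>) \<in> borel_measurable ?H"
      using haar_axis_stabilizer(6) by measurable
    fix \<gamma> assume "\<gamma> \<in> space ?H"
    then have "\<gamma> \<in> axis_stabilizer" by (simp only: haar_axis_stabilizer(3))
    then show "rotation_matrix (r ** \<gamma>)" using r(1) by (simp add: axis_stabilizer_def rotation_mult)
  qed
  have "radon_dual i \<phi> \<theta> = (\<integral>\<gamma>. \<phi> ((\<lambda>x. (r ** (u ** \<gamma>)) *v x) ` last_plane i) \<partial>?H)"
    unfolding radon_dual_def by (simp only: matrix_mul_assoc ru)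
  also have "\<dots> = (\<integral>\<gamma>. \<phi> ((\<lambda>x. (r ** \<gamma>) *v x) ` last_plane i) \<partial>distr ?H ?H (\<lambda>\<gamma>. u ** \<gamma>))"
    by (rule integral_distr[OF haar_axis_stabilizer(4)[OF u] m, symmetric])
  finally show ?thesis
    unfolding haar_axis_stabilizer(5)[OF u] .
qed

lemma radon_dual_L1_bounded:
  assumes n: "CARD('n::{finite, linorder}) \<ge> 2" and i: "0 < i" "i \<le> CARD('n)"
  shows "L1_bounded_operator (grassmann_measure i) (sphere_measure :: (real ^ 'n::_) measure)
    (radon_dual i :: (_ \<Rightarrow> 'c::{real_normed_field, banach, second_countable_topology}) \<Rightarrow> _)"
proof -
  let ?k = "Max (UNIV :: 'n set)" and ?H = "haar_prob (axis_stabilizer :: (real ^ 'n::_ ^ 'n::_) set)"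
  let ?S = "sphere_measure :: (real ^ 'n::_) measure"
  interpret S: prob_space ?S by (rule sphere_measure(1)[OF n])
  interpret H: prob_space ?H by (rule haar_axis_stabilizer(1))
  interpret P: pair_prob_space ?S ?H ..
  have "UNIV \<noteq> {?k}"
  proof
    assume "UNIV = {?k}"
    then have "CARD('n) = card {?k}" by (rule arg_cong)
    then show False using n by simp
  qed
  then obtain l where l: "?k \<noteq> l" by (metis UNIV_eq_I singleton_iff)
  let ?r = "axis_rotation ?k l"
  define h where "h \<phi> p = \<phi> ((\<lambda>x. (?r (fst p) ** snd p) *v x) ` last_plane i)"
    for \<phi> :: "(real ^ 'n::_) set \<Rightarrow> 'c" and p :: "(real ^ 'n::_) \<times> (real ^ 'n::_ ^ 'n::_)"
  note D = dual_disintegration[OF n i(1) last_plane(1)[OF i(2)] l]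
  have sets: "sets (grassmann_measure i :: (real ^ 'n::_) set measure) = sets (grassmann_space i)"
    by (rule grassmann_measure(2)[OF i])
  have meas: "\<phi> \<in> borel_measurable (grassmann_space i)" if "integrable (grassmann_measure i) \<phi>" for \<phi> :: "(real ^ 'n::_) set \<Rightarrow> 'c"
    using borel_measurable_integrable[OF that] by (subst (asm) measurable_cong_sets[OF sets refl])
  have h: "integrable (?S \<Otimes>\<^sub>M ?H) (h \<phi>)" if "integrable (grassmann_measure i) \<phi>" for \<phi>
    using that meas[OF that] unfolding D(2) h_def
    by (subst (asm) integrable_distr_eq[OF D(1)]) (simp_all add: case_prod_unfold)
  have hn: "(\<integral>p. norm (h \<phi> p) \<partial>(?S \<Otimes>\<^sub>M ?H)) = (\<integral>\<xi>. norm (\<phi> \<xi>) \<partial>grassmann_measure i)"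
    if "integrable (grassmann_measure i) \<phi>" for \<phi>
    unfolding D(2) h_def using meas[OF that] by (subst integral_distr[OF D(1)]) (simp_all add: case_prod_unfold)
  have ac: "axes_comp ({} :: 'n set) = UNIV" by (auto simp: axes_comp_def orthogonal_comp_def)
  have r: "rotation_matrix (?r \<theta>)" "?r \<theta> *v last_axis = \<theta>" if "norm \<theta> = 1" for \<theta>
    using axis_rotation[of ?k "{}" l \<theta>] l that by (simp_all add: ac fix_group_def last_axis_def)
  have dual: "radon_dual i \<phi> \<theta> = (\<integral>\<gamma>. h \<phi> (\<theta>, \<gamma>) \<partial>?H)"
    if "integrable (grassmann_measure i) \<phi>" "\<theta> \<in> space ?S" for \<phi> \<theta>
    using radon_dual_eq[OF n i(2) meas[OF that(1)] r] that(2)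
    by (simp add: sphere_measure(3)[OF n] h_def)
  have int: "integrable ?S (radon_dual i \<phi>)" if \<phi>: "integrable (grassmann_measure i) \<phi>" for \<phi> :: "(real ^ 'n::_) set \<Rightarrow> 'c"
    using P.integrable_fst'[OF h[OF \<phi>]]
    by (rule Bochner_Integration.integrable_cong[THEN iffD1, rotated -1]) (simp_all add: dual[OF \<phi>])
  show ?thesis
    unfolding L1_bounded_operator_def
  proof (intro conjI allI impI)
    fix \<phi> \<psi> :: "(real ^ 'n::_) set \<Rightarrow> 'c" and a b
    assume \<phi>: "integrable (grassmann_measure i) \<phi>" and \<psi>: "integrable (grassmann_measure i) \<psi>"
    have \<phi>\<psi>: "integrable (grassmann_measure i) (\<lambda>x. a * \<phi> x + b * \<psi> x)"
      using \<phi> \<psi> by auto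
    show "AE \<theta> in ?S. radon_dual i (\<lambda>x. a * \<phi> x + b * \<psi> x) \<theta> = a * radon_dual i \<phi> \<theta> + b * radon_dual i \<psi> \<theta>"
      using P.AE_integrable_fst'[OF h[OF \<phi>]] P.AE_integrable_fst'[OF h[OF \<psi>]] AE_space
    proof eventually_elim
      case (elim \<theta>)
      have "h (\<lambda>x. a * \<phi> x + b * \<psi> x) p = a * h \<phi> p + b * h \<psi> p" for p
        by (simp add: h_def)
      then show ?case
        unfolding dual[OF \<phi> elim(3)] dual[OF \<psi> elim(3)] dual[OF \<phi>\<psi> elim(3)]
        using elim(1,2) by simp
    qed
  next
    have "(\<integral>\<theta>. norm (radon_dual i \<phi> \<theta>) \<partial>?S) \<le> (\<integral>\<xi>. norm (\<phi> \<xi>) \<partial>grassmann_measure i)"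
      if \<phi>: "integrable (grassmann_measure i) \<phi>" for \<phi> :: "(real ^ 'n::_) set \<Rightarrow> 'c"
    proof -
      have "(\<integral>\<theta>. norm (radon_dual i \<phi> \<theta>) \<partial>?S) \<le> (\<integral>\<theta>. (\<integral>\<gamma>. norm (h \<phi> (\<theta>, \<gamma>)) \<partial>?H) \<partial>?S)"
        using int[OF \<phi>] P.integrable_fst'[OF integrable_norm[OF h[OF \<phi>]]]
        by (intro integral_mono) (auto simp: dual[OF \<phi>] intro: integral_norm_bound)
      also have "\<dots> = (\<integral>\<xi>. norm (\<phi> \<xi>) \<partial>grassmann_measure i)"
        using P.integral_fst'[OF integrable_norm[OF h[OF \<phi>]]] hn[OF \<phi>] by simp
      finally show ?thesis .
    qed
    then show "\<exists>C. \<forall>\<phi> :: (real ^ 'n::_) set \<Rightarrow> 'c. integrable (grassmann_measure i) \<phi> \<longrightarrow>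
      (\<integral>\<theta>. norm (radon_dual i \<phi> \<theta>) \<partial>?S) \<le> C * (\<integral>\<xi>. norm (\<phi> \<xi>) \<partial>grassmann_measure i)"
      by (intro exI[of _ 1] allI impI) simp
  qed (rule int)
qed

lemma radon_dual_L1:
  fixes \<phi> :: "(real ^ 'n::{finite, linorder}) set \<Rightarrow> 'c::{real_normed_field, banach, second_countable_topology}"
  assumes n: "CARD('n) \<ge> 2" and i: "0 < i" "i \<le> CARD('n)" and \<phi>: "integrable (grassmann_measure i) \<phi>"
  shows "integrable sphere_measure (radon_dual_L1 i \<phi>)"
    and "AE \<theta> in sphere_measure. radon_dual_L1 i \<phi> \<theta> = radon_dual i \<phi> \<theta>"
proof -
  note G = grassmann_measure[OF i]
  have sets: "sets (grassmann_measure i :: (real ^ 'n::_) set measure) = sets (vimage_algebra (grassmannian i) projection borel)"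
    using G(2) sets_grassmann_space by simp
  note E = L1_extension_eq_direct[OF prob_space.finite_measure[OF G(1)] sets grassmann_topology_def radon_dual_L1_bounded[OF n i],
    folded radon_dual_L1_def]
  show "integrable sphere_measure (radon_dual_L1 i \<phi>)" by (rule L1_bounded_operatorD(1)[OF E(1) \<phi>])
  show "AE \<theta> in sphere_measure. radon_dual_L1 i \<phi> \<theta> = radon_dual i \<phi> \<theta>" by (rule E(2)[OF \<phi>])
qed

section \<open>Passing to orthogonal complements\<close>

lemma orthogonal_comp_grassmannian:
  fixes \<xi> :: "(real ^ 'n) set"
  shows "\<xi> \<in> grassmannian i \<Longrightarrow> \<xi>\<^sup>\<bottom> \<in> grassmannian (CARD('n) - i)"
  using dim_orthogonal_comp[of \<xi>] by (auto simp: grassmannian_def subspace_orthogonal_comp)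

lemma grassmann_measure_orthogonal_comp:
  assumes i: "0 < i" "i < CARD('n)"
  shows "orthogonal_comp \<in> measurable (grassmann_measure i) (grassmann_space (CARD('n) - i) :: (real ^ 'n) set measure)"
    and "distr (grassmann_measure i) (grassmann_space (CARD('n) - i)) orthogonal_comp
      = (grassmann_measure (CARD('n) - i) :: (real ^ 'n) set measure)"
proof -
  let ?j = "CARD('n) - i" and ?G = "grassmann_measure i :: (real ^ 'n) set measure"
  have i': "i \<le> CARD('n)" using i by simp
  note G = grassmann_measure[OF i(1) i']
  have "orthogonal_comp \<in> measurable (grassmann_space i) (grassmann_space ?j :: (real ^ 'n) set measure)"
  proof (rule measurable_grassmann_spaceI)
    have "(\<lambda>\<xi>. mat 1 - projection \<xi>) \<in> borel_measurable (grassmann_space i)"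
      using projection_measurable by measurable
    then show "(\<lambda>\<xi>::(real ^ 'n) set. projection (\<xi>\<^sup>\<bottom>)) \<in> borel_measurable (grassmann_space i)"
      by (rule measurable_cong[THEN iffD1, rotated]) (simp add: projection_orthogonal_comp grassmannian_def)
  qed (use orthogonal_comp_grassmannian in auto)
  then show m: "orthogonal_comp \<in> measurable ?G (grassmann_space ?j)"
    by (rule measurable_cong_sets[OF G(2) refl, THEN equalityD2, THEN subsetD])
  show "distr ?G (grassmann_space ?j) orthogonal_comp = grassmann_measure ?j"
  proof (rule grassmann_measure_eqI[symmetric])
    show "prob_space (distr ?G (grassmann_space ?j) orthogonal_comp)"
      by (rule prob_space.prob_space_distr[OF G(1) m])
    fix g :: "real ^ 'n ^ 'n" assume g: "rotation_matrix g"
    let ?g = "\<lambda>\<xi>. (\<lambda>x. g *v x) ` \<xi>"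
    have mg: "?g \<in> measurable ?G ?G"
      by (rule measurable_cong_sets[OF G(2) G(2), THEN equalityD2, THEN subsetD, OF grassmann_action_measurable[OF g]])
    have "distr (distr ?G (grassmann_space ?j) orthogonal_comp) (grassmann_space ?j) ?g
      = distr ?G (grassmann_space ?j) (\<lambda>\<xi>. ?g (\<xi>\<^sup>\<bottom>))"
      using m grassmann_action_measurable[OF g] by (subst distr_distr) (auto simp: o_def)
    also have "\<dots> = distr ?G (grassmann_space ?j) (\<lambda>\<xi>. (?g \<xi>)\<^sup>\<bottom>)"
      by (simp add: orthogonal_comp_image[OF rotation_orthogonal[OF g]])
    also have "\<dots> = distr (distr ?G ?G ?g) (grassmann_space ?j) orthogonal_comp"
      using m mg by (subst distr_distr) (auto simp: o_def)
    also have "distr ?G ?G ?g = ?G"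
      using G(3)[OF g] distr_cong[of ?G ?G ?G "grassmann_space i" ?g ?g] G(2) by simp
    finally show "distr (distr ?G (grassmann_space ?j) orthogonal_comp) (grassmann_space ?j) ?g
      = distr ?G (grassmann_space ?j) orthogonal_comp" .
  qed (use i in auto)
qed

lemma sphere_measure_hyperplane:
  assumes n: "CARD('n) \<ge> 2"
  shows "(\<lambda>u. {u}\<^sup>\<bottom>) \<in> measurable (sphere_measure :: (real ^ 'n) measure) (grassmann_space (CARD('n) - 1))"
    and "distr (sphere_measure :: (real ^ 'n) measure) (grassmann_space (CARD('n) - 1)) (\<lambda>u. {u}\<^sup>\<bottom>)
      = grassmann_measure (CARD('n) - 1)"
proof -
  let ?j = "CARD('n) - 1" and ?S = "sphere_measure :: (real ^ 'n) measure" and ?p = "\<lambda>u. {u}\<^sup>\<bottom>"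
  note S = sphere_measure[OF n]
  have gr: "{u}\<^sup>\<bottom> \<in> grassmannian ?j" if "norm u = 1" for u :: "real ^ 'n"
  proof -
    have "u \<noteq> 0" using that by auto
    then have "dim (span {u}) = 1" by (simp add: dim_span_eq_card_independent)
    then have "span {u} \<in> grassmannian 1" by (simp add: grassmannian_def)
    moreover have "(span {u})\<^sup>\<bottom> = {u}\<^sup>\<bottom>"
    proof
      show "(span {u})\<^sup>\<bottom> \<subseteq> {u}\<^sup>\<bottom>" by (intro orthogonal_comp_anti_mono) (simp add: span_base)
      show "{u}\<^sup>\<bottom> \<subseteq> (span {u})\<^sup>\<bottom>"
        by (auto simp: orthogonal_comp_def orthogonal_def span_singleton)
    qed
    ultimately show ?thesis using orthogonal_comp_grassmannian[of "span {u}" 1] by simp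
  qed
  show m: "?p \<in> measurable ?S (grassmann_space ?j)"
  proof (rule measurable_grassmann_spaceI)
    have "(\<lambda>u :: real ^ 'n. \<chi> i j. (if i = j then 1 else 0) - u $ i * u $ j) \<in> borel_measurable borel"
      by (intro borel_measurable_continuous_onI continuous_intros)
    from measurable_compose[OF sphere_measure_ident_measurable[OF n] this]
    show "(\<lambda>u. projection ({u}\<^sup>\<bottom>)) \<in> borel_measurable ?S"
      by (rule measurable_cong[THEN iffD1, rotated]) (simp add: projection_hyperplane S(3))
  qed (use gr S(3) in auto)
  show "distr ?S (grassmann_space ?j) ?p = grassmann_measure ?j"
  proof (rule grassmann_measure_eqI[symmetric])
    show "prob_space (distr ?S (grassmann_space ?j) ?p)"
      by (rule prob_space.prob_space_distr[OF S(1) m])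
    fix g :: "real ^ 'n ^ 'n" assume g: "rotation_matrix g"
    let ?g = "\<lambda>\<xi>. (\<lambda>x. g *v x) ` \<xi>"
    have "(\<lambda>x. g *v x) \<in> measurable (restrict_space borel (sphere 0 1)) (restrict_space borel (sphere 0 1))"
      by (intro measurable_restrict_space2 measurable_restrict_space1)
        (auto simp: space_restrict_space orthogonal_matrix_norm[OF rotation_orthogonal[OF g]])
    then have mg: "(\<lambda>x. g *v x) \<in> measurable ?S ?S"
      by (rule measurable_cong_sets[OF S(2) S(2), THEN equalityD2, THEN subsetD])
    have "distr (distr ?S (grassmann_space ?j) ?p) (grassmann_space ?j) ?g
      = distr ?S (grassmann_space ?j) (\<lambda>u. ?g ({u}\<^sup>\<bottom>))"
      using m grassmann_action_measurable[OF g] by (subst distr_distr) (auto simp: o_def)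
    also have "\<dots> = distr ?S (grassmann_space ?j) (\<lambda>u. {g *v u}\<^sup>\<bottom>)"
      using orthogonal_comp_image[OF rotation_orthogonal[OF g], of "{_}"] by simp
    also have "\<dots> = distr (distr ?S ?S (\<lambda>x. g *v x)) (grassmann_space ?j) ?p"
      using m mg by (subst distr_distr) (auto simp: o_def)
    finally show "distr (distr ?S (grassmann_space ?j) ?p) (grassmann_space ?j) ?g = distr ?S (grassmann_space ?j) ?p"
      unfolding sphere_measure_invariant[OF n g] .
  qed (use n in auto)
qed

text \<open>
  With \<open>r = rotation_to \<theta>\<close>, a rotation \<open>g\<close> fixing \<open>\<theta>\<close> moves the random subspace in the same way as
  left translation of \<open>\<gamma>\<close> by \<open>r\<^sup>T g r\<close>, which lies in the stabiliser of the last axis. So a random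
  unit vector of the random subspace is uniform on the sphere of \<open>{\<theta>}\<^sup>\<bottom>\<close> whenever these rotations
  are transitive there; the plane is treated separately.
\<close>

lemma radon_dual_radon_orthogonal_comp:
  fixes f :: "real ^ 'n::{finite, linorder} \<Rightarrow> 'c::{real_normed_field, banach, second_countable_topology}"
  assumes n: "CARD('n) \<ge> 2" and i: "0 < i" "i < CARD('n)"
    and \<theta>: "norm \<theta> = 1" and f: "integrable (section_measure ({\<theta>}\<^sup>\<bottom>)) f"
  shows "radon_dual i (\<lambda>\<xi>. radon f (\<xi>\<^sup>\<bottom>)) \<theta> = radon f ({\<theta>}\<^sup>\<bottom>)"
proof -
  let ?H = "haar_prob (axis_stabilizer :: (real ^ 'n::_ ^ 'n::_) set)" and ?\<rho> = "rotation_to \<theta>"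
  let ?\<eta> = "last_plane i :: (real ^ 'n::_) set"
  interpret H: prob_space ?H by (rule haar_axis_stabilizer(1))
  note \<rho> = rotation_to[OF n \<theta>]
  define \<xi> where "\<xi> \<gamma> = ((\<lambda>x. (?\<rho> ** \<gamma>) *v x) ` ?\<eta>)\<^sup>\<bottom>" for \<gamma>
  have \<eta>: "?\<eta> \<in> grassmannian i" "last_axis \<in> ?\<eta>" using last_plane[where 'n='n and i=i] i by simp_all
  have rot: "rotation_matrix (?\<rho> ** \<gamma>)" if "\<gamma> \<in> axis_stabilizer" for \<gamma>
    using that \<rho>(1) by (simp add: axis_stabilizer_def rotation_mult)
  have \<theta>_in: "\<theta> \<in> (\<lambda>x. (?\<rho> ** \<gamma>) *v x) ` ?\<eta>" if "\<gamma> \<in> axis_stabilizer" for \<gamma>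
  proof
    show "\<theta> = (?\<rho> ** \<gamma>) *v last_axis"
      using that \<rho>(2) by (simp add: axis_stabilizer_def matrix_vector_mul_assoc[symmetric])
  qed (rule \<eta>)
  have gr: "\<xi> \<gamma> \<in> grassmannian (CARD('n) - i)" if "\<gamma> \<in> axis_stabilizer" for \<gamma>
    unfolding \<xi>_def by (intro orthogonal_comp_grassmannian grassmannian_image rot that \<eta>)
  interpret subspace_family ?H \<xi> "{\<theta>}\<^sup>\<bottom>"
  proof
    show "subspace ({\<theta>}\<^sup>\<bottom>)" by (rule subspace_orthogonal_comp)
    fix \<gamma> assume "\<gamma> \<in> space ?H"
    then have \<gamma>: "\<gamma> \<in> axis_stabilizer" by (simp add: haar_axis_stabilizer(3))
    show "subspace (\<xi> \<gamma>)" "0 < dim (\<xi> \<gamma>)" using gr[OF \<gamma>] i by (auto simp: grassmannian_def)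
    show "\<xi> \<gamma> \<subseteq> {\<theta>}\<^sup>\<bottom>" unfolding \<xi>_def using \<theta>_in[OF \<gamma>] by (intro orthogonal_comp_anti_mono) simp
  next
    have "(\<lambda>\<gamma>. ?\<rho> ** \<gamma>) \<in> borel_measurable ?H"
      using haar_axis_stabilizer(6) by measurable
    then have "(\<lambda>\<gamma>. mat 1 - (?\<rho> ** \<gamma>) ** projection ?\<eta> ** transpose (?\<rho> ** \<gamma>)) \<in> borel_measurable ?H"
      by measurable
    then show "(\<lambda>\<gamma>. projection (\<xi> \<gamma>)) \<in> borel_measurable ?H"
    proof (rule measurable_cong[THEN iffD1, rotated])
      fix \<gamma> assume "\<gamma> \<in> space ?H"
      then have o: "orthogonal_matrix (?\<rho> ** \<gamma>)" by (simp add: haar_axis_stabilizer(3) rot rotation_orthogonal)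
      have s: "subspace ?\<eta>" using \<eta> by (simp add: grassmannian_def)
      show "mat 1 - (?\<rho> ** \<gamma>) ** projection ?\<eta> ** transpose (?\<rho> ** \<gamma>) = projection (\<xi> \<gamma>)"
        unfolding \<xi>_def projection_orthogonal_comp[OF subspace_matrix_image[OF s]] projection_image[OF o s] ..
    qed
  qed
  have dual: "radon_dual i (\<lambda>\<xi>. radon f (\<xi>\<^sup>\<bottom>)) \<theta> = (\<integral>\<gamma>. radon f (\<xi> \<gamma>) \<partial>?H)"
    by (simp add: radon_dual_def \<xi>_def)
  show ?thesis
  proof (cases "CARD('n) = 2")
    case True
    then have i1: "i = 1" using i by simp
    \<comment> \<open>In the plane the complement of a line through \<open>\<theta>\<close> is the line \<open>\<theta>\<^sup>\<bottom>\<close>.\<close>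
    have "\<xi> \<gamma> = {\<theta>}\<^sup>\<bottom>" if \<gamma>: "\<gamma> \<in> space ?H" for \<gamma>
    proof (rule subspace_dim_equal[OF sub[OF \<gamma>] V subset[OF \<gamma>]])
      have "dim ({\<theta>}\<^sup>\<bottom>) \<noteq> CARD('n)"
      proof
        assume "dim ({\<theta>}\<^sup>\<bottom>) = CARD('n)"
        then have "{\<theta>}\<^sup>\<bottom> = UNIV" using V dim_eq_full[of "{\<theta>}\<^sup>\<bottom>"] by (simp add: span_eq_iff[THEN iffD2])
        then have "\<theta> \<in> {\<theta>}\<^sup>\<bottom>" by simp
        then show False using \<theta> by (simp add: orthogonal_comp_def orthogonal_self) 
      qed
      moreover have "dim ({\<theta>}\<^sup>\<bottom>) \<le> CARD('n)" using dim_subset_UNIV[of "{\<theta>}\<^sup>\<bottom>"] by simp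
      moreover have "dim (\<xi> \<gamma>) = CARD('n) - i"
        using gr \<gamma> by (simp add: haar_axis_stabilizer(3) grassmannian_def)
      ultimately show "dim ({\<theta>}\<^sup>\<bottom>) \<le> dim (\<xi> \<gamma>)" using True i1 by simp
    qed
    then have "(\<integral>\<gamma>. radon f (\<xi> \<gamma>) \<partial>?H) = (\<integral>\<gamma>. radon f ({\<theta>}\<^sup>\<bottom>) \<partial>?H)"
      by (intro Bochner_Integration.integral_cong) auto
    then show ?thesis unfolding dual by (simp add: H.prob_space)
  next
    case False
    then have n3: "CARD('n) \<ge> 3" using n by simp
    let ?G = "{g. rotation_matrix g \<and> g *v \<theta> = \<theta>}"
    \<comment> \<open>A rotation fixing \<open>\<theta>\<close> moves the random subspace by a translation of \<open>\<gamma>\<close>.\<close>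
    have mix: "mixture ?H \<xi> ({\<theta>}\<^sup>\<bottom>) = section_measure ({\<theta>}\<^sup>\<bottom>)"
    proof (rule mixture_eq_section_measure[OF n, of ?G])
      show "?G \<subseteq> section_group ({\<theta>}\<^sup>\<bottom>)"
      proof
        fix g assume g: "g \<in> ?G"
        then have "(\<lambda>x. g *v x) ` ({\<theta>}\<^sup>\<bottom>) = {\<theta>}\<^sup>\<bottom>"
          using orthogonal_comp_image[of g "{\<theta>}"] by (simp add: rotation_orthogonal)
        with g show "g \<in> section_group ({\<theta>}\<^sup>\<bottom>)" by (simp add: section_group_def)
      qed
    next
      fix x y assume "x \<in> sphere 0 1 \<inter> {\<theta>}\<^sup>\<bottom>" "y \<in> sphere 0 1 \<inter> {\<theta>}\<^sup>\<bottom>"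
      then have "norm x = 1" "x \<bullet> \<theta> = 0" "norm y = 1" "y \<bullet> \<theta> = 0"
        by (auto simp: orthogonal_comp_def orthogonal_def inner_commute)
      then obtain g where "rotation_matrix g" "g *v \<theta> = \<theta>" "g *v x = y"
        by (rule rotation_fixing_transitive_on_equator[OF n3])
      then show "\<exists>g\<in>?G. g *v x = y" by blast
    next
      fix g assume "g \<in> ?G"
      then have g: "rotation_matrix g" "g *v \<theta> = \<theta>" by auto
      define h where "h = transpose ?\<rho> ** (g ** ?\<rho>)"
      note ort = rotation_orthogonal[OF \<rho>(1)]
      have "h *v last_axis = transpose ?\<rho> *v (?\<rho> *v last_axis)"
        by (simp only: h_def matrix_vector_mul_assoc[symmetric] \<rho>(2) g(2))
      also have "\<dots> = last_axis" by (rule orthogonal_cancel(4)[OF ort])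
      finally have "h *v last_axis = last_axis" .
      moreover have "rotation_matrix h"
        unfolding h_def using \<rho>(1) g(1) by (intro rotation_mult rotation_transpose)
      ultimately have h: "h \<in> axis_stabilizer" by (simp add: axis_stabilizer_def)
      have \<rho>h: "?\<rho> ** h = g ** ?\<rho>" unfolding h_def by (rule orthogonal_cancel(5)[OF ort])
      show "\<exists>t\<in>?H \<rightarrow>\<^sub>M ?H. distr ?H ?H t = ?H \<and> (\<forall>\<gamma>\<in>space ?H. \<xi> (t \<gamma>) = (\<lambda>x. g *v x) ` \<xi> \<gamma>)"
      proof (intro bexI[of _ "\<lambda>\<gamma>. h ** \<gamma>"] conjI ballI)
        show "distr ?H ?H (\<lambda>\<gamma>. h ** \<gamma>) = ?H" by (rule haar_axis_stabilizer(5)[OF h])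
        show "(\<lambda>\<gamma>. h ** \<gamma>) \<in> ?H \<rightarrow>\<^sub>M ?H" by (rule haar_axis_stabilizer(4)[OF h])
        fix \<gamma> assume "\<gamma> \<in> space ?H"
        have "?\<rho> ** (h ** \<gamma>) = g ** (?\<rho> ** \<gamma>)"
          by (simp only: matrix_mul_assoc \<rho>h)
        then show "\<xi> (h ** \<gamma>) = (\<lambda>x. g *v x) ` \<xi> \<gamma>"
          unfolding \<xi>_def orthogonal_comp_image[OF rotation_orthogonal[OF g(1)], symmetric]
          by (simp only: image_matrix_mul)
      qed
    qed
    have "(\<integral>\<gamma>. radon f (\<xi> \<gamma>) \<partial>?H) = (\<integral>y. f y \<partial>section_measure ({\<theta>}\<^sup>\<bottom>))"
      using mixture_fubini(3)[OF n, of f] f unfolding mix by blast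
    then show ?thesis unfolding dual by (simp add: radon_def)
  qed
qed

theorem theorem3p7:
  fixes f :: "real ^ 'n::{finite, linorder} \<Rightarrow>
              'c::{real_normed_field, banach, second_countable_topology}"
    and i :: nat
  assumes "CARD('n) \<ge> 2" and "0 < i" and "i < CARD('n)"
    and "integrable sphere_measure f"
  shows "integrable sphere_measure (minkowski_funk_L1 f) \<and>
         integrable sphere_measure (radon_dual_L1 i (radon_perp_L1 (CARD('n) - i) f)) \<and>
         (AE \<theta> in sphere_measure.
            minkowski_funk_L1 f \<theta> = radon_dual_L1 i (radon_perp_L1 (CARD('n) - i) f) \<theta>)"
proof -
  note n = assms(1) and i = assms(2,3) and f = assms(4)
  let ?j = "CARD('n) - i" and ?h = "CARD('n) - 1" and ?S = "sphere_measure :: (real ^ 'n::_) measure"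
  have i': "i \<le> CARD('n)" and j: "0 < ?j" "?j \<le> CARD('n)" and h: "0 < ?h" "?h \<le> CARD('n)" using i n by auto
  \<comment> \<open>Null sets of hyperplanes pull back to null sets of the sphere.\<close>
  note hyp = sphere_measure_hyperplane[OF n]
  have Mf: "minkowski_funk_L1 f = (\<lambda>u. radon_L1 ?h f ({u}\<^sup>\<bottom>))"
    by (simp add: minkowski_funk_L1_def[abs_def])
  have M_int: "integrable ?S (minkowski_funk_L1 f)"
    unfolding Mf using radon_L1(1)[OF n h f] by (intro integrable_distr[OF hyp(1)]) (simp only: hyp(2))
  have M_eq: "AE u in ?S. minkowski_funk_L1 f u = radon f ({u}\<^sup>\<bottom>)"
    unfolding Mf using radon_L1(2)[OF n h f] by (intro AE_distrD[OF hyp(1)]) (simp only: hyp(2))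
  have f_sec: "AE u in ?S. integrable (section_measure ({u}\<^sup>\<bottom>)) f"
    using radon_integrable(1)[OF n h f] by (intro AE_distrD[OF hyp(1)]) (simp only: hyp(2))
  \<comment> \<open>Null sets of complements pull back to null sets of subspaces.\<close>
  note perp = grassmann_measure_orthogonal_comp[OF i]
  have Pf: "radon_perp_L1 ?j f = (\<lambda>\<xi>. radon_L1 ?j f (\<xi>\<^sup>\<bottom>))"
    by (simp add: radon_perp_L1_def[abs_def])
  have P_int: "integrable (grassmann_measure i) (radon_perp_L1 ?j f)"
    unfolding Pf using radon_L1(1)[OF n j f] by (intro integrable_distr[OF perp(1)]) (simp only: perp(2))
  have P_int': "integrable (grassmann_measure i) (\<lambda>\<xi>. radon f (\<xi>\<^sup>\<bottom>))"
    using radon_integrable(2)[OF n j f] by (intro integrable_distr[OF perp(1)]) (simp only: perp(2))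
  have P_eq: "AE \<xi> in grassmann_measure i. radon_perp_L1 ?j f \<xi> = radon f (\<xi>\<^sup>\<bottom>)"
    unfolding Pf using radon_L1(2)[OF n j f] by (intro AE_distrD[OF perp(1)]) (simp only: perp(2))
  note dual = radon_dual_L1[OF n i(1) i' P_int]
  have "AE \<theta> in ?S. radon_dual i (radon_perp_L1 ?j f) \<theta> = radon_dual i (\<lambda>\<xi>. radon f (\<xi>\<^sup>\<bottom>)) \<theta>"
    by (rule L1_bounded_operator_AE_cong[OF radon_dual_L1_bounded[OF n i(1) i'] P_int P_int' P_eq])
  with dual(2) M_eq f_sec AE_space
  have "AE \<theta> in ?S. minkowski_funk_L1 f \<theta> = radon_dual_L1 i (radon_perp_L1 ?j f) \<theta>"
  proof eventually_elim
    case (elim \<theta>)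
    then show ?case
      using radon_dual_radon_orthogonal_comp[OF n i, of \<theta> f] by (simp add: sphere_measure(3)[OF n])
  qed
  with M_int dual(1) show ?thesis by simp
qed

end
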